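(* Let $\theta\in\{2,3,\dots\}$ and define \[ \beta_{c}(\theta)=\begin{cases}2,&\theta=2,\\ 2\big(\frac{\theta-1}{\theta-2}\big)\log(\theta-1),&\theta\ge3.\end{cases} \] Let $z(\beta,h)=\lim_{n\to\infty}\frac1n\log Z_n(\beta,h)$ and $z^+(\beta)=\lim_{h\downarrow0}\frac{z(\beta,h)-z(\beta,0)}{h}$. Then $z^+(\beta)=0$ if $\beta<\beta_c$, or if $\theta=2$ and $\beta=\beta_c$; and $z^+(\beta)>0$ if $\beta>\beta_c$, or if $\theta\ge3$ and $\beta=\beta_c$.
   Context: Let $\beta>0$, $h\in\mathbb R$, $V=\{1,\dots,n\}$ and $E$ the set of unordered pairs of distinct elements of $V$. Under a probability measure $\mathbb P$ (expectation $\mathbb E$), let $\omega=(\omega_{xy}:xy\in E)$ be independent rate-1 Poisson point processes on $[0,\beta/n]$. Let $\sigma(\omega)\in\mathcal S_n$ be the composition, in time order, of the transpositions $(x,y)$ over all points $t\in\omega_{xy}$, $xy\in E$. Let $\mathcal C(\omega)$ be the set of cycles of $\sigma(\omega)$ (including fixed points), and $|\gamma|$ the size of a cycle $\gamma$. Define \[ Z_n(\beta,h)=e^{-(h/\theta)n}\,\mathbb E\Big[\prod_{\gamma\in\mathcal C(\omega)}\big(e^{h|\gamma|}+\theta-1\big)\Big]. \] The limit $z(\beta,h)=\lim_n\frac1n\log Z_n(\beta,h)$ exists for all $\beta>0,h\in\mathbb R$. *)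

theory Defs
  imports "HOL-Analysis.Analysis" "HOL-Combinatorics.Transposition" "HOL-Combinatorics.Orbits"
begin

definition edges :: "nat \<Rightarrow> (nat \<times> nat) set" where
  "edges n = {(x,y). 1 \<le> x \<and> x < y \<and> y \<le> n}"

text \<open>Composition in time order of the transpositions of a sequence of edges
  (first edge = earliest point, applied first).\<close>
definition perm_of_seq :: "(nat \<times> nat) list \<Rightarrow> nat \<Rightarrow> nat" where
  "perm_of_seq es = fold (\<lambda>e \<sigma>. Transposition.transpose (fst e) (snd e) \<circ> \<sigma>) es id"

definition cycles_of :: "nat \<Rightarrow> (nat \<Rightarrow> nat) \<Rightarrow> nat set set" where
  "cycles_of n \<sigma> = (\<lambda>x. orbit \<sigma> x) ` {1..n}"

definition cycle_weight :: "nat \<Rightarrow> real \<Rightarrow> nat \<Rightarrow> (nat \<Rightarrow> nat) \<Rightarrow> real" where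
  "cycle_weight \<theta> h n \<sigma> = (\<Prod>\<gamma>\<in>cycles_of n \<sigma>. exp (h * real (card \<gamma>)) + real \<theta> - 1)"

text \<open>Expectation over independent rate-1 Poisson processes on [0, \<beta>/n] indexed by E:
  the total number of points k is Poisson(|E| \<beta>/n) and, given k, the time-ordered
  sequence of edges is uniform on E^k. Hence
  E[F(\<sigma>)] = \<Sum>_k e^{-|E|\<beta>/n} (\<beta>/n)^k / k! \<Sum>_{es \<in> E^k} F(\<sigma>(es)).\<close>
definition Z :: "nat \<Rightarrow> nat \<Rightarrow> real \<Rightarrow> real \<Rightarrow> real" where
  "Z \<theta> n \<beta> h = exp (- (h / real \<theta>) * real n) *
     (\<Sum>k. exp (- real (card (edges n)) * \<beta> / real n) * (\<beta> / real n) ^ k / fact k *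
        (\<Sum>es\<in>{es. set es \<subseteq> edges n \<and> length es = k}. cycle_weight \<theta> h n (perm_of_seq es)))"

definition z :: "nat \<Rightarrow> real \<Rightarrow> real \<Rightarrow> real" where
  "z \<theta> \<beta> h = lim (\<lambda>n. ln (Z \<theta> n \<beta> h) / real n)"

definition beta_c :: "nat \<Rightarrow> real" where
  "beta_c \<theta> = (if \<theta> = 2 then 2
     else 2 * ((real \<theta> - 1) / (real \<theta> - 2)) * ln (real \<theta> - 1))"

end

theory Submission
  imports Defs "HOL-Real_Asymp.Real_Asymp"
begin

text \<open>
  Counting colourings \<open>c : {1..n} \<rightarrow> {0..<\<theta>}\<close> with \<open>c \<circ> \<sigma> = c\<close>, weighted by \<open>exp h\<close> to the number of
  vertices of one chosen colour, turns \<open>Z\<close> into a trace of \<open>exp ((\<beta>/n) \<Sum> (T\<^sub>x\<^sub>y - 1))\<close> on a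
  tensor power, and the free energy becomes that of the mean-field Potts model: for \<open>h \<ge> 0\<close>,
  \<open>z(\<beta>,h) = sup\<^sub>x [S(x) + \<beta>/2 \<Sum> x\<^sub>i\<^sup>2 + h max x\<^sub>i] - \<beta>/2 - h/\<theta>\<close> over probability vectors \<open>x\<close> with entropy \<open>S(x)\<close>.

  Lower bound: keeping only the edge sequences all of whose edges are monochromatic for \<open>c\<close>
  leaves the classical Potts partition function, to which Gibbs' variational principle applies.

  Upper bound: the number of fixed colourings with colour counts \<open>\<mu>\<close> is a trace over a weight
  space of \<open>gl\<^sub>\<theta>\<close>. The commutation relations of the raising operators, used only through an
  injection between finite sets, bound the trace of the next power of \<open>\<Sum> T\<^sub>x\<^sub>y\<close> on the space of \<open>\<mu>\<close> by
  \<open>\<Sum> \<mu>\<^sub>i\<^sup>2 / 2\<close> times the present one, plus traces on the spaces of \<open>\<mu> + r(e\<^sub>i - e\<^sub>j)\<close> with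
  \<open>\<mu>\<^sub>i \<ge> \<mu>\<^sub>j\<close>. An explicit supersolution of this system costs only a bounded factor.

  The right derivative at \<open>h = 0\<close> is positive or zero according to whether a maximiser at
  \<open>h = 0\<close> other than the uniform vector exists. This is decided by the sharp inequality
  \<open>ln \<theta> - S(x) \<ge> \<beta>\<^sub>c/2 (\<Sum> x\<^sub>i\<^sup>2 - 1/\<theta>)\<close>, which a tangent line argument reduces to vectors
  with all but one entry equal.
\<close>

section \<open>Colourings fixed by a permutation\<close>

definition colourings :: "nat \<Rightarrow> nat \<Rightarrow> (nat \<Rightarrow> nat) set" where
  "colourings \<theta> n = {1..n} \<rightarrow>\<^sub>E {..<\<theta>}"

definition colour_count :: "nat \<Rightarrow> (nat \<Rightarrow> nat) \<Rightarrow> nat \<Rightarrow> nat" where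
  "colour_count n c i = card {v \<in> {1..n}. c v = i}"

text \<open>Indexes a basis of the weight space of \<open>\<mu>\<close>. As \<open>\<mu>\<close> is
  compared as a function on all of \<open>nat\<close>, the class is empty unless
  \<open>\<mu>\<close> vanishes from \<open>\<theta>\<close> on.\<close>

definition colour_class :: "nat \<Rightarrow> nat \<Rightarrow> (nat \<Rightarrow> nat) \<Rightarrow> (nat \<Rightarrow> nat) set" where
  "colour_class \<theta> n \<mu> = {c \<in> colourings \<theta> n. colour_count n c = \<mu>}"

lemma finite_edges [simp]: "finite (edges n)"
  by (rule finite_subset[of _ "{1..n} \<times> {1..n}"]) (auto simp: edges_def)

lemma card_edges: "2 * card (edges n) = n * (n - 1)"
proof (induction n)
  case 0
  have "edges 0 = {}" by (auto simp: edges_def)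
  then show ?case by simp
next
  case (Suc n)
  have "edges (Suc n) = edges n \<union> (\<lambda>x. (x, Suc n)) ` {1..n}"
    by (auto simp: edges_def)
  moreover have "edges n \<inter> (\<lambda>x. (x, Suc n)) ` {1..n} = {}"
    by (auto simp: edges_def)
  moreover have "card ((\<lambda>x. (x, Suc n)) ` {1..n}) = n"
    by (subst card_image) (auto simp: inj_on_def)
  ultimately have "card (edges (Suc n)) = card (edges n) + n"
    by (simp add: card_Un_disjoint)
  with Suc show ?case by (cases n) auto
qed

lemma finite_colourings [simp]: "finite (colourings \<theta> n)"
  by (simp add: colourings_def finite_PiE)

lemma finite_colour_class [simp]: "finite (colour_class \<theta> n \<mu>)"
  by (simp add: colour_class_def)

lemma perm_of_seq_Nil [simp]: "perm_of_seq [] = id"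
  by (simp add: perm_of_seq_def)

text \<open>The head acts first and so stands on the right: splitting off the head of a sequence
  multiplies the permutation of the rest from the right.\<close>

lemma perm_of_seq_Cons:
  "perm_of_seq (e # es) = perm_of_seq es \<circ> Transposition.transpose (fst e) (snd e)"
proof -
  have "fold (\<lambda>e \<sigma>. Transposition.transpose (fst e) (snd e) \<circ> \<sigma>) es \<tau>
      = fold (\<lambda>e \<sigma>. Transposition.transpose (fst e) (snd e) \<circ> \<sigma>) es id \<circ> \<tau>"
    for \<tau> :: "nat \<Rightarrow> nat"
  proof (induction es arbitrary: \<tau>)
    case (Cons a es)
    show ?case
      using Cons[of "Transposition.transpose (fst a) (snd a) \<circ> \<tau>"]
            Cons[of "Transposition.transpose (fst a) (snd a)"]
      by (simp add: comp_assoc)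
  qed auto
  from this[of "Transposition.transpose (fst e) (snd e)"] show ?thesis
    by (simp add: perm_of_seq_def)
qed

lemma permutes_perm_of_seq:
  assumes "set es \<subseteq> edges n"
  shows "perm_of_seq es permutes {1..n}"
  using assms
proof (induction es)
  case (Cons e es)
  then have "Transposition.transpose (fst e) (snd e) permutes {1..n}"
    by (intro permutes_swap_id) (auto simp: edges_def)
  with Cons show ?case
    unfolding perm_of_seq_Cons by (intro permutes_compose) auto
qed (simp add: permutes_id)

text \<open>The trace of \<open>\<sigma> D\<^sup>\<otimes>\<^sup>n\<close> on \<open>(\<real>\<^sup>\<theta>)\<^sup>\<otimes>\<^sup>n\<close>,
  where \<open>D\<close> is diagonal with entry \<open>exp h\<close> at the colour \<open>l\<close> and \<open>1\<close> elsewhere.\<close>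
lemma cycle_weight_eq_sum_colourings:
  assumes \<sigma>: "\<sigma> permutes {1..n}" and l: "l < \<theta>"
  shows "cycle_weight \<theta> h n \<sigma> =
    (\<Sum>c | c \<in> colourings \<theta> n \<and> c \<circ> \<sigma> = c. exp (h * real (colour_count n c l)))"
proof -
  let ?C = "cycles_of n \<sigma>"
  have perm: "permutation \<sigma>" using \<sigma> permutation_permutes by blast
  have self: "x \<in> orbit \<sigma> x" for x by (rule permutation_self_in_orbit[OF perm])
  have orb: "orbit \<sigma> y = orbit \<sigma> x" if "y \<in> orbit \<sigma> x" for x y
    using orbit_cyclic_eq3[OF cyclic_on_orbit'[OF perm] that] .
  have sub: "orbit \<sigma> x \<subseteq> {1..n}" if "x \<in> {1..n}" for x
    using permutes_orbit_subset[OF \<sigma> that] .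
  have fC: "finite ?C" by (simp add: cycles_of_def)
  \<comment> \<open>\<open>SOME\<close> picks a representative of each cycle. A colouring fixed by
    \<sigma> is constant on cycles, so any choice recovers its value there.\<close>
  have some: "orbit \<sigma> (SOME v. v \<in> \<gamma>) = \<gamma> \<and> (SOME v. v \<in> \<gamma>) \<in> \<gamma>" if "\<gamma> \<in> ?C" for \<gamma>
  proof -
    from that obtain x where x: "\<gamma> = orbit \<sigma> x" by (auto simp: cycles_of_def)
    have "(SOME v. v \<in> \<gamma>) \<in> \<gamma>" unfolding x by (rule someI[of _ x]) (rule self)
    with orb x show ?thesis by blast
  qed
  have subC: "\<gamma> \<subseteq> {1..n}" if "\<gamma> \<in> ?C" for \<gamma>
  proof -
    from that obtain x where "x \<in> {1..n}" "\<gamma> = orbit \<sigma> x" unfolding cycles_of_def by (rule imageE)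
    with sub show ?thesis by simp
  qed
  have const: "c y = c x" if c: "c \<circ> \<sigma> = c" and y: "y \<in> orbit \<sigma> x" for c :: "nat \<Rightarrow> nat" and x y
    using y by induction (metis c comp_apply)+
  \<comment> \<open>Each factor is a sum over the colour given to the cycle, the colour
    \<open>l\<close> carrying the exponential and the other colours weight 1. Expanding the product
    colours the cycles independently.\<close>
  have "cycle_weight \<theta> h n \<sigma> = (\<Prod>\<gamma>\<in>?C. \<Sum>i<\<theta>. if i = l then exp (h * real (card \<gamma>)) else 1)"
    unfolding cycle_weight_def
  proof (rule prod.cong[OF refl])
    fix \<gamma>
    have "(\<Sum>i<\<theta>. if i = l then exp (h * real (card \<gamma>)) else 1)
        = exp (h * real (card \<gamma>)) + (\<Sum>i\<in>{..<\<theta>} - {l}. 1)"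
      using l by (subst sum.remove[of _ l]) (auto intro!: sum.cong)
    also have "(\<Sum>i\<in>{..<\<theta>} - {l}. 1) = real \<theta> - 1"
      using l by (simp add: card_Diff_singleton of_nat_diff)
    finally show "exp (h * real (card \<gamma>)) + real \<theta> - 1 =
      (\<Sum>i<\<theta>. if i = l then exp (h * real (card \<gamma>)) else 1)" by simp
  qed
  also have "\<dots> = (\<Sum>f\<in>?C \<rightarrow>\<^sub>E {..<\<theta>}. \<Prod>\<gamma>\<in>?C. if f \<gamma> = l then exp (h * real (card \<gamma>)) else 1)"
    by (rule prod_sum_PiE) (auto simp: fC)
  also have "\<dots> = (\<Sum>c | c \<in> colourings \<theta> n \<and> c \<circ> \<sigma> = c. exp (h * real (colour_count n c l)))"
  proof (rule sum.reindex_bij_witness[where j = "\<lambda>f. \<lambda>v\<in>{1..n}. f (orbit \<sigma> v)"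
        and i = "\<lambda>c. \<lambda>\<gamma>\<in>?C. c (SOME v. v \<in> \<gamma>)"])
    fix f assume f: "f \<in> ?C \<rightarrow>\<^sub>E {..<\<theta>}"
    let ?c = "\<lambda>v\<in>{1..n}. f (orbit \<sigma> v)"
    show "(\<lambda>\<gamma>\<in>?C. ?c (SOME v. v \<in> \<gamma>)) = f"
    proof
      fix \<gamma>
      show "(\<lambda>\<gamma>\<in>?C. ?c (SOME v. v \<in> \<gamma>)) \<gamma> = f \<gamma>"
        using some[of \<gamma>] subC[of \<gamma>] f by (cases "\<gamma> \<in> ?C") (auto simp: PiE_def extensional_def)
    qed
    have "?c \<circ> \<sigma> = ?c"
    proof
      fix v
      have "\<sigma> v \<in> {1..n} \<longleftrightarrow> v \<in> {1..n}" using permutes_in_image[OF \<sigma>] .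
      moreover have "orbit \<sigma> (\<sigma> v) = orbit \<sigma> v"
        by (rule permutation_orbit_step[OF perm])
      ultimately show "(?c \<circ> \<sigma>) v = ?c v" by (simp add: restrict_def)
    qed
    moreover have "?c \<in> colourings \<theta> n"
      using f by (auto simp: colourings_def cycles_of_def)
    ultimately show "?c \<in> {c. c \<in> colourings \<theta> n \<and> c \<circ> \<sigma> = c}" by simp
    have "{v \<in> {1..n}. ?c v = l} = \<Union>{\<gamma> \<in> ?C. f \<gamma> = l}"
    proof (intro set_eqI iffI)
      fix v assume "v \<in> {v \<in> {1..n}. ?c v = l}"
      then show "v \<in> \<Union>{\<gamma> \<in> ?C. f \<gamma> = l}"
        using self[of v] by (auto simp: cycles_of_def)
    next
      fix v assume "v \<in> \<Union>{\<gamma> \<in> ?C. f \<gamma> = l}"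
      then obtain x where x: "x \<in> {1..n}" "f (orbit \<sigma> x) = l" "v \<in> orbit \<sigma> x"
        by (auto simp: cycles_of_def)
      then show "v \<in> {v \<in> {1..n}. ?c v = l}"
        using orb[OF x(3)] sub[OF x(1)] by auto
    qed
    then have "colour_count n ?c l = card (\<Union>{\<gamma> \<in> ?C. f \<gamma> = l})"
      by (simp add: colour_count_def)
    also have "\<dots> = (\<Sum>\<gamma> | \<gamma> \<in> ?C \<and> f \<gamma> = l. card \<gamma>)"
    proof (rule card_Union_disjoint)
      show "pairwise disjnt {\<gamma> \<in> ?C. f \<gamma> = l}"
        unfolding pairwise_def disjnt_def cycles_of_def using orb by blast
      show "finite \<gamma>" if "\<gamma> \<in> {\<gamma> \<in> ?C. f \<gamma> = l}" for \<gamma>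
        using subC[of \<gamma>] that finite_subset by blast
    qed
    finally have "exp (h * real (colour_count n ?c l)) =
        (\<Prod>\<gamma> | \<gamma> \<in> ?C \<and> f \<gamma> = l. exp (h * real (card \<gamma>)))"
      using fC by (simp add: exp_sum sum_distrib_left)
    also have "\<dots> = (\<Prod>\<gamma>\<in>?C. if f \<gamma> = l then exp (h * real (card \<gamma>)) else 1)"
      by (rule prod.inter_filter[OF fC])
    finally show "exp (h * real (colour_count n ?c l)) =
      (\<Prod>\<gamma>\<in>?C. if f \<gamma> = l then exp (h * real (card \<gamma>)) else 1)" .
  next
    fix c assume c: "c \<in> {c. c \<in> colourings \<theta> n \<and> c \<circ> \<sigma> = c}"
    let ?f = "\<lambda>\<gamma>\<in>?C. c (SOME v. v \<in> \<gamma>)"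
    show "(\<lambda>v\<in>{1..n}. ?f (orbit \<sigma> v)) = c"
    proof
      fix v
      show "(\<lambda>v\<in>{1..n}. ?f (orbit \<sigma> v)) v = c v"
      proof (cases "v \<in> {1..n}")
        case True
        then have C: "orbit \<sigma> v \<in> ?C" by (auto simp: cycles_of_def)
        then have "c (SOME w. w \<in> orbit \<sigma> v) = c v"
          using some[OF C] const c by blast
        with C True show ?thesis by simp
      next
        case False
        with c show ?thesis by (auto simp: colourings_def PiE_def extensional_def)
      qed
    qed
    show "?f \<in> ?C \<rightarrow>\<^sub>E {..<\<theta>}"
    proof (rule PiE_I)
      fix \<gamma> assume C: "\<gamma> \<in> ?C"
      then have "(SOME v. v \<in> \<gamma>) \<in> {1..n}" using some[OF C] subC[OF C] by (meson subsetD)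
      then have "c (SOME v. v \<in> \<gamma>) \<in> {..<\<theta>}"
        using c by (simp add: colourings_def PiE_iff)
      with C show "?f \<gamma> \<in> {..<\<theta>}" by simp
    qed auto
  qed
  finally show ?thesis .
qed

lemma colour_class_recolour:
  assumes "c \<in> colour_class \<theta> n \<mu>" "y \<in> {1..n}" "c y = j" "i \<noteq> j" "i < \<theta>"
  shows "c(y := i) \<in> colour_class \<theta> n (\<mu>(i := \<mu> i + 1, j := \<mu> j - 1))"
proof -
  have \<mu>: "\<mu> = colour_count n c" and c: "c \<in> colourings \<theta> n"
    using assms(1) by (auto simp: colour_class_def)
  have "colour_count n (c(y := i)) k = (\<mu>(i := \<mu> i + 1, j := \<mu> j - 1)) k" for k
  proof -
    have "{v \<in> {1..n}. (c(y := i)) v = k} =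
        (if k = i then insert y {v \<in> {1..n}. c v = k}
         else if k = j then {v \<in> {1..n}. c v = k} - {y} else {v \<in> {1..n}. c v = k})"
      using assms by auto
    moreover have "y \<notin> {v \<in> {1..n}. c v = i}" "y \<in> {v \<in> {1..n}. c v = j}"
      using assms by auto
    ultimately show ?thesis
      using assms(4) by (auto simp: \<mu> colour_count_def card_Diff_singleton)
  qed
  moreover have "c(y := i) \<in> colourings \<theta> n"
    using c assms(2,5) by (auto simp: colourings_def PiE_iff extensional_def)
  ultimately show ?thesis by (auto simp: colour_class_def)
qed

section \<open>Traces on weight spaces and recolouring of single vertices\<close>

definition fixed_colourings :: "nat \<Rightarrow> nat \<Rightarrow> (nat \<Rightarrow> nat) \<Rightarrow> (nat \<Rightarrow> nat) \<Rightarrow> (nat \<Rightarrow> nat) set" where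
  "fixed_colourings \<theta> n \<mu> \<sigma> = {c \<in> colour_class \<theta> n \<mu>. c \<circ> \<sigma> = c}"

text \<open>The last condition says that \<open>c\<close> is fixed by
  \<open>\<sigma> \<circ> transpose x y\<close>. These are the off-diagonal terms in the trace of
  \<sigma> times the sum of all transpositions.\<close>

definition swapped_colourings ::
  "nat \<Rightarrow> nat \<Rightarrow> (nat \<Rightarrow> nat) \<Rightarrow> (nat \<Rightarrow> nat) \<Rightarrow> nat \<Rightarrow> nat \<Rightarrow> ((nat \<Rightarrow> nat) \<times> nat \<times> nat) set" where
  "swapped_colourings \<theta> n \<mu> \<sigma> i j = {(c, x, y). c \<in> colour_class \<theta> n \<mu> \<and> x \<in> {1..n} \<and> y \<in> {1..n}
     \<and> c x = i \<and> c y = j \<and> c \<circ> \<sigma> = c \<circ> Transposition.transpose x y}"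

text \<open>With \<open>S\<^sub>i\<^sub>j\<close> the operator that recolours one vertex from \<open>j\<close> to \<open>i\<close>, this set
  is counted by the trace of \<open>\<sigma> S\<^sub>j\<^sub>i S\<^sub>i\<^sub>j\<close> on the weight space of \<open>\<mu>\<close>.\<close>
definition recoloured ::
  "nat \<Rightarrow> nat \<Rightarrow> (nat \<Rightarrow> nat) \<Rightarrow> (nat \<Rightarrow> nat) \<Rightarrow> nat \<Rightarrow> nat \<Rightarrow> ((nat \<Rightarrow> nat) \<times> nat \<times> nat) set" where
  "recoloured \<theta> n \<mu> \<sigma> i j = {(c, x, y). c \<in> colour_class \<theta> n \<mu> \<and> x \<in> {1..n} \<and> y \<in> {1..n}
     \<and> c y = j \<and> (c(y := i)) x = i \<and> c \<circ> \<sigma> = c(y := i, x := j)}"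

lemma finite_fixed_colourings [simp]: "finite (fixed_colourings \<theta> n \<mu> \<sigma>)"
  by (simp add: fixed_colourings_def)

lemma finite_swapped_colourings [simp]: "finite (swapped_colourings \<theta> n \<mu> \<sigma> i j)"
  by (rule finite_subset[of _ "colour_class \<theta> n \<mu> \<times> {1..n} \<times> {1..n}"])
    (auto simp: swapped_colourings_def)

lemma finite_recoloured [simp]: "finite (recoloured \<theta> n \<mu> \<sigma> i j)"
  by (rule finite_subset[of _ "colour_class \<theta> n \<mu> \<times> {1..n} \<times> {1..n}"])
    (auto simp: recoloured_def)

text \<open>Split by whether the two recoloured vertices coincide. If \<open>x = y\<close>, the
  changes cancel and \<open>y\<close> is any of the \<open>\<mu> j\<close> vertices of colour
  \<open>j\<close>. Otherwise \<open>x\<close> had colour \<open>i\<close> from the start, and the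
  two changes together swap \<open>x\<close> and \<open>y\<close>.\<close>

lemma card_recoloured:
  assumes "i \<noteq> j"
  shows "card (recoloured \<theta> n \<mu> \<sigma> i j) =
    card (swapped_colourings \<theta> n \<mu> \<sigma> i j) + \<mu> j * card (fixed_colourings \<theta> n \<mu> \<sigma>)"
proof -
  let ?D = "SIGMA c : fixed_colourings \<theta> n \<mu> \<sigma>. {v \<in> {1..n}. c v = j}"
  let ?d = "\<lambda>(c, y). (c, y, y) :: (nat \<Rightarrow> nat) \<times> nat \<times> nat"
  have tr: "c \<circ> Transposition.transpose x y = c(y := i, x := j)"
    if "c x = i" "c y = j" for c :: "nat \<Rightarrow> nat" and x y
    using that assms by (auto simp: fun_eq_iff Transposition.transpose_def)
  have "recoloured \<theta> n \<mu> \<sigma> i j = swapped_colourings \<theta> n \<mu> \<sigma> i j \<union> ?d ` ?D"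
  proof (intro set_eqI iffI)
    fix p assume p: "p \<in> recoloured \<theta> n \<mu> \<sigma> i j"
    obtain c x y where [simp]: "p = (c, x, y)" by (cases p) 
    show "p \<in> swapped_colourings \<theta> n \<mu> \<sigma> i j \<union> ?d ` ?D"
    proof (cases "x = y")
      case True
      have "c(y := i, y := j) = c" using p by (auto simp: recoloured_def fun_eq_iff)
      with p True show ?thesis
        by (auto simp: recoloured_def fixed_colourings_def image_iff)
    next
      case False
      with p show ?thesis
        using tr[of c x y] by (auto simp: recoloured_def swapped_colourings_def)
    qed
  next
    fix p assume "p \<in> swapped_colourings \<theta> n \<mu> \<sigma> i j \<union> ?d ` ?D"
    then show "p \<in> recoloured \<theta> n \<mu> \<sigma> i j"
    proof
      assume "p \<in> swapped_colourings \<theta> n \<mu> \<sigma> i j"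
      then show ?thesis using assms tr
        by (auto simp: recoloured_def swapped_colourings_def)
    next
      assume "p \<in> ?d ` ?D"
      then obtain c y where "p = (c, y, y)" "c \<in> fixed_colourings \<theta> n \<mu> \<sigma>" "y \<in> {1..n}" "c y = j"
        by auto
      then show ?thesis by (auto simp: recoloured_def fixed_colourings_def)
    qed
  qed
  moreover have "swapped_colourings \<theta> n \<mu> \<sigma> i j \<inter> ?d ` ?D = {}"
    using assms by (auto simp: swapped_colourings_def)
  moreover have "card (?d ` ?D) = card ?D"
    by (rule card_image) (auto simp: inj_on_def)
  moreover have "card ?D = \<mu> j * card (fixed_colourings \<theta> n \<mu> \<sigma>)"
  proof -
    have "card ?D = (\<Sum>c\<in>fixed_colourings \<theta> n \<mu> \<sigma>. card {v \<in> {1..n}. c v = j})"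
      by (rule card_SigmaI) auto
    also have "\<dots> = (\<Sum>c\<in>fixed_colourings \<theta> n \<mu> \<sigma>. \<mu> j)"
      by (rule sum.cong) (auto simp: fixed_colourings_def colour_class_def colour_count_def)
    finally show ?thesis by (simp add: mult.commute)
  qed
  moreover have "finite ?D" by (rule finite_SigmaI) auto
  ultimately show ?thesis by (simp add: card_Un_disjoint)
qed

text \<open>Cyclicity of the trace, because \<open>S\<^sub>i\<^sub>j\<close> commutes with \<open>\<sigma>\<close>.\<close>
lemma card_recoloured_le:
  assumes \<sigma>: "\<sigma> permutes {1..n}" and ij: "i \<noteq> j" "i < \<theta>"
  shows "card (recoloured \<theta> n \<mu> \<sigma> i j)
    \<le> card (recoloured \<theta> n (\<mu>(i := \<mu> i + 1, j := \<mu> j - 1)) \<sigma> j i)"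
\<comment> \<open>The recolouring of \<open>y\<close> moves from the start of the cycle of
  operations to its end; carried past \<sigma> it acts at \<open>inv \<sigma> y\<close>.\<close>
proof (rule card_inj_on_le[where f = "\<lambda>(c, x, y). (c(y := i), inv \<sigma> y, x)"])
  show "(\<lambda>(c, x, y). (c(y := i), inv \<sigma> y, x)) ` recoloured \<theta> n \<mu> \<sigma> i j
    \<subseteq> recoloured \<theta> n (\<mu>(i := \<mu> i + 1, j := \<mu> j - 1)) \<sigma> j i"
  proof clarify
    fix c x y
    assume "(c, x, y) \<in> recoloured \<theta> n \<mu> \<sigma> i j"
    then have c: "c \<in> colour_class \<theta> n \<mu>" and x: "x \<in> {1..n}" and y: "y \<in> {1..n}"
      and cy: "c y = j" and cx: "(c(y := i)) x = i" and eq: "c \<circ> \<sigma> = c(y := i, x := j)"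
      by (auto simp: recoloured_def)
    have iy: "inv \<sigma> y \<in> {1..n}"
      using permutes_in_image[OF permutes_inv[OF \<sigma>]] y by simp
    have s: "\<sigma> (inv \<sigma> y) = y" using permutes_inverses[OF \<sigma>] by simp
    have s': "\<sigma> v = y \<longleftrightarrow> v = inv \<sigma> y" for v
      using permutes_inverses[OF \<sigma>] by metis
    have "(c(y := i, x := j)) (inv \<sigma> y) = j"
      unfolding eq[symmetric] using s cy by simp
    moreover have "c(y := i) \<circ> \<sigma> = (c(y := i))(x := j, inv \<sigma> y := i)"
    proof -
      have "c(y := i) \<circ> \<sigma> = (c \<circ> \<sigma>)(inv \<sigma> y := i)"
        using s' by (auto simp: fun_eq_iff)
      then show ?thesis by (simp add: eq)
    qed
    ultimately show "(c(y := i), inv \<sigma> y, x)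
        \<in> recoloured \<theta> n (\<mu>(i := \<mu> i + 1, j := \<mu> j - 1)) \<sigma> j i"
      using colour_class_recolour[OF c y cy ij] x iy cx by (auto simp: recoloured_def)
  qed
  show "inj_on (\<lambda>(c, x, y). (c(y := i), inv \<sigma> y, x)) (recoloured \<theta> n \<mu> \<sigma> i j)"
  proof (rule inj_onI)
    fix p q
    assume p: "p \<in> recoloured \<theta> n \<mu> \<sigma> i j" and q: "q \<in> recoloured \<theta> n \<mu> \<sigma> i j"
      and pq: "(\<lambda>(c, x, y). (c(y := i), inv \<sigma> y, x)) p = (\<lambda>(c, x, y). (c(y := i), inv \<sigma> y, x)) q"
    obtain c x y c' x' y' where [simp]: "p = (c, x, y)" "q = (c', x', y')"
      by (cases p, cases q)
    have 1: "(c, x, y) \<in> recoloured \<theta> n \<mu> \<sigma> i j" "(c', x', y') \<in> recoloured \<theta> n \<mu> \<sigma> i j"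
      and 2: "inv \<sigma> y = inv \<sigma> y'" "c(y := i) = c'(y' := i)" "x = x'"
      using p q pq by auto
    from 2(1) have y: "y = y'" using permutes_inverses[OF \<sigma>] by metis
    moreover have "c = c'"
    proof
      fix v
      show "c v = c' v"
        using 1 2(2) y by (cases "v = y") (auto simp: recoloured_def fun_eq_iff split: if_splits)
    qed
    ultimately show "p = q" using 2(3) by simp
  qed
qed auto

text \<open>Moving one vertex from colour \<open>j\<close> to \<open>i\<close> bounds the left side
  by the same expression for the new counts, plus a commutator term with coefficient
  \<open>\<mu> i - \<mu> j + 2\<close>. Iterating until colour \<open>j\<close> is exhausted, where
  no swap is left, gives the sum.\<close>

lemma card_swapped_colourings_le:
  assumes \<sigma>: "\<sigma> permutes {1..n}" and ij: "i \<noteq> j" "i < \<theta>" "j < \<theta>" "\<mu> j \<le> \<mu> i"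
  shows "card (swapped_colourings \<theta> n \<mu> \<sigma> i j) + \<mu> j * card (fixed_colourings \<theta> n \<mu> \<sigma>)
    \<le> (\<Sum>r = 1..\<mu> j. (\<mu> i - \<mu> j + 2 * r) *
          card (fixed_colourings \<theta> n (\<mu>(i := \<mu> i + r, j := \<mu> j - r)) \<sigma>))"
  using ij(4)
proof (induction "\<mu> j" arbitrary: \<mu>)
  case 0
  have "swapped_colourings \<theta> n \<mu> \<sigma> i j = {}"
  proof -
    have False if "(c, x, y) \<in> swapped_colourings \<theta> n \<mu> \<sigma> i j" for c x y
    proof -
      have "y \<in> {v \<in> {1..n}. c v = j}" "card {v \<in> {1..n}. c v = j} = 0"
        using that 0 by (auto simp: swapped_colourings_def colour_class_def colour_count_def)
      moreover have "finite {v \<in> {1..n}. c v = j}" by simp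
      ultimately have "{v \<in> {1..n}. c v = j} = {}" by (simp only: card_0_eq)
      with \<open>y \<in> {v \<in> {1..n}. c v = j}\<close> show False by (simp only: empty_iff)
    qed
    then show ?thesis by auto
  qed
  with 0 show ?case by simp
next
  case (Suc m)
  let ?a = "\<lambda>\<mu>. card (fixed_colourings \<theta> n \<mu> \<sigma>)"
  let ?\<nu> = "\<mu>(i := \<mu> i + 1, j := \<mu> j - 1)"
  have \<nu>: "?\<nu> j = m" "?\<nu> i = \<mu> i + 1" "m \<le> \<mu> i" using Suc ij by auto
  have upd: "?\<nu>(i := ?\<nu> i + r, j := ?\<nu> j - r) = \<mu>(i := \<mu> i + Suc r, j := \<mu> j - Suc r)" for r
    using ij by (auto simp: fun_eq_iff)
  have sw: "card (swapped_colourings \<theta> n ?\<nu> \<sigma> j i) = card (swapped_colourings \<theta> n ?\<nu> \<sigma> i j)"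
    by (rule bij_betw_same_card[of "\<lambda>(c, x, y). (c, y, x)"],
        rule bij_betw_byWitness[where f' = "\<lambda>(c, x, y). (c, y, x)"])
      (auto simp: swapped_colourings_def Transposition.transpose_commute)
  have "card (swapped_colourings \<theta> n \<mu> \<sigma> i j) + \<mu> j * ?a \<mu> = card (recoloured \<theta> n \<mu> \<sigma> i j)"
    using card_recoloured ij by metis
  also have "\<dots> \<le> card (recoloured \<theta> n ?\<nu> \<sigma> j i)"
    using card_recoloured_le[OF \<sigma> ij(1,2)] .
  also have "\<dots> = card (swapped_colourings \<theta> n ?\<nu> \<sigma> i j) + (\<mu> i + 1) * ?a ?\<nu>"
    using card_recoloured[of j i] ij \<nu> sw by simp
  \<comment> \<open>Splits \<open>\<mu> i + 1\<close> as \<open>?\<nu> j\<close>, the coefficient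
    that the induction hypothesis expects, plus the commutator
    \<open>\<mu> i - \<mu> j + 2\<close>.\<close>
  also have "\<dots> = (card (swapped_colourings \<theta> n ?\<nu> \<sigma> i j) + ?\<nu> j * ?a ?\<nu>) + (\<mu> i - \<mu> j + 2) * ?a ?\<nu>"
  proof -
    have "B + a * A = (B + b * A) + d * A" if "a = b + d" for a b d A B :: nat
      using that by (simp add: distrib_right)
    moreover have "\<mu> i + 1 = ?\<nu> j + (\<mu> i - \<mu> j + 2)" using Suc \<nu> by simp
    ultimately show ?thesis by blast
  qed
  also have "\<dots> \<le> (\<Sum>r = 1..?\<nu> j. (?\<nu> i - ?\<nu> j + 2 * r) *
      ?a (?\<nu>(i := ?\<nu> i + r, j := ?\<nu> j - r))) + (\<mu> i - \<mu> j + 2) * ?a ?\<nu>"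
    using Suc.hyps(1)[of ?\<nu>] \<nu> by (intro add_mono) auto
  also have "(\<Sum>r = 1..?\<nu> j. (?\<nu> i - ?\<nu> j + 2 * r) * ?a (?\<nu>(i := ?\<nu> i + r, j := ?\<nu> j - r)))
      = (\<Sum>r = 1..m. (\<mu> i - \<mu> j + 2 * Suc r) * ?a (\<mu>(i := \<mu> i + Suc r, j := \<mu> j - Suc r)))"
  proof -
    have coef: "?\<nu> i - ?\<nu> j + 2 * r = \<mu> i - \<mu> j + 2 * Suc r" for r
      unfolding \<nu>(1,2) using Suc.hyps(2) Suc.prems by arith
    show ?thesis unfolding upd coef by (simp only: \<nu>(1))
  qed
  also have "\<dots> = (\<Sum>r = Suc 1..Suc m. (\<mu> i - \<mu> j + 2 * r) * ?a (\<mu>(i := \<mu> i + r, j := \<mu> j - r)))"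
    by (rule sum.shift_bounds_cl_Suc_ivl[symmetric])
  also have "\<dots> + (\<mu> i - \<mu> j + 2) * ?a ?\<nu> =
      (\<Sum>r = 1..Suc m. (\<mu> i - \<mu> j + 2 * r) * ?a (\<mu>(i := \<mu> i + r, j := \<mu> j - r)))"
    by (subst (2) sum.atLeast_Suc_atMost) auto
  finally show ?case using Suc.hyps(2) by simp
qed

section \<open>The recursive inequality in the number of edges\<close>

definition edge_seqs :: "nat \<Rightarrow> nat \<Rightarrow> (nat \<times> nat) list set" where
  "edge_seqs n k = {es. set es \<subseteq> edges n \<and> length es = k}"

lemma finite_edge_seqs [simp]: "finite (edge_seqs n k)"
  unfolding edge_seqs_def by (rule finite_lists_length_eq) simp

lemma edge_seqs_0 [simp]: "edge_seqs n 0 = {[]}"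
  by (auto simp: edge_seqs_def)

lemma sum_edge_seqs_Suc:
  "(\<Sum>es\<in>edge_seqs n (Suc k). f es) = (\<Sum>es\<in>edge_seqs n k. \<Sum>e\<in>edges n. f (e # es))"
proof -
  have "(\<Sum>es\<in>edge_seqs n (Suc k). f es) = (\<Sum>(es, e)\<in>edge_seqs n k \<times> edges n. f (e # es))"
    by (rule sum.reindex_bij_witness[where i = "\<lambda>(es, e). e # es" and j = "\<lambda>es. (tl es, hd es)"])
      (auto simp: edge_seqs_def length_Suc_conv)
  then show ?thesis by (simp add: sum.cartesian_product)
qed

definition square_sum :: "nat \<Rightarrow> (nat \<Rightarrow> nat) \<Rightarrow> real" where
  "square_sum \<theta> \<mu> = (\<Sum>i<\<theta>. (real (\<mu> i))\<^sup>2)"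

text \<open>Moves go from a colour \<open>j\<close> to one that is at least as frequent. They
  increase \<open>square_sum\<close> and never decrease \<open>max_part\<close>, which gives the
  supersolution its decay.\<close>

definition raising_pairs :: "nat \<Rightarrow> (nat \<Rightarrow> nat) \<Rightarrow> (nat \<times> nat) set" where
  "raising_pairs \<theta> \<mu> = {(i, j). i < \<theta> \<and> j < \<theta> \<and> i \<noteq> j \<and> \<mu> j \<le> \<mu> i}"

lemma finite_raising_pairs [simp]: "finite (raising_pairs \<theta> \<mu>)"
  by (rule finite_subset[of _ "{..<\<theta>} \<times> {..<\<theta>}"]) (auto simp: raising_pairs_def)

lemma card_raising_pairs_le: "card (raising_pairs \<theta> \<mu>) \<le> \<theta>\<^sup>2"
proof -
  have "card (raising_pairs \<theta> \<mu>) \<le> card ({..<\<theta>} \<times> {..<\<theta>})"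
    by (rule card_mono) (auto simp: raising_pairs_def)
  then show ?thesis by (simp add: card_cartesian_product power2_eq_square)
qed

lemma card_monochromatic_pairs_le:
  assumes "c \<in> colour_class \<theta> n \<mu>"
  shows "real (card {(x, y). x \<in> {1..n} \<and> y \<in> {1..n} \<and> c x = c y}) \<le> square_sum \<theta> \<mu>"
proof -
  let ?A = "\<lambda>i. {v \<in> {1..n}. c v = i}"
  have "c x < \<theta>" if "x \<in> {1..n}" for x
    using assms that by (auto simp: colour_class_def colourings_def)
  then have "{(x, y). x \<in> {1..n} \<and> y \<in> {1..n} \<and> c x = c y} = (\<Union>i<\<theta>. ?A i \<times> ?A i)"
    by auto
  then have "card {(x, y). x \<in> {1..n} \<and> y \<in> {1..n} \<and> c x = c y} \<le> (\<Sum>i<\<theta>. card (?A i \<times> ?A i))"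
    using card_UN_le[of "{..<\<theta>}" "\<lambda>i. ?A i \<times> ?A i"] by simp
  also have "\<dots> = (\<Sum>i<\<theta>. (\<mu> i)\<^sup>2)"
    using assms by (intro sum.cong)
      (auto simp: card_cartesian_product power2_eq_square colour_class_def colour_count_def)
  finally have "real (card {(x, y). x \<in> {1..n} \<and> y \<in> {1..n} \<and> c x = c y})
      \<le> real (\<Sum>i<\<theta>. (\<mu> i)\<^sup>2)"
    by (simp only: of_nat_le_iff)
  then show ?thesis by (simp add: square_sum_def)
qed

text \<open>A transposition of two vertices of equal colour does not change \<open>c\<close>, so
  \<open>c\<close> is then fixed by \<sigma> itself and at most
  \<open>square_sum \<theta> \<mu> / 2\<close> edges are of this kind. All other edges contribute
  swapped colourings.\<close>

lemma sum_edges_card_fixed_le: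
  "(\<Sum>(x, y)\<in>edges n. real (card (fixed_colourings \<theta> n \<mu> (\<sigma> \<circ> Transposition.transpose x y))))
    \<le> square_sum \<theta> \<mu> / 2 * card (fixed_colourings \<theta> n \<mu> \<sigma>)
      + (\<Sum>(i, j)\<in>raising_pairs \<theta> \<mu>. real (card (swapped_colourings \<theta> n \<mu> \<sigma> i j)))"
proof -
  let ?F = "fixed_colourings \<theta> n \<mu> \<sigma>"
  define X where "X = (SIGMA c:colour_class \<theta> n \<mu>.
    {(x, y). (x, y) \<in> edges n \<and> c \<circ> \<sigma> = c \<circ> Transposition.transpose x y})"
  define M where "M = (SIGMA c:?F. {(x, y). (x, y) \<in> edges n \<and> c x = c y})"
  define N where "N = {(c, x, y) \<in> X. c x \<noteq> c y}"
  have fe: "finite {(x, y). (x, y) \<in> edges n \<and> P x y}" for P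
    by (rule finite_subset[OF _ finite_edges[of n]]) auto
  have finX: "finite X" unfolding X_def by (intro finite_SigmaI fe) simp
  have finM: "finite M" unfolding M_def by (intro finite_SigmaI fe) simp
  have eq: "c \<circ> (\<sigma> \<circ> Transposition.transpose x y) = c \<longleftrightarrow> c \<circ> \<sigma> = c \<circ> Transposition.transpose x y"
    for c :: "nat \<Rightarrow> nat" and x y
  proof
    assume "c \<circ> (\<sigma> \<circ> Transposition.transpose x y) = c"
    then have "c \<circ> (\<sigma> \<circ> Transposition.transpose x y) \<circ> Transposition.transpose x y
        = c \<circ> Transposition.transpose x y" by simp
    then show "c \<circ> \<sigma> = c \<circ> Transposition.transpose x y" by (simp add: comp_assoc)
  next
    assume "c \<circ> \<sigma> = c \<circ> Transposition.transpose x y"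
    then have "c \<circ> \<sigma> \<circ> Transposition.transpose x y
        = c \<circ> Transposition.transpose x y \<circ> Transposition.transpose x y" by simp
    then show "c \<circ> (\<sigma> \<circ> Transposition.transpose x y) = c" by (simp add: comp_assoc)
  qed
  have "(\<Sum>(x, y)\<in>edges n. card (fixed_colourings \<theta> n \<mu> (\<sigma> \<circ> Transposition.transpose x y)))
      = card (SIGMA e:edges n. fixed_colourings \<theta> n \<mu> (\<sigma> \<circ> Transposition.transpose (fst e) (snd e)))"
    by (subst card_SigmaI) (auto simp: case_prod_unfold)
  also have "\<dots> = card X"
    by (rule bij_betw_same_card[of "\<lambda>(e, c). (c, e)"],
        rule bij_betw_byWitness[where f' = "\<lambda>(c, e). (e, c)"])
      (auto simp: X_def fixed_colourings_def eq)
  also have "\<dots> \<le> card (M \<union> N)"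
  proof (rule card_mono)
    show "finite (M \<union> N)" using finM finX finite_subset[of N X] by (auto simp: N_def)
    have "c \<circ> Transposition.transpose x y = c" if "c x = c y" for c :: "nat \<Rightarrow> nat" and x y
      using that by (auto simp: fun_eq_iff Transposition.transpose_def)
    then show "X \<subseteq> M \<union> N" by (auto simp: M_def N_def X_def fixed_colourings_def)
  qed
  also have "\<dots> \<le> card M + card N" by (rule card_Un_le)
  finally have sum: "(\<Sum>(x, y)\<in>edges n. card (fixed_colourings \<theta> n \<mu> (\<sigma> \<circ> Transposition.transpose x y)))
      \<le> card M + card N" .
  have "card N \<le> card (\<Union>(i, j)\<in>raising_pairs \<theta> \<mu>. swapped_colourings \<theta> n \<mu> \<sigma> i j)"
  \<comment> \<open>The endpoints are ordered so that the more frequent colour comes first. Since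
    \<open>x < y\<close> on edges, the original order can be recovered and nothing is counted
    twice.\<close>
  proof (rule card_inj_on_le[where f = "\<lambda>(c, x, y). if \<mu> (c y) \<le> \<mu> (c x) then (c, x, y) else (c, y, x)"])
    show "inj_on (\<lambda>(c, x, y). if \<mu> (c y) \<le> \<mu> (c x) then (c, x, y) else (c, y, x)) N"
      by (auto simp: inj_on_def N_def X_def edges_def split: if_splits)
    show "(\<lambda>(c, x, y). if \<mu> (c y) \<le> \<mu> (c x) then (c, x, y) else (c, y, x)) ` N
        \<subseteq> (\<Union>(i, j)\<in>raising_pairs \<theta> \<mu>. swapped_colourings \<theta> n \<mu> \<sigma> i j)"
    proof (rule image_subsetI)
      fix p assume p: "p \<in> N"
      obtain c x y where [simp]: "p = (c, x, y)" by (cases p)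
      from p have "(c, x, y) \<in> N" by simp
      then have *: "c \<in> colour_class \<theta> n \<mu>" "(x, y) \<in> edges n" "c x \<noteq> c y"
          "c \<circ> \<sigma> = c \<circ> Transposition.transpose x y"
        by (auto simp: N_def X_def)
      then have "c x < \<theta>" "c y < \<theta>" "x \<in> {1..n}" "y \<in> {1..n}"
        by (auto simp: colour_class_def colourings_def edges_def PiE_iff)
      with * show "(case p of (c, x, y) \<Rightarrow> if \<mu> (c y) \<le> \<mu> (c x) then (c, x, y) else (c, y, x))
          \<in> (\<Union>(i, j)\<in>raising_pairs \<theta> \<mu>. swapped_colourings \<theta> n \<mu> \<sigma> i j)"
        by (auto simp: raising_pairs_def swapped_colourings_def Transposition.transpose_commute)
    qed
    show "finite (\<Union>(i, j)\<in>raising_pairs \<theta> \<mu>. swapped_colourings \<theta> n \<mu> \<sigma> i j)"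
      by (rule finite_UN_I) auto
  qed
  also have "\<dots> \<le> (\<Sum>(i, j)\<in>raising_pairs \<theta> \<mu>. card (swapped_colourings \<theta> n \<mu> \<sigma> i j))"
    using card_UN_le[of "raising_pairs \<theta> \<mu>" "\<lambda>(i, j). swapped_colourings \<theta> n \<mu> \<sigma> i j"]
    by (simp add: case_prod_unfold)
  finally have N: "card N \<le> (\<Sum>(i, j)\<in>raising_pairs \<theta> \<mu>. card (swapped_colourings \<theta> n \<mu> \<sigma> i j))" .
  \<comment> \<open>The factor 2 compares edges with ordered pairs of vertices of equal
    colour.\<close>
  have M: "2 * real (card M) \<le> square_sum \<theta> \<mu> * card ?F"
  proof -
    let ?s = "\<lambda>(c :: nat \<Rightarrow> nat, x :: nat, y :: nat). (c, y, x)"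
    have "card (?s ` M) = card M" by (rule card_image) (auto simp: inj_on_def)
    moreover have "M \<inter> ?s ` M = {}" by (auto simp: M_def edges_def)
    ultimately have "2 * card M = card (M \<union> ?s ` M)"
      using finM by (simp add: card_Un_disjoint)
    also have "\<dots> \<le> card (SIGMA c:?F. {(x, y). x \<in> {1..n} \<and> y \<in> {1..n} \<and> c x = c y})"
    proof (rule card_mono)
      show "finite (SIGMA c:?F. {(x, y). x \<in> {1..n} \<and> y \<in> {1..n} \<and> c x = c y})"
        by (intro finite_SigmaI finite_subset[OF _ finite_cartesian_product[of "{1..n}" "{1..n}"]]) auto
      show "M \<union> ?s ` M \<subseteq> (SIGMA c:?F. {(x, y). x \<in> {1..n} \<and> y \<in> {1..n} \<and> c x = c y})"
        by (auto simp: M_def edges_def)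
    qed
    also have "\<dots> = (\<Sum>c\<in>?F. card {(x, y). x \<in> {1..n} \<and> y \<in> {1..n} \<and> c x = c y})"
      by (intro card_SigmaI finite_subset[OF _ finite_cartesian_product[of "{1..n}" "{1..n}"]] ballI) auto
    finally have "real (2 * card M) \<le> real (\<Sum>c\<in>?F. card {(x, y). x \<in> {1..n} \<and> y \<in> {1..n} \<and> c x = c y})"
      by (simp only: of_nat_le_iff)
    also have "\<dots> \<le> (\<Sum>c\<in>?F. square_sum \<theta> \<mu>)"
      unfolding of_nat_sum
      by (intro sum_mono card_monochromatic_pairs_le[of _ \<theta> n]) (auto simp: fixed_colourings_def)
    finally show ?thesis by (simp add: mult.commute)
  qed
  have "(\<Sum>(x, y)\<in>edges n. real (card (fixed_colourings \<theta> n \<mu> (\<sigma> \<circ> Transposition.transpose x y))))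
      \<le> real (card M) + real (card N)"
    using of_nat_mono[OF sum, where 'a = real] by (simp add: case_prod_unfold)
  moreover have "real (card N) \<le> (\<Sum>(i, j)\<in>raising_pairs \<theta> \<mu>. real (card (swapped_colourings \<theta> n \<mu> \<sigma> i j)))"
    using of_nat_mono[OF N, where 'a = real] by (simp add: case_prod_unfold)
  ultimately show ?thesis using M by simp
qed

text \<open>The trace of the \<open>k\<close>-th power of the sum of all transpositions on the
  weight space of \<open>\<mu>\<close>.\<close>

definition fixed_count :: "nat \<Rightarrow> nat \<Rightarrow> nat \<Rightarrow> (nat \<Rightarrow> nat) \<Rightarrow> real" where
  "fixed_count \<theta> n k \<mu> = (\<Sum>es\<in>edge_seqs n k. real (card (fixed_colourings \<theta> n \<mu> (perm_of_seq es))))"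

lemma fixed_count_0: "fixed_count \<theta> n 0 \<mu> = real (card (colour_class \<theta> n \<mu>))"
  by (simp add: fixed_count_def fixed_colourings_def)

text \<open>Splits off the first edge and bounds the off-diagonal terms by
  \<open>card_swapped_colourings_le\<close>, whose nonnegative second summand on the left is
  discarded.\<close>

lemma fixed_count_Suc_le:
  "fixed_count \<theta> n (Suc k) \<mu> \<le> square_sum \<theta> \<mu> / 2 * fixed_count \<theta> n k \<mu>
    + (\<Sum>(i, j)\<in>raising_pairs \<theta> \<mu>. \<Sum>r = 1..\<mu> j. (real (\<mu> i) - real (\<mu> j) + 2 * real r) *
         fixed_count \<theta> n k (\<mu>(i := \<mu> i + r, j := \<mu> j - r)))"
proof -
  let ?a = "\<lambda>\<mu> es. real (card (fixed_colourings \<theta> n \<mu> (perm_of_seq es)))"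
  have step: "(\<Sum>e\<in>edges n. ?a \<mu> (e # es)) \<le> square_sum \<theta> \<mu> / 2 * ?a \<mu> es
    + (\<Sum>(i, j)\<in>raising_pairs \<theta> \<mu>. \<Sum>r = 1..\<mu> j. (real (\<mu> i) - real (\<mu> j) + 2 * real r) *
         ?a (\<mu>(i := \<mu> i + r, j := \<mu> j - r)) es)"
    if es: "es \<in> edge_seqs n k" for es
  proof -
    let ?\<sigma> = "perm_of_seq es"
    have \<sigma>: "?\<sigma> permutes {1..n}" using es by (intro permutes_perm_of_seq) (simp add: edge_seqs_def)
    have sw: "real (card (swapped_colourings \<theta> n \<mu> ?\<sigma> i j)) \<le>
        (\<Sum>r = 1..\<mu> j. (real (\<mu> i) - real (\<mu> j) + 2 * real r) * ?a (\<mu>(i := \<mu> i + r, j := \<mu> j - r)) es)"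
      if "(i, j) \<in> raising_pairs \<theta> \<mu>" for i j
    proof -
      have ij: "i \<noteq> j" "i < \<theta>" "j < \<theta>" "\<mu> j \<le> \<mu> i" using that by (auto simp: raising_pairs_def)
      have "card (swapped_colourings \<theta> n \<mu> ?\<sigma> i j) \<le> (\<Sum>r = 1..\<mu> j. (\<mu> i - \<mu> j + 2 * r) *
          card (fixed_colourings \<theta> n (\<mu>(i := \<mu> i + r, j := \<mu> j - r)) ?\<sigma>))"
        using card_swapped_colourings_le[where \<mu> = \<mu>, OF \<sigma> ij] by simp
      from of_nat_mono[OF this, where 'a = real] show ?thesis
        using ij by (simp add: of_nat_diff add_diff_eq diff_add_eq)
    qed
    have "(\<Sum>e\<in>edges n. ?a \<mu> (e # es)) = (\<Sum>(x, y)\<in>edges n.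
        real (card (fixed_colourings \<theta> n \<mu> (?\<sigma> \<circ> Transposition.transpose x y))))"
      by (simp add: perm_of_seq_Cons case_prod_unfold)
    also have "\<dots> \<le> square_sum \<theta> \<mu> / 2 * ?a \<mu> es
      + (\<Sum>(i, j)\<in>raising_pairs \<theta> \<mu>. real (card (swapped_colourings \<theta> n \<mu> ?\<sigma> i j)))"
      by (rule sum_edges_card_fixed_le)
    also have "(\<Sum>(i, j)\<in>raising_pairs \<theta> \<mu>. real (card (swapped_colourings \<theta> n \<mu> ?\<sigma> i j)))
      \<le> (\<Sum>(i, j)\<in>raising_pairs \<theta> \<mu>. \<Sum>r = 1..\<mu> j. (real (\<mu> i) - real (\<mu> j) + 2 * real r) *
         ?a (\<mu>(i := \<mu> i + r, j := \<mu> j - r)) es)"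
      using sw by (intro sum_mono) (auto simp: case_prod_unfold)
    finally show ?thesis by simp
  qed
  have "fixed_count \<theta> n (Suc k) \<mu> = (\<Sum>es\<in>edge_seqs n k. \<Sum>e\<in>edges n. ?a \<mu> (e # es))"
    by (simp add: fixed_count_def sum_edge_seqs_Suc)
  also have "\<dots> \<le> (\<Sum>es\<in>edge_seqs n k. square_sum \<theta> \<mu> / 2 * ?a \<mu> es
    + (\<Sum>(i, j)\<in>raising_pairs \<theta> \<mu>. \<Sum>r = 1..\<mu> j. (real (\<mu> i) - real (\<mu> j) + 2 * real r) *
         ?a (\<mu>(i := \<mu> i + r, j := \<mu> j - r)) es))"
    by (rule sum_mono) (rule step)
  also have "\<dots> = square_sum \<theta> \<mu> / 2 * fixed_count \<theta> n k \<mu>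
    + (\<Sum>(i, j)\<in>raising_pairs \<theta> \<mu>. \<Sum>r = 1..\<mu> j. (real (\<mu> i) - real (\<mu> j) + 2 * real r) *
         fixed_count \<theta> n k (\<mu>(i := \<mu> i + r, j := \<mu> j - r)))"
    by (simp only: sum.distrib fixed_count_def sum_distrib_left case_prod_unfold
        sum.swap[of _ _ "edge_seqs n k"])
  finally show ?thesis .
qed

section \<open>A supersolution of the recursion\<close>

text \<open>The prefactor is the derivative of \<open>r * (a + r)\<close>, so the sum resembles an
  integral with value at most \<open>1 / \<delta>\<close>. The induction telescopes; the factor 2
  comes from \<open>a + 2 * m + 2 \<le> 2 * (a + 2 * m + 1)\<close>.\<close>

lemma sum_raising_weights_le:
  fixes a \<delta> :: real
  assumes "0 \<le> a" "0 < \<delta>"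
  shows "(\<Sum>r = 1..m. (a + 2 * real r) * exp (- \<delta> * (real r * (a + real r)))) \<le> 2 / \<delta>"
proof -
  have "(\<Sum>r = 1..m. (a + 2 * real r) * exp (- \<delta> * (real r * (a + real r))))
      \<le> 2 / \<delta> * (1 - exp (- \<delta> * (real m * (a + real m))))"
  proof (induction m)
    case (Suc m)
    let ?e = "\<lambda>m. exp (- \<delta> * (real m * (a + real m)))"
    let ?d = "a + 2 * real m + 1"
    have *: "?e m = ?e (Suc m) * exp (\<delta> * ?d)"
      unfolding exp_add[symmetric] by (simp add: algebra_simps)
    have "\<delta> * ?d \<le> exp (\<delta> * ?d) - 1"
      using exp_ge_add_one_self[of "\<delta> * ?d"] by linarith
    then have "?e (Suc m) * (\<delta> * ?d) \<le> ?e (Suc m) * (exp (\<delta> * ?d) - 1)"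
      by (rule mult_left_mono) (rule exp_ge_zero)
    also have "\<dots> = ?e m - ?e (Suc m)"
      unfolding * by (simp only: right_diff_distrib mult_1_right)
    finally have "?e (Suc m) * (\<delta> * ?d) \<le> ?e m - ?e (Suc m)" .
    moreover have "?e (Suc m) * (\<delta> * (a + 2 * real (Suc m))) \<le> ?e (Suc m) * (2 * (\<delta> * ?d))"
      using assms by (intro mult_left_mono) (auto simp: algebra_simps)
    ultimately have "\<delta> * ((a + 2 * real (Suc m)) * ?e (Suc m)) \<le> 2 * (?e m - ?e (Suc m))"
      by (simp add: algebra_simps)
    then have "(a + 2 * real (Suc m)) * ?e (Suc m) \<le> 2 / \<delta> * (?e m - ?e (Suc m))"
      using assms by (simp add: pos_le_divide_eq mult.commute)
    with Suc have "(\<Sum>r = 1..m. (a + 2 * real r) * ?e r) + (a + 2 * real (Suc m)) * ?e (Suc m)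
        \<le> 2 / \<delta> * (1 - ?e m) + 2 / \<delta> * (?e m - ?e (Suc m))"
      by (rule add_mono)
    moreover have "2 / \<delta> * (1 - ?e m) + 2 / \<delta> * (?e m - ?e (Suc m)) = 2 / \<delta> * (1 - ?e (Suc m))"
      by (simp only: right_diff_distrib)
    moreover have "(Suc m < 1) = False" by simp
    ultimately show ?case by (simp only: sum.cl_ivl_Suc if_False)
  qed (use assms in simp)
  also have "\<dots> \<le> 2 / \<delta> * 1"
    using assms by (intro mult_left_mono) auto
  finally show ?thesis by simp
qed

definition max_part :: "nat \<Rightarrow> (nat \<Rightarrow> 'a :: linorder) \<Rightarrow> 'a" where
  "max_part \<theta> x = Max (x ` {..<\<theta>})"

lemma le_max_part: "i < \<theta> \<Longrightarrow> x i \<le> max_part \<theta> x"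
  by (simp add: max_part_def)

lemma max_part_in:
  assumes "0 < \<theta>" obtains i where "i < \<theta>" "max_part \<theta> x = x i"
proof -
  have "Max (x ` {..<\<theta>}) \<in> x ` {..<\<theta>}" using assms by (intro Max_in) auto
  with that show ?thesis by (auto simp: max_part_def)
qed

text \<open>If the maximum is attained at the lowered colour \<open>j\<close>, then colour
  \<open>i\<close> takes over, as \<open>\<mu> j \<le> \<mu> i\<close>.\<close>

lemma max_part_raise:
  fixes \<mu> :: "nat \<Rightarrow> nat"
  assumes "(i, j) \<in> raising_pairs \<theta> \<mu>"
  shows "max_part \<theta> \<mu> \<le> max_part \<theta> (\<mu>(i := \<mu> i + r, j := \<mu> j - r))"
proof -
  have ij: "i < \<theta>" "j < \<theta>" "i \<noteq> j" "\<mu> j \<le> \<mu> i" using assms by (auto simp: raising_pairs_def)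
  let ?\<nu> = "\<mu>(i := \<mu> i + r, j := \<mu> j - r)"
  obtain l where l: "l < \<theta>" "max_part \<theta> \<mu> = \<mu> l" using ij max_part_in[of \<theta> \<mu>] by blast
  have "\<mu> l \<le> ?\<nu> (if l = j then i else l)" using ij by auto
  also have "\<dots> \<le> max_part \<theta> ?\<nu>" using ij l by (intro le_max_part) auto
  finally show ?thesis using l by simp
qed

lemma square_sum_raise:
  assumes "(i, j) \<in> raising_pairs \<theta> \<mu>" "r \<le> \<mu> j"
  shows "square_sum \<theta> (\<mu>(i := \<mu> i + r, j := \<mu> j - r))
    = square_sum \<theta> \<mu> + 2 * (real r * (real (\<mu> i) - real (\<mu> j) + real r))"
proof -
  have ij: "i < \<theta>" "j < \<theta>" "i \<noteq> j" using assms by (auto simp: raising_pairs_def)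
  have split: "square_sum \<theta> \<nu> = (real (\<nu> i))\<^sup>2 + (real (\<nu> j))\<^sup>2 + (\<Sum>k\<in>{..<\<theta>} - {i} - {j}. (real (\<nu> k))\<^sup>2)"
    for \<nu> using ij by (simp add: square_sum_def sum.remove[of _ i] sum.remove[of _ j])
  have "(\<Sum>k\<in>{..<\<theta>} - {i} - {j}. (real ((\<mu>(i := \<mu> i + r, j := \<mu> j - r)) k))\<^sup>2)
      = (\<Sum>k\<in>{..<\<theta>} - {i} - {j}. (real (\<mu> k))\<^sup>2)"
    by (rule sum.cong) auto
  then show ?thesis
    using assms(2) ij by (simp add: split of_nat_diff power2_eq_square algebra_simps)
qed

text \<open>The bound is a supersolution of the differential inequality that
  \<open>fixed_count_Suc_le\<close> gives for the exponential generating function.\<close>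
lemma sum_fixed_count_le:
  assumes T: "0 \<le> T" and \<delta>: "0 < \<delta>" and h: "0 \<le> h" and P: "0 \<le> P"
    and init: "\<And>\<mu>. real (card (colour_class \<theta> n \<mu>))
      \<le> P * exp (- (T + \<delta>) * square_sum \<theta> \<mu> / 2 - h * real (max_part \<theta> \<mu>))"
  shows "(\<Sum>k<K. T ^ k / fact k * fixed_count \<theta> n k \<mu>)
    \<le> P * exp (2 * (real \<theta>)\<^sup>2 / \<delta> * T - h * real (max_part \<theta> \<mu>))"
proof -
  \<comment> \<open>At most \<open>\<theta>\<^sup>2\<close> raising pairs, each contributing at most
    \<open>2 / \<delta>\<close> by \<open>sum_raising_weights_le\<close>.\<close>
  define \<kappa> where "\<kappa> = 2 * real (\<theta>\<^sup>2) / \<delta>"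
  let ?Q = "square_sum \<theta>"
  let ?m = "\<lambda>\<mu>. real (max_part \<theta> \<mu>)"
  \<comment> \<open>Differentiating in \<open>s\<close> yields the diagonal factor
    \<open>?Q \<mu> / 2\<close> plus \<kappa>. Up to time \<open>T\<close> the coefficient of
    \<open>?Q\<close> stays at least \<delta> in modulus, which makes the raised terms summable. At
    \<open>s = 0\<close> this is the bound \<open>init\<close>.\<close>
  define w where "w = (\<lambda>\<mu> s. P * exp (- (T + \<delta> - s) * ?Q \<mu> / 2 + \<kappa> * s - h * ?m \<mu>))"
  \<comment> \<open>The truncated generating function. The derivative at order \<open>Suc K\<close>
    is bounded in terms of order \<open>K\<close>, so an induction on \<open>K\<close> proves the
    comparison without any question of convergence.\<close>
  define u where "u = (\<lambda>K \<mu> s. \<Sum>k<K. s ^ k / fact k * fixed_count \<theta> n k \<mu>)"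
  have w_nonneg: "0 \<le> w \<mu> s" for \<mu> s using P by (simp add: w_def)
  have w_raise: "w (\<mu>(i := \<mu> i + r, j := \<mu> j - r)) s
      \<le> w \<mu> s * exp (- \<delta> * (real r * (real (\<mu> i) - real (\<mu> j) + real r)))"
    if ij: "(i, j) \<in> raising_pairs \<theta> \<mu>" and r: "r \<le> \<mu> j" and s: "s \<le> T" for \<mu> i j r s
  proof -
    let ?\<nu> = "\<mu>(i := \<mu> i + r, j := \<mu> j - r)" and ?f = "real r * (real (\<mu> i) - real (\<mu> j) + real r)"
    have f: "0 \<le> ?f" using ij by (auto simp: raising_pairs_def)
    have "h * ?m \<mu> \<le> h * ?m ?\<nu>"
      using max_part_raise[OF ij] h by (intro mult_left_mono) auto
    moreover have "\<delta> * ?f \<le> (T + \<delta> - s) * ?f"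
      using f s by (intro mult_right_mono) auto
    moreover have "- (T + \<delta> - s) * ?Q ?\<nu> / 2 = - (T + \<delta> - s) * ?Q \<mu> / 2 - (T + \<delta> - s) * ?f"
      unfolding square_sum_raise[OF ij r] by (simp add: field_simps)
    ultimately have "- (T + \<delta> - s) * ?Q ?\<nu> / 2 + \<kappa> * s - h * ?m ?\<nu>
        \<le> (- (T + \<delta> - s) * ?Q \<mu> / 2 + \<kappa> * s - h * ?m \<mu>) + - \<delta> * ?f"
      by linarith
    then have "exp (- (T + \<delta> - s) * ?Q ?\<nu> / 2 + \<kappa> * s - h * ?m ?\<nu>)
        \<le> exp (- (T + \<delta> - s) * ?Q \<mu> / 2 + \<kappa> * s - h * ?m \<mu>) * exp (- \<delta> * ?f)"
      by (simp only: exp_add[symmetric] exp_le_cancel_iff)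
    from mult_left_mono[OF this P] show ?thesis
      unfolding w_def by (simp only: mult.assoc)
  qed
  have w_sum: "(\<Sum>(i, j)\<in>raising_pairs \<theta> \<mu>. \<Sum>r = 1..\<mu> j. (real (\<mu> i) - real (\<mu> j) + 2 * real r) *
         w (\<mu>(i := \<mu> i + r, j := \<mu> j - r)) s) \<le> \<kappa> * w \<mu> s" if s: "s \<le> T" for \<mu> s
  proof -
    have "(\<Sum>r = 1..\<mu> j. (real (\<mu> i) - real (\<mu> j) + 2 * real r) * w (\<mu>(i := \<mu> i + r, j := \<mu> j - r)) s)
        \<le> w \<mu> s * (2 / \<delta>)" if ij: "(i, j) \<in> raising_pairs \<theta> \<mu>" for i j
    proof -
      have a: "0 \<le> real (\<mu> i) - real (\<mu> j)" using ij by (auto simp: raising_pairs_def)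
      have "(\<Sum>r = 1..\<mu> j. (real (\<mu> i) - real (\<mu> j) + 2 * real r) * w (\<mu>(i := \<mu> i + r, j := \<mu> j - r)) s)
         \<le> (\<Sum>r = 1..\<mu> j. (real (\<mu> i) - real (\<mu> j) + 2 * real r) *
              (w \<mu> s * exp (- \<delta> * (real r * (real (\<mu> i) - real (\<mu> j) + real r)))))"
        using a s by (intro sum_mono mult_left_mono w_raise[OF ij]) auto
      also have "\<dots> = w \<mu> s * (\<Sum>r = 1..\<mu> j. (real (\<mu> i) - real (\<mu> j) + 2 * real r) *
              exp (- \<delta> * (real r * (real (\<mu> i) - real (\<mu> j) + real r))))"
        by (simp add: sum_distrib_left mult.left_commute)
      also have "\<dots> \<le> w \<mu> s * (2 / \<delta>)"
        by (intro mult_left_mono sum_raising_weights_le a \<delta> w_nonneg)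
      finally show ?thesis .
    qed
    then have "(\<Sum>(i, j)\<in>raising_pairs \<theta> \<mu>. \<Sum>r = 1..\<mu> j. (real (\<mu> i) - real (\<mu> j) + 2 * real r) *
         w (\<mu>(i := \<mu> i + r, j := \<mu> j - r)) s) \<le> (\<Sum>(i, j)\<in>raising_pairs \<theta> \<mu>. w \<mu> s * (2 / \<delta>))"
      by (intro sum_mono) (auto simp: case_prod_unfold)
    also have "\<dots> = real (card (raising_pairs \<theta> \<mu>)) * (w \<mu> s * (2 / \<delta>))" by simp
    also have "\<dots> \<le> real (\<theta>\<^sup>2) * (w \<mu> s * (2 / \<delta>))"
      using w_nonneg[of \<mu> s] \<delta> card_raising_pairs_le[of \<theta> \<mu>]
      by (intro mult_right_mono) (auto simp del: of_nat_power)
    finally show ?thesis by (simp add: \<kappa>_def mult_ac)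
  qed
  have "u K \<mu> s \<le> w \<mu> s" if "0 \<le> s" "s \<le> T" for s
    using that
  proof (induction K arbitrary: \<mu> s)
    case 0
    then show ?case using w_nonneg by (simp add: u_def)
  next
    case (Suc K)
    let ?u' = "\<lambda>s. \<Sum>k<K. s ^ k / fact k * fixed_count \<theta> n (Suc k) \<mu>"
    let ?w' = "\<lambda>s. w \<mu> s * (?Q \<mu> / 2 + \<kappa>)"
    have u_eq: "u (Suc K) \<mu> = (\<lambda>s. fixed_count \<theta> n 0 \<mu>
        + (\<Sum>k<K. s ^ Suc k / fact (Suc k) * fixed_count \<theta> n (Suc k) \<mu>))"
      unfolding u_def by (subst sum.lessThan_Suc_shift) simp
    have du: "(u (Suc K) \<mu> has_real_derivative ?u' s) (at s)" for s
    proof -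
      have "((\<lambda>s. s ^ Suc k / fact (Suc k) * c) has_real_derivative s ^ k / fact k * c) (at s)"
        for k c
        by (rule DERIV_cong[OF DERIV_cmult_right[OF DERIV_cdivide[OF DERIV_pow]]]) (simp del: of_nat_Suc)
      then have "((\<lambda>s. \<Sum>k<K. s ^ Suc k / fact (Suc k) * fixed_count \<theta> n (Suc k) \<mu>)
          has_real_derivative ?u' s) (at s)" by (rule DERIV_sum)
      from DERIV_add[OF DERIV_const this] show ?thesis unfolding u_eq by (simp only: add_0_left)
    qed
    have dw: "(w \<mu> has_real_derivative ?w' s) (at s)" for s
      unfolding w_def by (auto intro!: derivative_eq_intros simp: field_simps)
    have le: "?u' s \<le> ?w' s" if s: "0 \<le> s" "s \<le> T" for s
    proof -
      have "?u' s \<le> (\<Sum>k<K. s ^ k / fact k * (?Q \<mu> / 2 * fixed_count \<theta> n k \<mu>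
        + (\<Sum>(i, j)\<in>raising_pairs \<theta> \<mu>. \<Sum>r = 1..\<mu> j. (real (\<mu> i) - real (\<mu> j) + 2 * real r) *
         fixed_count \<theta> n k (\<mu>(i := \<mu> i + r, j := \<mu> j - r)))))"
        using s by (intro sum_mono mult_left_mono fixed_count_Suc_le) auto
      also have "\<dots> = ?Q \<mu> / 2 * u K \<mu> s
        + (\<Sum>(i, j)\<in>raising_pairs \<theta> \<mu>. \<Sum>r = 1..\<mu> j. (real (\<mu> i) - real (\<mu> j) + 2 * real r) *
         u K (\<mu>(i := \<mu> i + r, j := \<mu> j - r)) s)"
        by (simp only: distrib_left sum.distrib u_def sum_distrib_left case_prod_unfold
          sum.swap[of _ _ "{..<K}"] mult.left_commute)
      also have "\<dots> \<le> ?Q \<mu> / 2 * w \<mu> s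
        + (\<Sum>(i, j)\<in>raising_pairs \<theta> \<mu>. \<Sum>r = 1..\<mu> j. (real (\<mu> i) - real (\<mu> j) + 2 * real r) *
         w (\<mu>(i := \<mu> i + r, j := \<mu> j - r)) s)"
        unfolding case_prod_unfold using s
        by (intro add_mono mult_left_mono sum_mono Suc.IH)
          (auto simp: square_sum_def raising_pairs_def intro!: sum_nonneg)
      also have "\<dots> \<le> ?Q \<mu> / 2 * w \<mu> s + \<kappa> * w \<mu> s"
        using w_sum s by (intro add_left_mono) auto
      finally show ?thesis by (simp add: algebra_simps)
    qed
    have "w \<mu> 0 - u (Suc K) \<mu> 0 \<le> w \<mu> s - u (Suc K) \<mu> s"
    proof (rule DERIV_nonneg_imp_nondecreasing[OF Suc.prems(1)])
      fix x assume x: "0 \<le> x" "x \<le> s"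
      have "((\<lambda>s. w \<mu> s - u (Suc K) \<mu> s) has_real_derivative ?w' x - ?u' x) (at x)"
        by (intro DERIV_diff dw du)
      moreover have "0 \<le> ?w' x - ?u' x" using le[of x] x Suc.prems by simp
      ultimately show "\<exists>y. ((\<lambda>s. w \<mu> s - u (Suc K) \<mu> s) has_real_derivative y) (at x) \<and> 0 \<le> y"
        by blast
    qed
    moreover have "u (Suc K) \<mu> 0 \<le> w \<mu> 0"
      using init[of \<mu>] by (simp add: u_eq w_def fixed_count_0)
    ultimately show ?case by simp
  qed
  from this[of T] have "u K \<mu> T \<le> w \<mu> T" using T by simp
  also have "\<dots> \<le> P * exp (\<kappa> * T - h * ?m \<mu>)"
    unfolding w_def using P \<delta> by (intro mult_left_mono) (auto simp: square_sum_def sum_nonneg)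
  finally show ?thesis by (simp add: u_def \<kappa>_def)
qed

section \<open>The variational formula for the free energy\<close>

definition prob_simplex :: "nat \<Rightarrow> (nat \<Rightarrow> real) set" where
  "prob_simplex \<theta> = {x. (\<forall>i<\<theta>. 0 \<le> x i) \<and> (\<Sum>i<\<theta>. x i) = 1}"

text \<open>A zero entry contributes zero, in agreement with the usual convention for
  \<open>0 * ln 0\<close>.\<close>

definition entropy :: "nat \<Rightarrow> (nat \<Rightarrow> real) \<Rightarrow> real" where
  "entropy \<theta> x = - (\<Sum>i<\<theta>. x i * ln (x i))"

text \<open>The other terms are symmetric in the entries, so for \<open>h \<ge> 0\<close> the
  supremum equals the one with the field acting on a single fixed colour.\<close>

definition free_energy :: "nat \<Rightarrow> real \<Rightarrow> real \<Rightarrow> (nat \<Rightarrow> real) \<Rightarrow> real" where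
  "free_energy \<theta> \<beta> h x = entropy \<theta> x + \<beta> / 2 * (\<Sum>i<\<theta>. (x i)\<^sup>2) + h * max_part \<theta> x"

definition max_free_energy :: "nat \<Rightarrow> real \<Rightarrow> real \<Rightarrow> real" where
  "max_free_energy \<theta> \<beta> h = (SUP x\<in>prob_simplex \<theta>. free_energy \<theta> \<beta> h x)"

lemma simplex_le_1:
  assumes "x \<in> prob_simplex \<theta>" "i < \<theta>"
  shows "x i \<le> 1"
  using assms member_le_sum[of i "{..<\<theta>}" x] by (auto simp: prob_simplex_def)

lemma simplex_sum_squares_le:
  assumes "x \<in> prob_simplex \<theta>"
  shows "(\<Sum>i<\<theta>. (x i)\<^sup>2) \<le> max_part \<theta> x"
proof -
  have "(\<Sum>i<\<theta>. (x i)\<^sup>2) \<le> (\<Sum>i<\<theta>. max_part \<theta> x * x i)"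
    using assms by (intro sum_mono)
      (auto simp: prob_simplex_def power2_eq_square intro!: mult_right_mono le_max_part)
  also have "\<dots> = max_part \<theta> x"
    using assms by (simp add: prob_simplex_def flip: sum_distrib_left)
  finally show ?thesis .
qed

lemma max_part_simplex_le_1:
  assumes "x \<in> prob_simplex \<theta>" "0 < \<theta>"
  shows "max_part \<theta> x \<le> 1"
  using max_part_in[OF assms(2), of x] simplex_le_1[OF assms(1)] by metis

lemma max_part_simplex_ge:
  assumes "x \<in> prob_simplex \<theta>" "0 < \<theta>"
  shows "1 / \<theta> \<le> max_part \<theta> x"
proof -
  have "1 = (\<Sum>i<\<theta>. x i)" using assms by (simp add: prob_simplex_def)
  also have "\<dots> \<le> (\<Sum>i<\<theta>. max_part \<theta> x)" by (intro sum_mono le_max_part) auto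
  finally show ?thesis using assms(2) by (simp add: field_simps)
qed

lemma uniform_in_prob_simplex: "0 < \<theta> \<Longrightarrow> (\<lambda>_. 1 / real \<theta>) \<in> prob_simplex \<theta>"
  by (simp add: prob_simplex_def)

lemma max_part_const: "0 < \<theta> \<Longrightarrow> max_part \<theta> (\<lambda>_. a) = a"
  by (metis max_part_in)

lemma gibbs_ineq:
  fixes x q :: real
  assumes "0 \<le> x" "0 < q"
  shows "x * ln q + x - q \<le> x * ln x"
proof (cases "x = 0")
  case False
  then have x: "0 < x" using assms by simp
  have "ln (q / x) \<le> q / x - 1" using x assms by (intro ln_le_minus_one) auto
  then have "x * ln (q / x) \<le> x * (q / x - 1)" using x by (intro mult_left_mono) auto
  then show ?thesis using x assms by (simp add: ln_div right_diff_distrib)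
qed (use assms in simp)

lemma entropy_le:
  assumes x: "x \<in> prob_simplex \<theta>" and "0 < \<theta>"
  shows "entropy \<theta> x \<le> ln \<theta>"
proof -
  have "(\<Sum>i<\<theta>. x i * ln (1 / \<theta>) + x i - 1 / \<theta>) \<le> (\<Sum>i<\<theta>. x i * ln (x i))"
    using assms by (intro sum_mono gibbs_ineq) (auto simp: prob_simplex_def)
  moreover have "(\<Sum>i<\<theta>. x i * ln (1 / \<theta>) + x i - 1 / \<theta>) = ln (1 / \<theta>)"
    using assms by (simp add: prob_simplex_def sum.distrib sum_subtractf flip: sum_distrib_right)
  ultimately show ?thesis using assms by (simp add: entropy_def ln_div)
qed

lemma entropy_uniform: "0 < \<theta> \<Longrightarrow> entropy \<theta> (\<lambda>_. 1 / real \<theta>) = ln \<theta>"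
  by (simp add: entropy_def ln_div)

lemma free_energy_bdd_above:
  assumes "0 < \<theta>" "0 \<le> \<beta>" "0 \<le> h"
  shows "bdd_above (free_energy \<theta> \<beta> h ` prob_simplex \<theta>)"
proof (rule bdd_aboveI2)
  fix x assume x: "x \<in> prob_simplex \<theta>"
  have "(\<Sum>i<\<theta>. (x i)\<^sup>2) \<le> 1" "max_part \<theta> x \<le> 1"
    using simplex_sum_squares_le[OF x] max_part_simplex_le_1[OF x assms(1)] by linarith+
  then show "free_energy \<theta> \<beta> h x \<le> ln \<theta> + \<beta> / 2 * 1 + h * 1"
    unfolding free_energy_def using assms entropy_le[OF x assms(1)]
    by (intro add_mono mult_left_mono) auto
qed

lemma free_energy_le_max:
  assumes "0 < \<theta>" "0 \<le> \<beta>" "0 \<le> h" "x \<in> prob_simplex \<theta>"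
  shows "free_energy \<theta> \<beta> h x \<le> max_free_energy \<theta> \<beta> h"
  unfolding max_free_energy_def using assms by (intro cSUP_upper free_energy_bdd_above)

lemma max_free_energy_le:
  assumes "0 < \<theta>" "\<And>x. x \<in> prob_simplex \<theta> \<Longrightarrow> free_energy \<theta> \<beta> h x \<le> a"
  shows "max_free_energy \<theta> \<beta> h \<le> a"
  unfolding max_free_energy_def using assms uniform_in_prob_simplex by (intro cSUP_least) auto

section \<open>Sizes of colour classes and the upper bound for the partition function\<close>

lemma sum_content:
  assumes "c \<in> colourings \<theta> n"
  shows "(\<Sum>i<\<theta>. colour_count n c i) = n"
proof -
  have "(\<Sum>i<\<theta>. \<Sum>v\<in>{v \<in> {1..n}. c v = i}. 1) = (\<Sum>v\<in>{1..n}. 1 :: nat)"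
    using assms by (intro sum.group) (auto simp: colourings_def)
  then show ?thesis by (simp add: colour_count_def)
qed

lemma sum_prod_colourings:
  fixes g :: "nat \<Rightarrow> nat \<Rightarrow> real"
  shows "(\<Sum>c\<in>colourings \<theta> n. \<Prod>v\<in>{1..n}. g v (c v)) = (\<Prod>v\<in>{1..n}. \<Sum>i<\<theta>. g v i)"
  unfolding colourings_def by (rule prod_sum_PiE[symmetric]) auto

text \<open>Under the product measure with marginal \<open>\<mu> / n\<close>, every colouring of the
  class has the same probability \<open>exp (- n * entropy)\<close>, and these probabilities add up
  to at most 1.\<close>

lemma card_colour_class_le:
  assumes c: "c \<in> colour_class \<theta> n \<mu>" and n: "0 < n"
  shows "(\<lambda>i. \<mu> i / n) \<in> prob_simplex \<theta>"
    and "card (colour_class \<theta> n \<mu>) \<le> exp (n * entropy \<theta> (\<lambda>i. \<mu> i / n))"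
proof -
  let ?x = "\<lambda>i. real (\<mu> i) / n"
  have "(\<Sum>i<\<theta>. \<mu> i) = n" using c sum_content by (auto simp: colour_class_def)
  then have "(\<Sum>i<\<theta>. ?x i) = 1"
    using n by (simp flip: sum_divide_distrib of_nat_sum)
  then show x: "?x \<in> prob_simplex \<theta>" by (simp add: prob_simplex_def)
  have p: "(\<Prod>v\<in>{1..n}. ?x (c v)) = exp (- n * entropy \<theta> ?x)" if "c \<in> colour_class \<theta> n \<mu>" for c
  proof -
    have \<mu>: "\<mu> = colour_count n c" and c: "c \<in> colourings \<theta> n" using that by (auto simp: colour_class_def)
    have "(\<Prod>v\<in>{1..n}. ?x (c v)) = (\<Prod>i<\<theta>. \<Prod>v\<in>{v \<in> {1..n}. c v = i}. ?x (c v))"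
      using c by (intro prod.group[symmetric]) (auto simp: colourings_def)
    also have "\<dots> = (\<Prod>i<\<theta>. ?x i ^ \<mu> i)"
      by (intro prod.cong) (auto simp: \<mu> colour_count_def)
    also have "\<dots> = (\<Prod>i<\<theta>. exp (\<mu> i * ln (?x i)))"
    \<comment> \<open>For an absent colour both sides are 1, as \<open>0 ^ 0\<close> and
      \<open>exp 0\<close>.\<close>
    proof (rule prod.cong)
      fix i
      show "?x i ^ \<mu> i = exp (\<mu> i * ln (?x i))"
        using n by (cases "\<mu> i = 0") (auto simp: exp_of_nat_mult)
    qed simp
    also have "\<dots> = exp (\<Sum>i<\<theta>. \<mu> i * ln (?x i))" by (simp add: exp_sum)
    also have "(\<Sum>i<\<theta>. \<mu> i * ln (?x i)) = - n * entropy \<theta> ?x"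
      using n by (simp add: entropy_def sum_distrib_left sum_negf)
    finally show ?thesis .
  qed
  have "card (colour_class \<theta> n \<mu>) * exp (- n * entropy \<theta> ?x)
      = (\<Sum>c\<in>colour_class \<theta> n \<mu>. \<Prod>v\<in>{1..n}. ?x (c v))"
    using p by simp
  also have "\<dots> \<le> (\<Sum>c\<in>colourings \<theta> n. \<Prod>v\<in>{1..n}. ?x (c v))"
    by (rule sum_mono2) (auto simp: colour_class_def intro!: prod_nonneg)
  also have "\<dots> = 1"
    using x by (subst sum_prod_colourings[where g = "\<lambda>_. ?x"]) (simp add: prob_simplex_def)
  finally have "card (colour_class \<theta> n \<mu>) * exp (- n * entropy \<theta> ?x) * exp (n * entropy \<theta> ?x)
      \<le> 1 * exp (n * entropy \<theta> ?x)"
    by (rule mult_right_mono) simp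
  then show "card (colour_class \<theta> n \<mu>) \<le> exp (n * entropy \<theta> ?x)"
    by (simp add: mult.assoc flip: exp_add)
qed

text \<open>Polynomially many classes, hence no contribution to the exponential growth rate.\<close>

lemma card_contents_le: "card (colour_count n ` colourings \<theta> n) \<le> (n + 1) ^ \<theta>"
proof -
  have "colour_count n ` colourings \<theta> n \<subseteq> (\<lambda>f i. if i < \<theta> then f i else 0) ` ({..<\<theta>} \<rightarrow>\<^sub>E {..n})"
  proof clarify
    fix c assume c: "c \<in> colourings \<theta> n"
    have "colour_count n c i \<le> n" for i
      using card_mono[of "{1..n}" "{v \<in> {1..n}. c v = i}"] by (simp add: colour_count_def subset_iff)
    moreover have "colour_count n c i = 0" if "\<not> i < \<theta>" for i
    proof -
      have "{v \<in> {1..n}. c v = i} = {}" using c that by (auto simp: colourings_def PiE_iff)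
      then show ?thesis unfolding colour_count_def by (simp only: card.empty)
    qed
    ultimately show "colour_count n c \<in> (\<lambda>f i. if i < \<theta> then f i else 0) ` ({..<\<theta>} \<rightarrow>\<^sub>E {..n})"
      by (intro image_eqI[where x = "restrict (colour_count n c) {..<\<theta>}"]) (auto simp: fun_eq_iff)
  qed
  then have "card (colour_count n ` colourings \<theta> n) \<le> card ({..<\<theta>} \<rightarrow>\<^sub>E {..n})"
    by (intro surj_card_le) (auto simp: finite_PiE)
  then show ?thesis by (simp add: card_PiE)
qed

lemma sum_cycle_weight_eq:
  assumes "l < \<theta>"
  shows "(\<Sum>es\<in>edge_seqs n k. cycle_weight \<theta> h n (perm_of_seq es)) =
    (\<Sum>\<mu>\<in>colour_count n ` colourings \<theta> n. exp (h * real (\<mu> l)) * fixed_count \<theta> n k \<mu>)"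
proof -
  have "cycle_weight \<theta> h n (perm_of_seq es) = (\<Sum>\<mu>\<in>colour_count n ` colourings \<theta> n.
      exp (h * real (\<mu> l)) * card (fixed_colourings \<theta> n \<mu> (perm_of_seq es)))"
    if "es \<in> edge_seqs n k" for es
  proof -
    let ?\<sigma> = "perm_of_seq es"
    have \<sigma>: "?\<sigma> permutes {1..n}" using that by (intro permutes_perm_of_seq) (simp add: edge_seqs_def)
    have "cycle_weight \<theta> h n ?\<sigma> = (\<Sum>\<mu>\<in>colour_count n ` colourings \<theta> n.
        \<Sum>c\<in>{c \<in> {c. c \<in> colourings \<theta> n \<and> c \<circ> ?\<sigma> = c}. colour_count n c = \<mu>}. exp (h * real (colour_count n c l)))"
      unfolding cycle_weight_eq_sum_colourings[OF \<sigma> assms]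
      by (rule sum.group[symmetric]) auto
    also have "\<dots> = (\<Sum>\<mu>\<in>colour_count n ` colourings \<theta> n. \<Sum>c\<in>fixed_colourings \<theta> n \<mu> ?\<sigma>. exp (h * real (\<mu> l)))"
      by (intro sum.cong) (auto simp: fixed_colourings_def colour_class_def)
    finally show ?thesis by (simp add: mult.commute)
  qed
  then have "(\<Sum>es\<in>edge_seqs n k. cycle_weight \<theta> h n (perm_of_seq es)) =
    (\<Sum>es\<in>edge_seqs n k. \<Sum>\<mu>\<in>colour_count n ` colourings \<theta> n.
      exp (h * real (\<mu> l)) * card (fixed_colourings \<theta> n \<mu> (perm_of_seq es)))"
    by (rule sum.cong[OF refl])
  then show ?thesis
    by (simp only: fixed_count_def sum_distrib_left sum.swap[of _ _ "edge_seqs n k"])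
qed

lemma card_edge_seqs: "card (edge_seqs n k) = card (edges n) ^ k"
  unfolding edge_seqs_def by (rule card_lists_length_eq) simp

text \<open>Every cycle weight is at most \<open>W\<close>, the sum over all colourings whether
  fixed or not, so an exponential series in \<open>T * card (edges n)\<close> dominates.\<close>

lemma summable_Z:
  assumes "0 < \<theta>" "0 \<le> T"
  shows "summable (\<lambda>k. a * T ^ k / fact k *
    (\<Sum>es\<in>edge_seqs n k. cycle_weight \<theta> h n (perm_of_seq es)))"
proof (rule summable_comparison_test)
  define W where "W = (\<Sum>c\<in>colourings \<theta> n. exp (h * real (colour_count n c 0)))"
  have W: "0 \<le> cycle_weight \<theta> h n (perm_of_seq es) \<and> cycle_weight \<theta> h n (perm_of_seq es) \<le> W"
    if "es \<in> edge_seqs n k" for es k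
  proof -
    have \<sigma>: "perm_of_seq es permutes {1..n}"
      using that by (intro permutes_perm_of_seq) (simp add: edge_seqs_def)
    show ?thesis unfolding cycle_weight_eq_sum_colourings[OF \<sigma> assms(1)] W_def
      by (auto intro!: sum_nonneg sum_mono2)
  qed
  have "norm (a * T ^ k / fact k * (\<Sum>es\<in>edge_seqs n k. cycle_weight \<theta> h n (perm_of_seq es)))
    \<le> \<bar>a\<bar> * W * (inverse (fact k) * (T * real (card (edges n))) ^ k)" for k
  proof -
    have "(\<Sum>es\<in>edge_seqs n k. cycle_weight \<theta> h n (perm_of_seq es)) \<le> (\<Sum>es\<in>edge_seqs n k. W)"
      using W by (intro sum_mono) auto
    then have "(\<Sum>es\<in>edge_seqs n k. cycle_weight \<theta> h n (perm_of_seq es)) \<le> real (card (edges n)) ^ k * W"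
      by (simp add: card_edge_seqs)
    moreover have "0 \<le> (\<Sum>es\<in>edge_seqs n k. cycle_weight \<theta> h n (perm_of_seq es))"
      using W by (intro sum_nonneg) auto
    ultimately have "\<bar>a\<bar> * T ^ k / fact k * (\<Sum>es\<in>edge_seqs n k. cycle_weight \<theta> h n (perm_of_seq es))
        \<le> \<bar>a\<bar> * T ^ k / fact k * (real (card (edges n)) ^ k * W)"
      using assms by (intro mult_left_mono) auto
    then show ?thesis
      using assms \<open>0 \<le> (\<Sum>es\<in>edge_seqs n k. _ es)\<close>
      by (simp add: abs_mult power_mult_distrib divide_inverse mult_ac)
  qed
  then show "\<exists>N. \<forall>k\<ge>N. norm (a * T ^ k / fact k * (\<Sum>es\<in>edge_seqs n k. cycle_weight \<theta> h n (perm_of_seq es)))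
    \<le> \<bar>a\<bar> * W * (inverse (fact k) * (T * real (card (edges n))) ^ k)" by blast
  show "summable (\<lambda>k. \<bar>a\<bar> * W * (inverse (fact k) * (T * real (card (edges n))) ^ k))"
    by (intro summable_mult summable_exp)
qed

text \<open>Here \<open>sum_fixed_count_le\<close> is used with \<open>T = \<beta> / n\<close> and
  \<open>\<delta> = \<epsilon> / n\<close>. Its loss
  \<open>exp (2 * \<theta>\<^sup>2 / \<delta> * T)\<close> is then independent of \<open>n\<close>,
  at the price of replacing \<beta> by \<open>\<beta> + \<epsilon>\<close> in the free
  energy.\<close>

lemma Z_le:
  assumes \<theta>: "0 < \<theta>" and \<beta>: "0 < \<beta>" and \<epsilon>: "0 < \<epsilon>" and h: "0 \<le> h" and n: "0 < n"
  shows "Z \<theta> n \<beta> h \<le> exp (- (h / \<theta>) * n) * (exp (- real (card (edges n)) * \<beta> / n) *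
    ((real n + 1) ^ \<theta> * (exp (n * max_free_energy \<theta> (\<beta> + \<epsilon>) h) * exp (2 * (real \<theta>)\<^sup>2 * \<beta> / \<epsilon>))))"
proof -
  define T where "T = \<beta> / n"
  define P where "P = exp (n * max_free_energy \<theta> (\<beta> + \<epsilon>) h)"
  define A where "A = exp (- real (card (edges n)) * \<beta> / n)"
  define W where "W = (\<lambda>k. \<Sum>es\<in>edge_seqs n k. cycle_weight \<theta> h n (perm_of_seq es))"
  let ?C = "colour_count n ` colourings \<theta> n"
  have T: "0 < T" and \<delta>: "0 < \<epsilon> / n" using \<beta> \<epsilon> n by (auto simp: T_def)
  \<comment> \<open>The entropy bound on the class size, with \<open>P\<close> chosen as the
    exponential of \<open>n\<close> times the maximal free energy at
    \<open>\<beta> + \<epsilon>\<close>.\<close>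
  have init: "real (card (colour_class \<theta> n \<mu>))
      \<le> P * exp (- (T + \<epsilon> / n) * square_sum \<theta> \<mu> / 2 - h * real (max_part \<theta> \<mu>))" for \<mu>
  proof (cases "colour_class \<theta> n \<mu> = {}")
    case True
    then show ?thesis by (simp add: P_def)
  next
    case False
    then obtain c where c: "c \<in> colour_class \<theta> n \<mu>" by blast
    let ?x = "\<lambda>i. real (\<mu> i) / n"
    have mp: "n * max_part \<theta> ?x \<ge> real (max_part \<theta> \<mu>)"
    proof -
      obtain i where "i < \<theta>" "max_part \<theta> \<mu> = \<mu> i" using max_part_in[OF \<theta>] by blast
      with le_max_part[of i \<theta> ?x] n show ?thesis by (simp add: field_simps)
    qed
    have sq: "(\<Sum>i<\<theta>. (?x i)\<^sup>2) = square_sum \<theta> \<mu> / n\<^sup>2"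
      by (simp add: square_sum_def power_divide sum_divide_distrib)
    have "n * entropy \<theta> ?x + (T + \<epsilon> / n) * square_sum \<theta> \<mu> / 2 + h * max_part \<theta> \<mu>
        \<le> n * entropy \<theta> ?x + (T + \<epsilon> / n) * square_sum \<theta> \<mu> / 2 + h * (n * max_part \<theta> ?x)"
      using mp h by (intro add_left_mono mult_left_mono) auto
    also have "\<dots> = n * free_energy \<theta> (\<beta> + \<epsilon>) h ?x"
      unfolding free_energy_def sq T_def using n by (simp add: field_simps power2_eq_square)
    also have "\<dots> \<le> n * max_free_energy \<theta> (\<beta> + \<epsilon>) h"
      using free_energy_le_max[OF \<theta> _ h card_colour_class_le(1)[OF c n], of "\<beta> + \<epsilon>"] \<beta> \<epsilon>
      by (intro mult_left_mono) auto
    finally have "exp (n * entropy \<theta> ?x) \<le> exp (n * max_free_energy \<theta> (\<beta> + \<epsilon>) h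
        + (- (T + \<epsilon> / n) * square_sum \<theta> \<mu> / 2 - h * real (max_part \<theta> \<mu>)))"
      by (simp add: algebra_simps add_divide_distrib diff_divide_distrib)
    then show ?thesis
      using card_colour_class_le(2)[OF c n] by (simp add: P_def exp_add)
  qed
  have bound: "(\<Sum>k<K. A * T ^ k / fact k * W k)
      \<le> A * ((real n + 1) ^ \<theta> * (P * exp (2 * (real \<theta>)\<^sup>2 * \<beta> / \<epsilon>)))" for K
  proof -
    \<comment> \<open>The weight of the marked colour 0 is absorbed by the \<open>max_part\<close>
      term in the exponent of the supersolution.\<close>
    have "exp (h * real (\<mu> 0)) * (\<Sum>k<K. T ^ k / fact k * fixed_count \<theta> n k \<mu>)
        \<le> P * exp (2 * (real \<theta>)\<^sup>2 * \<beta> / \<epsilon>)" for \<mu>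
    proof -
      have "exp (h * real (\<mu> 0)) * (\<Sum>k<K. T ^ k / fact k * fixed_count \<theta> n k \<mu>)
        \<le> exp (h * real (max_part \<theta> \<mu>)) * (P * exp (2 * (real \<theta>)\<^sup>2 / (\<epsilon> / n) * T - h * real (max_part \<theta> \<mu>)))"
      proof (rule mult_mono)
        show "exp (h * real (\<mu> 0)) \<le> exp (h * real (max_part \<theta> \<mu>))"
          using le_max_part[OF \<theta>, of \<mu>] h by (simp add: mult_left_mono)
        show "(\<Sum>k<K. T ^ k / fact k * fixed_count \<theta> n k \<mu>)
            \<le> P * exp (2 * (real \<theta>)\<^sup>2 / (\<epsilon> / n) * T - h * real (max_part \<theta> \<mu>))"
          using sum_fixed_count_le[OF _ \<delta> h _ init] T by (simp add: P_def)
        show "0 \<le> (\<Sum>k<K. T ^ k / fact k * fixed_count \<theta> n k \<mu>)"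
          using T by (intro sum_nonneg mult_nonneg_nonneg) (auto simp: fixed_count_def intro: sum_nonneg)
      qed simp
      also have "\<dots> = P * exp (2 * (real \<theta>)\<^sup>2 / (\<epsilon> / n) * T)"
        by (simp add: exp_diff)
      also have "2 * (real \<theta>)\<^sup>2 / (\<epsilon> / n) * T = 2 * (real \<theta>)\<^sup>2 * \<beta> / \<epsilon>"
        using n by (simp add: T_def)
      finally show ?thesis .
    qed
    then have "(\<Sum>\<mu>\<in>?C. exp (h * real (\<mu> 0)) * (\<Sum>k<K. T ^ k / fact k * fixed_count \<theta> n k \<mu>))
        \<le> (\<Sum>\<mu>\<in>?C. P * exp (2 * (real \<theta>)\<^sup>2 * \<beta> / \<epsilon>))"
      by (intro sum_mono)
    also have "\<dots> = card ?C * (P * exp (2 * (real \<theta>)\<^sup>2 * \<beta> / \<epsilon>))" by simp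
    also have "\<dots> \<le> (real n + 1) ^ \<theta> * (P * exp (2 * (real \<theta>)\<^sup>2 * \<beta> / \<epsilon>))"
      using of_nat_mono[OF card_contents_le[of n \<theta>], where 'a = real]
      by (intro mult_right_mono) (auto simp: P_def add.commute)
    finally have "A * (\<Sum>\<mu>\<in>?C. exp (h * real (\<mu> 0)) * (\<Sum>k<K. T ^ k / fact k * fixed_count \<theta> n k \<mu>))
        \<le> A * ((real n + 1) ^ \<theta> * (P * exp (2 * (real \<theta>)\<^sup>2 * \<beta> / \<epsilon>)))"
      by (rule mult_left_mono) (simp add: A_def)
    moreover have "(\<Sum>k<K. A * T ^ k / fact k * W k)
        = A * (\<Sum>\<mu>\<in>?C. exp (h * real (\<mu> 0)) * (\<Sum>k<K. T ^ k / fact k * fixed_count \<theta> n k \<mu>))"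
      unfolding W_def sum_cycle_weight_eq[OF \<theta>] sum_distrib_left sum.swap[of _ "?C"]
      by (simp add: mult_ac)
    ultimately show ?thesis by simp
  qed
  have "summable (\<lambda>k. A * T ^ k / fact k * W k)"
    unfolding W_def using T by (intro summable_Z \<theta>) simp
  then have "(\<Sum>k. A * T ^ k / fact k * W k) \<le> A * ((real n + 1) ^ \<theta> * (P * exp (2 * (real \<theta>)\<^sup>2 * \<beta> / \<epsilon>)))"
    using bound by (rule suminf_le_const)
  then have "exp (- (h / \<theta>) * n) * (\<Sum>k. A * T ^ k / fact k * W k)
      \<le> exp (- (h / \<theta>) * n) * (A * ((real n + 1) ^ \<theta> * (P * exp (2 * (real \<theta>)\<^sup>2 * \<beta> / \<epsilon>))))"
    by (rule mult_left_mono) simp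
  then show ?thesis
    unfolding Z_def W_def A_def T_def P_def edge_seqs_def .
qed

section \<open>The Potts lower bound for the partition function\<close>

definition monochromatic_edges :: "nat \<Rightarrow> (nat \<Rightarrow> nat) \<Rightarrow> (nat \<times> nat) set" where
  "monochromatic_edges n c = {(x, y) \<in> edges n. c x = c y}"

lemma monochromatic_edges_subset: "monochromatic_edges n c \<subseteq> edges n"
  by (auto simp: monochromatic_edges_def)

lemma finite_monochromatic_edges [simp]: "finite (monochromatic_edges n c)"
  by (rule finite_subset[OF monochromatic_edges_subset finite_edges])

lemma perm_of_seq_monochromatic:
  assumes "set es \<subseteq> monochromatic_edges n c"
  shows "c \<circ> perm_of_seq es = c"
  using assms
proof (induction es)
  case (Cons e es)
  then have "c (fst e) = c (snd e)" by (auto simp: monochromatic_edges_def)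
  then have "c \<circ> Transposition.transpose (fst e) (snd e) = c"
    by (auto simp: fun_eq_iff Transposition.transpose_def)
  with Cons show ?case by (simp add: perm_of_seq_Cons comp_assoc[symmetric] del: o_apply)
qed simp

text \<open>Among the sequences whose permutation fixes \<open>c\<close>, those built from
  monochromatic edges number exactly a \<open>k\<close>-th power, so the later sum over
  \<open>k\<close> is an exponential.\<close>

lemma sum_cycle_weight_ge:
  assumes l: "l < \<theta>"
  shows "(\<Sum>c\<in>colourings \<theta> n. exp (h * real (colour_count n c l)) * real (card (monochromatic_edges n c)) ^ k)
    \<le> (\<Sum>es\<in>edge_seqs n k. cycle_weight \<theta> h n (perm_of_seq es))"
proof -
  let ?M = "\<lambda>c. {es. set es \<subseteq> monochromatic_edges n c \<and> length es = k}"
  have sub: "?M c \<subseteq> edge_seqs n k" for c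
    using monochromatic_edges_subset[of n c] by (auto simp: edge_seqs_def)
  have "(\<Sum>c\<in>colourings \<theta> n. exp (h * real (colour_count n c l)) * real (card (monochromatic_edges n c)) ^ k)
      = (\<Sum>c\<in>colourings \<theta> n. \<Sum>es\<in>?M c. exp (h * real (colour_count n c l)))"
    by (simp add: card_lists_length_eq mult.commute)
  also have "\<dots> \<le> (\<Sum>c\<in>colourings \<theta> n. \<Sum>es\<in>edge_seqs n k.
      if c \<circ> perm_of_seq es = c then exp (h * real (colour_count n c l)) else 0)"
  proof (rule sum_mono)
    fix c
    have "(\<Sum>es\<in>?M c. exp (h * real (colour_count n c l)))
        = (\<Sum>es\<in>?M c. if c \<circ> perm_of_seq es = c then exp (h * real (colour_count n c l)) else 0)"
      by (intro sum.cong refl) (auto simp: perm_of_seq_monochromatic)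
    also have "\<dots> \<le> (\<Sum>es\<in>edge_seqs n k. if c \<circ> perm_of_seq es = c then exp (h * real (colour_count n c l)) else 0)"
      by (rule sum_mono2[OF finite_edge_seqs sub]) auto
    finally show "(\<Sum>es\<in>?M c. exp (h * real (colour_count n c l))) \<le>
      (\<Sum>es\<in>edge_seqs n k. if c \<circ> perm_of_seq es = c then exp (h * real (colour_count n c l)) else 0)" .
  qed
  also have "\<dots> = (\<Sum>es\<in>edge_seqs n k. \<Sum>c\<in>colourings \<theta> n.
      if c \<circ> perm_of_seq es = c then exp (h * real (colour_count n c l)) else 0)"
    by (rule sum.swap)
  also have "\<dots> = (\<Sum>es\<in>edge_seqs n k. cycle_weight \<theta> h n (perm_of_seq es))"
  proof (rule sum.cong[OF refl])
    fix es assume "es \<in> edge_seqs n k"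
    then have \<sigma>: "perm_of_seq es permutes {1..n}"
      by (intro permutes_perm_of_seq) (simp add: edge_seqs_def)
    show "(\<Sum>c\<in>colourings \<theta> n. if c \<circ> perm_of_seq es = c then exp (h * real (colour_count n c l)) else 0)
        = cycle_weight \<theta> h n (perm_of_seq es)"
      unfolding cycle_weight_eq_sum_colourings[OF \<sigma> l] by (simp add: sum.inter_filter)
  qed
  finally show ?thesis .
qed

lemma Z_ge_potts:
  fixes h :: real
  assumes l: "l < \<theta>" and \<beta>: "0 < \<beta>"
  shows "exp (- (h / \<theta>) * n) * (\<Sum>c\<in>colourings \<theta> n. exp (h * colour_count n c l
      - \<beta> / n * (real (card (edges n)) - real (card (monochromatic_edges n c))))) \<le> Z \<theta> n \<beta> h"
proof -
  define T where "T = \<beta> / n"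
  define A where "A = exp (- real (card (edges n)) * \<beta> / n)"
  let ?m = "\<lambda>c. real (card (monochromatic_edges n c))"
  let ?e = "\<lambda>c. exp (h * real (colour_count n c l))"
  have T: "0 \<le> T" using \<beta> by (simp add: T_def)
  have "(\<lambda>k. \<Sum>c\<in>colourings \<theta> n. A * ?e c * ((T * ?m c) ^ k /\<^sub>R fact k))
      sums (\<Sum>c\<in>colourings \<theta> n. A * ?e c * exp (T * ?m c))"
    by (intro sums_sum sums_mult exp_converges)
  also have "(\<lambda>k. \<Sum>c\<in>colourings \<theta> n. A * ?e c * ((T * ?m c) ^ k /\<^sub>R fact k))
      = (\<lambda>k. A * T ^ k / fact k * (\<Sum>c\<in>colourings \<theta> n. ?e c * ?m c ^ k))"
    by (auto simp: sum_distrib_left power_mult_distrib divide_inverse mult_ac fun_eq_iff)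
  finally have s: "(\<lambda>k. A * T ^ k / fact k * (\<Sum>c\<in>colourings \<theta> n. ?e c * ?m c ^ k))
      sums (\<Sum>c\<in>colourings \<theta> n. A * ?e c * exp (T * ?m c))" .
  have "(\<Sum>c\<in>colourings \<theta> n. A * ?e c * exp (T * ?m c))
      = (\<Sum>k. A * T ^ k / fact k * (\<Sum>c\<in>colourings \<theta> n. ?e c * ?m c ^ k))"
    using s by (rule sums_unique)
  also have "\<dots> \<le> (\<Sum>k. A * T ^ k / fact k * (\<Sum>es\<in>edge_seqs n k. cycle_weight \<theta> h n (perm_of_seq es)))"
    using l T by (intro suminf_le mult_left_mono sum_cycle_weight_ge sums_summable[OF s] summable_Z)
      (auto simp: A_def)
  finally have "exp (- (h / \<theta>) * n) * (\<Sum>c\<in>colourings \<theta> n. A * ?e c * exp (T * ?m c)) \<le> Z \<theta> n \<beta> h"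
    unfolding Z_def by (intro mult_left_mono) (auto simp: A_def T_def edge_seqs_def)
  moreover have "A * ?e c * exp (T * ?m c) = exp (h * colour_count n c l
      - \<beta> / n * (real (card (edges n)) - ?m c))" for c
    unfolding A_def T_def exp_add[symmetric] by (simp add: algebra_simps diff_divide_distrib)
  ultimately show ?thesis by simp
qed

lemma sum_colourings_weight_1:
  assumes x: "x \<in> prob_simplex \<theta>"
  shows "(\<Sum>c\<in>colourings \<theta> n. \<Prod>v\<in>{1..n}. x (c v)) = 1"
  using x by (subst sum_prod_colourings[where g = "\<lambda>_. x"]) (simp add: prob_simplex_def)

lemma sum_colourings_weight_vertex:
  assumes x: "x \<in> prob_simplex \<theta>" and v: "v \<in> {1..n}"
  shows "(\<Sum>c\<in>colourings \<theta> n. (\<Prod>v\<in>{1..n}. x (c v)) * f (c v)) = (\<Sum>i<\<theta>. x i * f i)"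
proof -
  have "(\<Sum>c\<in>colourings \<theta> n. (\<Prod>v\<in>{1..n}. x (c v)) * f (c v))
      = (\<Sum>c\<in>colourings \<theta> n. \<Prod>w\<in>{1..n}. x (c w) * (if w = v then f (c w) else 1))"
    using v by (simp add: prod.distrib)
  also have "\<dots> = (\<Prod>w\<in>{1..n}. \<Sum>i<\<theta>. x i * (if w = v then f i else 1))"
    by (rule sum_prod_colourings[where g = "\<lambda>w i. x i * (if w = v then f i else 1)"])
  also have "\<dots> = (\<Prod>w\<in>{1..n}. if w = v then \<Sum>i<\<theta>. x i * f i else 1)"
    using x by (intro prod.cong) (auto simp: prob_simplex_def)
  finally show ?thesis using v by simp
qed

text \<open>The event \<open>c v = c w\<close> is split by the common colour \<open>j\<close>; each
  piece factorises over the vertices, and \<open>v \<noteq> w\<close> yields two separate factors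
  \<open>x j\<close>.\<close>

lemma sum_colourings_weight_edge:
  assumes x: "x \<in> prob_simplex \<theta>" and v: "v \<in> {1..n}" and w: "w \<in> {1..n}" and "v \<noteq> w"
  shows "(\<Sum>c\<in>colourings \<theta> n. (\<Prod>v\<in>{1..n}. x (c v)) * of_bool (c v = c w)) = (\<Sum>i<\<theta>. (x i)\<^sup>2)"
proof -
  let ?g = "\<lambda>j u i. x i * ((if u = v then of_bool (i = j) else 1) * (if u = w then of_bool (i = j) else 1))"
  have "(\<Sum>c\<in>colourings \<theta> n. (\<Prod>v\<in>{1..n}. x (c v)) * of_bool (c v = c w))
      = (\<Sum>c\<in>colourings \<theta> n. \<Sum>j<\<theta>. (\<Prod>v\<in>{1..n}. x (c v)) * (of_bool (c v = j) * of_bool (c w = j)))"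
  proof (rule sum.cong[OF refl])
    fix c assume "c \<in> colourings \<theta> n"
    then have cw: "c w < \<theta>" using w by (auto simp: colourings_def PiE_iff)
    have "(\<Sum>j<\<theta>. of_bool (c v = j) * of_bool (c w = j)) = (of_bool (c v = c w) :: real)"
    proof -
      have "(\<Sum>j<\<theta>. of_bool (c v = j) * of_bool (c w = j)) = (\<Sum>j<\<theta>. if j = c w then of_bool (c v = c w) else (0::real))"
        by (intro sum.cong) auto
      then show ?thesis using cw by simp
    qed
    then show "(\<Prod>v\<in>{1..n}. x (c v)) * of_bool (c v = c w)
        = (\<Sum>j<\<theta>. (\<Prod>v\<in>{1..n}. x (c v)) * (of_bool (c v = j) * of_bool (c w = j)))"
      by (simp flip: sum_distrib_left)
  qed
  also have "\<dots> = (\<Sum>j<\<theta>. \<Sum>c\<in>colourings \<theta> n. (\<Prod>v\<in>{1..n}. x (c v)) * (of_bool (c v = j) * of_bool (c w = j)))"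
    by (rule sum.swap)
  also have "\<dots> = (\<Sum>j<\<theta>. \<Sum>c\<in>colourings \<theta> n. \<Prod>u\<in>{1..n}. ?g j u (c u))"
    using v w by (simp add: prod.distrib)
  also have "\<dots> = (\<Sum>j<\<theta>. \<Prod>u\<in>{1..n}. \<Sum>i<\<theta>. ?g j u i)"
    by (intro sum.cong refl sum_prod_colourings)
  also have "\<dots> = (\<Sum>j<\<theta>. (x j)\<^sup>2)"
  proof (rule sum.cong[OF refl])
    fix j assume j: "j \<in> {..<\<theta>}"
    have "(\<Prod>u\<in>{1..n}. \<Sum>i<\<theta>. ?g j u i)
        = (\<Prod>u\<in>{1..n}. (if u = v then x j else 1) * (if u = w then x j else 1))"
    proof (rule prod.cong[OF refl])
      fix u
      have "(\<Sum>i<\<theta>. x i * of_bool (i = j)) = x j"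
        using j by (simp add: of_bool_def if_distrib cong: if_cong)
      then show "(\<Sum>i<\<theta>. ?g j u i) = (if u = v then x j else 1) * (if u = w then x j else 1)"
        using x \<open>v \<noteq> w\<close> by (auto simp: prob_simplex_def)
    qed
    then show "(\<Prod>u\<in>{1..n}. \<Sum>i<\<theta>. ?g j u i) = (x j)\<^sup>2"
      using v w by (simp add: prod.distrib power2_eq_square)
  qed
  finally show ?thesis .
qed

text \<open>Gibbs' variational principle for the Potts partition function of \<open>Z_ge_potts\<close>,
  with trial measure the product measure with marginal \<open>x\<close>.\<close>
lemma Z_ge:
  assumes x: "x \<in> prob_simplex \<theta>" and l: "l < \<theta>" and \<beta>: "0 < \<beta>" and n: "0 < n"
  shows "exp (- (h / \<theta>) * n) * exp (n * entropy \<theta> x + h * n * x l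
      - \<beta> / n * card (edges n) * (1 - (\<Sum>i<\<theta>. (x i)\<^sup>2))) \<le> Z \<theta> n \<beta> h"
proof -
  define p where "p = (\<lambda>c. \<Prod>v\<in>{1..n}. x (c v))"
  define T where "T = \<beta> / n"
  let ?m = "\<lambda>c. real (card (monochromatic_edges n c))"
  define H where "H = (\<lambda>c. h * colour_count n c l - T * (real (card (edges n)) - ?m c))"
  \<comment> \<open>The logarithm of the density of the Potts weight \<open>exp (H c)\<close> with
    respect to \<open>p\<close>; its mean under \<open>p\<close> is the exponent
    \<open>?a\<close>.\<close>
  define u where "u = (\<lambda>c. H c - (\<Sum>v\<in>{1..n}. ln (x (c v))))"
  let ?C = "colourings \<theta> n"
  let ?a = "n * entropy \<theta> x + h * n * x l - T * card (edges n) * (1 - (\<Sum>i<\<theta>. (x i)\<^sup>2))"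
  have x0: "0 \<le> x (c v)" if "c \<in> ?C" "v \<in> {1..n}" for c v
    using x that by (auto simp: prob_simplex_def colourings_def PiE_iff)
  have p0: "0 \<le> p c" if "c \<in> ?C" for c
    unfolding p_def using x0 that by (intro prod_nonneg) auto
  have p1: "(\<Sum>c\<in>?C. p c) = 1" unfolding p_def by (rule sum_colourings_weight_1[OF x])
  have "(\<Sum>c\<in>?C. p c * colour_count n c l) = (\<Sum>c\<in>?C. \<Sum>v\<in>{1..n}. p c * of_bool (c v = l))"
    by (simp add: colour_count_def sum.If_cases of_bool_def Int_def flip: sum_distrib_left)
  also have "\<dots> = (\<Sum>v\<in>{1..n}. \<Sum>c\<in>?C. p c * of_bool (c v = l))" by (rule sum.swap)
  also have "\<dots> = (\<Sum>v\<in>{1..n}. \<Sum>i<\<theta>. x i * of_bool (i = l))"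
    unfolding p_def by (intro sum.cong refl sum_colourings_weight_vertex[OF x, where f = "\<lambda>i. of_bool (i = l)"])
  also have "\<dots> = n * x l"
    using l by (simp add: of_bool_def if_distrib cong: if_cong)
  finally have e1: "(\<Sum>c\<in>?C. p c * colour_count n c l) = n * x l" .
  have "(\<Sum>c\<in>?C. p c * (\<Sum>v\<in>{1..n}. ln (x (c v)))) = (\<Sum>v\<in>{1..n}. \<Sum>c\<in>?C. p c * ln (x (c v)))"
    unfolding sum_distrib_left by (rule sum.swap)
  also have "\<dots> = (\<Sum>v\<in>{1..n}. \<Sum>i<\<theta>. x i * ln (x i))"
    unfolding p_def by (intro sum.cong refl sum_colourings_weight_vertex[OF x, where f = "\<lambda>i. ln (x i)"])
  also have "\<dots> = - n * entropy \<theta> x" by (simp add: entropy_def)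
  finally have e2: "(\<Sum>c\<in>?C. p c * (\<Sum>v\<in>{1..n}. ln (x (c v)))) = - n * entropy \<theta> x" .
  have m: "?m c = (\<Sum>e\<in>edges n. of_bool (c (fst e) = c (snd e)))" for c
    by (simp add: monochromatic_edges_def sum.If_cases of_bool_def Int_def case_prod_unfold)
  have "(\<Sum>c\<in>?C. p c * ?m c) = (\<Sum>e\<in>edges n. \<Sum>c\<in>?C. p c * of_bool (c (fst e) = c (snd e)))"
    unfolding m sum_distrib_left by (rule sum.swap)
  also have "\<dots> = (\<Sum>e\<in>edges n. \<Sum>i<\<theta>. (x i)\<^sup>2)"
    unfolding p_def by (intro sum.cong refl sum_colourings_weight_edge[OF x]) (auto simp: edges_def)
  finally have e3: "(\<Sum>c\<in>?C. p c * ?m c) = card (edges n) * (\<Sum>i<\<theta>. (x i)\<^sup>2)" by simp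
  have "(\<Sum>c\<in>?C. p c * u c) = h * (\<Sum>c\<in>?C. p c * colour_count n c l) - T * card (edges n) * (\<Sum>c\<in>?C. p c)
      + T * (\<Sum>c\<in>?C. p c * ?m c) - (\<Sum>c\<in>?C. p c * (\<Sum>v\<in>{1..n}. ln (x (c v))))"
    unfolding u_def H_def sum_distrib_left[of h] sum_distrib_left[of T] sum_distrib_left[of "T * _"]
      sum.distrib[symmetric] sum_subtractf[symmetric]
    by (intro sum.cong refl) (simp add: algebra_simps)
  also have "\<dots> = ?a" unfolding e1 e2 e3 p1 by (simp add: algebra_simps)
  finally have eu: "(\<Sum>c\<in>?C. p c * u c) = ?a" .
  \<comment> \<open>Jensen's inequality for \<open>exp\<close>, through the tangent at the mean
    \<open>?a\<close> of \<open>u\<close>. Colourings with \<open>p c = 0\<close> give 0 on the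
    left.\<close>
  have "p c * exp ?a * (1 + u c - ?a) \<le> exp (H c)" if c: "c \<in> ?C" for c
  proof (cases "p c = 0")
    case False
    have xp: "0 < x (c v)" if "v \<in> {1..n}" for v
      using False x0[OF c that] that by (auto simp: p_def less_le)
    have "p c * exp (u c) = exp (H c)"
    proof -
      have "p c = exp (\<Sum>v\<in>{1..n}. ln (x (c v)))"
        unfolding p_def using xp by (simp add: exp_sum)
      then show ?thesis by (simp add: u_def flip: exp_add)
    qed
    moreover have "exp ?a * (1 + (u c - ?a)) \<le> exp ?a * exp (u c - ?a)"
      by (intro mult_left_mono exp_ge_add_one_self) simp
    then have "exp ?a * (1 + u c - ?a) \<le> exp (u c)"
      by (simp add: algebra_simps flip: exp_add)
    then have "p c * (exp ?a * (1 + u c - ?a)) \<le> p c * exp (u c)"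
      by (intro mult_left_mono p0 c)
    ultimately show ?thesis by (simp add: mult.assoc)
  qed simp
  then have "(\<Sum>c\<in>?C. p c * exp ?a * (1 + u c - ?a)) \<le> (\<Sum>c\<in>?C. exp (H c))"
    by (rule sum_mono)
  also have "(\<Sum>c\<in>?C. p c * exp ?a * (1 + u c - ?a))
      = exp ?a * ((1 - ?a) * (\<Sum>c\<in>?C. p c) + (\<Sum>c\<in>?C. p c * u c))"
    unfolding sum_distrib_left sum.distrib[symmetric]
    by (intro sum.cong refl) (simp only: algebra_simps)
  also have "\<dots> = exp ?a" unfolding p1 eu by simp
  finally have "exp (- (h / \<theta>) * n) * exp ?a \<le> exp (- (h / \<theta>) * n) * (\<Sum>c\<in>?C. exp (H c))"
    by (rule mult_left_mono) simp
  also have "\<dots> \<le> Z \<theta> n \<beta> h"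
    unfolding H_def T_def by (rule Z_ge_potts[OF l \<beta>])
  finally show ?thesis unfolding T_def .
qed

section \<open>The limit of the free energy\<close>

lemma max_free_energy_add_le:
  assumes "0 < \<theta>" "0 \<le> \<beta>" "0 \<le> \<epsilon>" "0 \<le> h"
  shows "max_free_energy \<theta> (\<beta> + \<epsilon>) h \<le> max_free_energy \<theta> \<beta> h + \<epsilon> / 2"
proof (rule max_free_energy_le)
  fix x assume x: "x \<in> prob_simplex \<theta>"
  have "(\<Sum>i<\<theta>. (x i)\<^sup>2) \<le> 1"
    using simplex_sum_squares_le[OF x] max_part_simplex_le_1[OF x assms(1)] by linarith
  then have "\<epsilon> / 2 * (\<Sum>i<\<theta>. (x i)\<^sup>2) \<le> \<epsilon> / 2 * 1"
    using assms by (intro mult_left_mono) auto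
  then show "free_energy \<theta> (\<beta> + \<epsilon>) h x \<le> max_free_energy \<theta> \<beta> h + \<epsilon> / 2"
    using free_energy_le_max[OF assms(1,2,4) x] by (simp add: free_energy_def algebra_simps add_divide_distrib)
qed fact

lemma real_card_edges: "real (card (edges n)) = real n * (real n - 1) / 2"
proof -
  have "2 * real (card (edges n)) = real (n * (n - 1))"
    using card_edges[of n] by (metis of_nat_mult of_nat_numeral)
  then show ?thesis by (cases n) (auto simp: algebra_simps)
qed

text \<open>The lower bound is exact for every positive \<open>n\<close>. In the upper bound the
  shift of \<beta> is the tolerance \<open>r\<close> itself, which costs \<open>r / 2\<close>; the
  remaining error vanishes as \<open>n\<close> grows.\<close>

theorem ln_Z_tendsto:
  assumes \<theta>: "0 < \<theta>" and \<beta>: "0 < \<beta>" and h: "0 \<le> h"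
  shows "(\<lambda>n. ln (Z \<theta> n \<beta> h) / n) \<longlonglongrightarrow> max_free_energy \<theta> \<beta> h - \<beta> / 2 - h / \<theta>"
proof (rule LIMSEQ_I)
  let ?F = "max_free_energy \<theta> \<beta> h - \<beta> / 2 - h / \<theta>"
  have pos: "0 < Z \<theta> n \<beta> h" if "0 < n" for n
    using Z_ge[OF uniform_in_prob_simplex[OF \<theta>] \<theta> \<beta> that] by (rule less_le_trans[rotated]) simp
  have lower: "?F \<le> ln (Z \<theta> n \<beta> h) / n" if n: "0 < n" for n
  proof -
    have "free_energy \<theta> \<beta> h x \<le> ln (Z \<theta> n \<beta> h) / n + \<beta> / 2 + h / \<theta>" if x: "x \<in> prob_simplex \<theta>" for x
    proof -
      let ?s = "\<Sum>i<\<theta>. (x i)\<^sup>2"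
      obtain l where l: "l < \<theta>" "max_part \<theta> x = x l" using max_part_in[OF \<theta>] by blast
      have "?s \<le> 1"
        using simplex_sum_squares_le[OF x] max_part_simplex_le_1[OF x \<theta>] by linarith
      \<comment> \<open>There are \<open>n * (n - 1) / 2\<close> edges, and replacing
        \<open>n - 1\<close> by \<open>n\<close> only weakens the lower bound.\<close>
      then have "\<beta> * (1 - ?s) * ((real n - 1) / 2) \<le> \<beta> * (1 - ?s) * (n / 2)"
        using \<beta> by (intro mult_left_mono) auto
      moreover have "\<beta> / n * card (edges n) * (1 - ?s) = \<beta> * (1 - ?s) * ((real n - 1) / 2)"
        using n by (simp add: real_card_edges field_simps)
      ultimately have "n * (free_energy \<theta> \<beta> h x - \<beta> / 2 - h / \<theta>)
          \<le> - (h / \<theta>) * n + (n * entropy \<theta> x + h * n * x l - \<beta> / n * card (edges n) * (1 - ?s))"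
        unfolding free_energy_def l(2) by (simp add: algebra_simps diff_divide_distrib add_divide_distrib)
      also have "\<dots> = ln (exp (- (h / \<theta>) * n) * exp (n * entropy \<theta> x + h * n * x l
          - \<beta> / n * card (edges n) * (1 - ?s)))"
        unfolding exp_add[symmetric] by (rule ln_exp[symmetric])
      also have "\<dots> \<le> ln (Z \<theta> n \<beta> h)"
        using Z_ge[OF x l(1) \<beta> n, of h] by (intro ln_mono) auto
      finally show ?thesis using n by (simp add: field_simps)
    qed
    from max_free_energy_le[OF \<theta> this] show ?thesis by simp
  qed
  fix r :: real assume r: "0 < r"
  \<comment> \<open>The three terms come from the number of colour classes, the loss in the
    supersolution, and the difference between \<open>n\<^sup>2 / 2\<close> and the number of
    edges.\<close>
  let ?err = "\<lambda>n::nat. (\<theta> * ln (real n + 1) + 2 * (real \<theta>)\<^sup>2 * \<beta> / r + \<beta> / 2) / n"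
  have upper: "ln (Z \<theta> n \<beta> h) / n \<le> ?F + r / 2 + ?err n" if n: "0 < n" for n
  proof -
    let ?G = "max_free_energy \<theta> (\<beta> + r) h"
    have "ln (Z \<theta> n \<beta> h) \<le> ln (exp (- (h / \<theta>) * n) * (exp (- real (card (edges n)) * \<beta> / n) *
        ((real n + 1) ^ \<theta> * (exp (n * ?G) * exp (2 * (real \<theta>)\<^sup>2 * \<beta> / r)))))"
      using Z_le[OF \<theta> \<beta> r h n] pos[OF n] by (intro ln_mono) auto
    also have "\<dots> = - (h / \<theta>) * n + (- real (card (edges n)) * \<beta> / n + (\<theta> * ln (real n + 1)
        + (n * ?G + 2 * (real \<theta>)\<^sup>2 * \<beta> / r)))"
      by (simp add: ln_mult ln_realpow)
    also have "- real (card (edges n)) * \<beta> / n = - (n * (\<beta> / 2)) + \<beta> / 2"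
      using n by (simp add: real_card_edges field_simps)
    also have "n * ?G \<le> n * (max_free_energy \<theta> \<beta> h + r / 2)"
      using max_free_energy_add_le[OF \<theta> _ _ h, of \<beta> r] \<beta> r by (intro mult_left_mono) auto
    finally have "ln (Z \<theta> n \<beta> h) \<le> n * (?F + r / 2) + (\<theta> * ln (real n + 1) + 2 * (real \<theta>)\<^sup>2 * \<beta> / r + \<beta> / 2)"
      by (simp add: algebra_simps)
    then show ?thesis using n by (simp add: field_simps)
  qed
  have "?err \<longlonglongrightarrow> 0" by real_asymp
  then have "eventually (\<lambda>n. ?err n < r / 2) sequentially"
    using r by (intro order_tendstoD) auto
  then obtain N where N: "\<And>n. n \<ge> N \<Longrightarrow> ?err n < r / 2"
    by (auto simp: eventually_sequentially)
  show "\<exists>N. \<forall>n\<ge>N. norm (ln (Z \<theta> n \<beta> h) / n - ?F) < r"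
  proof (intro exI allI impI)
    fix n assume "n \<ge> max N 1"
    then have n: "0 < n" "n \<ge> N" by auto
    show "norm (ln (Z \<theta> n \<beta> h) / n - ?F) < r"
      using lower[OF n(1)] upper[OF n(1)] N[OF n(2)] unfolding real_norm_def by linarith
  qed
qed

corollary z_eq:
  assumes "0 < \<theta>" "0 < \<beta>" "0 \<le> h"
  shows "z \<theta> \<beta> h = max_free_energy \<theta> \<beta> h - \<beta> / 2 - h / \<theta>"
  unfolding z_def by (rule limI) (rule ln_Z_tendsto[OF assms])

section \<open>Logarithmic inequalities\<close>

text \<open>The difference vanishes at 1 and has derivative \<open>(1 - 1 / x)\<^sup>2\<close>. It
  gives both the concavity of \<open>k * ln k / (k - 1)\<close> and its bound by
  \<open>(k + 1) / 2\<close>.\<close>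

lemma two_ln_le_diff_inverse:
  fixes k :: real
  assumes "1 \<le> k"
  shows "2 * ln k \<le> k - 1 / k"
proof -
  let ?f = "\<lambda>k::real. k - 1 / k - 2 * ln k"
  have "?f 1 \<le> ?f k"
  proof (rule DERIV_nonneg_imp_nondecreasing[OF assms])
    fix x :: real assume x: "1 \<le> x" "x \<le> k"
    have "(?f has_real_derivative (1 - 1 / x)\<^sup>2) (at x)"
      using x by (auto intro!: derivative_eq_intros simp: field_simps power2_eq_square)
    then show "\<exists>y. (?f has_real_derivative y) (at x) \<and> 0 \<le> y" by (meson zero_le_power2)
  qed
  then show ?thesis by simp
qed

lemma add_one_mult_ln_ge:
  fixes r :: real
  assumes "1 \<le> r"
  shows "2 * (r - 1) \<le> (r + 1) * ln r"
proof -
  let ?f = "\<lambda>r::real. (r + 1) * ln r - 2 * (r - 1)"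
  have "?f 1 \<le> ?f r"
  proof (rule DERIV_nonneg_imp_nondecreasing[OF assms])
    fix x :: real assume x: "1 \<le> x" "x \<le> r"
    have "(?f has_real_derivative ln x + (x + 1) / x - 2) (at x)"
      using x by (auto intro!: derivative_eq_intros simp: field_simps)
    moreover have "ln (1 / x) \<le> 1 / x - 1" using x by (intro ln_le_minus_one) auto
    then have "0 \<le> ln x + (x + 1) / x - 2" using x by (simp add: ln_div field_simps)
    ultimately show "\<exists>y. (?f has_real_derivative y) (at x) \<and> 0 \<le> y" by blast
  qed
  then show ?thesis by simp
qed

text \<open>The function \<open>k * ln k / (k - 1)\<close> is concave on the numbers above 1, so it
  lies below its tangent at \<open>r\<close>.\<close>

lemma mult_ln_divide_tangent:
  fixes k r :: real
  assumes "1 < k" "1 < r"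
  shows "k * ln k / (k - 1) \<le> r * ln r / (r - 1) + (r - 1 - ln r) / (r - 1)\<^sup>2 * (k - r)"
proof -
  let ?f = "\<lambda>k::real. - (k * ln k / (k - 1))"
  let ?f' = "\<lambda>k::real. - ((k - 1 - ln k) / (k - 1)\<^sup>2)"
  let ?f'' = "\<lambda>k::real. (k - 1 / k - 2 * ln k) / (k - 1) ^ 3"
  have "?f' r * (k - r) \<le> ?f k - ?f r"
  proof (rule f''_imp_f'[where C = "{1<..}" and f'' = ?f''])
    fix x :: real assume "x \<in> {1<..}"
    then have x: "1 < x" by simp
    show "(?f has_real_derivative ?f' x) (at x)"
      using x by (auto intro!: derivative_eq_intros simp: field_simps power2_eq_square)
    show "(?f' has_real_derivative ?f'' x) (at x)"
    proof -
      have "(?f' has_real_derivative - (((1 - 1 / x) * (x - 1)\<^sup>2 - (x - 1 - ln x) * (2 * (x - 1))) / ((x - 1)\<^sup>2)\<^sup>2)) (at x)"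
        using x by (auto intro!: derivative_eq_intros simp: power2_eq_square)
      moreover have "- (((1 - 1 / x) * (x - 1)\<^sup>2 - (x - 1 - ln x) * (2 * (x - 1))) / ((x - 1)\<^sup>2)\<^sup>2) = ?f'' x"
      proof -
        have n: "x - 1 \<noteq> 0" "x \<noteq> 0" using x by auto
        have "- ((1 - 1 / x) * (x - 1)\<^sup>2 - (x - 1 - ln x) * (2 * (x - 1))) = (x - 1) * (x - 1 / x - 2 * ln x)"
          using n by (simp add: field_simps power2_eq_square)
        moreover have "((x - 1)\<^sup>2)\<^sup>2 = (x - 1) * (x - 1) ^ 3"
          by (simp add: power2_eq_square power3_eq_cube)
        ultimately show ?thesis
          by (simp only: minus_divide_left nonzero_mult_divide_mult_cancel_left[OF n(1)])
      qed
      ultimately show ?thesis by simp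
    qed
    show "0 \<le> ?f'' x" using x two_ln_le_diff_inverse[of x] by auto
  qed (use assms in auto)
  then show ?thesis by simp
qed

text \<open>With the tangent at \<open>r\<close> in place of \<open>k * ln k / (k - 1)\<close>, the
  sides differ by exactly \<open>k * ((r + 1) * ln r - 2 * (r - 1))\<close>.\<close>

lemma mult_ln_gap_ge_1:
  fixes k r :: real
  assumes k: "1 < k" and r: "1 \<le> r"
  shows "k * ln k / (k - 1) * (r - 1)\<^sup>2 \<le> (r + k) * (r * ln r - r + 1)"
proof (cases "r = 1")
  case False
  then have r1: "1 < r" using r by simp
  have "k * ln k / (k - 1) * (r - 1)\<^sup>2
      \<le> (r * ln r / (r - 1) + (r - 1 - ln r) / (r - 1)\<^sup>2 * (k - r)) * (r - 1)\<^sup>2"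
    by (intro mult_right_mono mult_ln_divide_tangent k r1) simp
  also have "\<dots> = r * ln r * (r - 1) + (r - 1 - ln r) * (k - r)"
    using r1 by (simp add: distrib_right power2_eq_square)
  also have "\<dots> = (r + k) * (r * ln r - r + 1) - k * ((r + 1) * ln r - 2 * (r - 1))"
    by (simp add: algebra_simps)
  also have "\<dots> \<le> (r + k) * (r * ln r - r + 1)"
    using add_one_mult_ln_ge[OF r] k by simp
  finally show ?thesis .
qed (use k in simp)

text \<open>On this range the second derivative of \<open>r * ln r\<close> is at least 1.\<close>

lemma mult_ln_gap_le_1:
  fixes r :: real
  assumes "0 \<le> r" "r \<le> 1"
  shows "(r - 1)\<^sup>2 / 2 \<le> r * ln r - r + 1"
proof (cases "r = 0")
  case False
  then have r: "0 < r" using assms by simp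
  let ?f = "\<lambda>r::real. r * ln r - r + 1 - (r - 1)\<^sup>2 / 2"
  have "?f 1 \<le> ?f r"
  proof (rule DERIV_nonpos_imp_nonincreasing[OF assms(2)])
    fix x :: real assume x: "r \<le> x" "x \<le> 1"
    have "(?f has_real_derivative ln x - (x - 1)) (at x)"
      using x r by (auto intro!: derivative_eq_intros simp: field_simps)
    moreover have "ln x - (x - 1) \<le> 0" using ln_le_minus_one[of x] x r by simp
    ultimately show "\<exists>y. (?f has_real_derivative y) (at x) \<and> y \<le> 0" by blast
  qed
  then show ?thesis by simp
qed simp

text \<open>The tangent at \<open>s\<close> of \<open>x ln x - B x\<^sup>2\<close>, \<open>B = k ln k / (k - 1)\<close>, supports this function on
  \<open>[0, t]\<close> although it is not convex there.\<close>
lemma mult_ln_tangent_gap: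
  fixes k s t x :: real
  assumes k: "1 < k" and s: "0 < s" "s \<le> t" "t + k * s = 1" and x: "0 \<le> x" "x \<le> t"
  shows "k * ln k / (k - 1) * (x - s)\<^sup>2 \<le> x * ln x - x * ln s - x + s"
proof -
  \<comment> \<open>Rescaling by \<open>s\<close> turns the tangent gap into \<open>s\<close> times
    the gap of \<open>r * ln r\<close> at 1.\<close>
  define r where "r = x / s"
  define B where "B = k * ln k / (k - 1)"
  have xr: "x = r * s" and r0: "0 \<le> r" using s x by (auto simp: r_def)
  have B0: "0 \<le> B" using k by (simp add: B_def)
  have eq: "x * ln x - x * ln s - x + s = s * (r * ln r - r + 1)"
    unfolding xr using s r0 by (cases "r = 0") (auto simp: ln_mult algebra_simps)
  have sq: "(x - s)\<^sup>2 = s * (s * (r - 1)\<^sup>2)"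
    unfolding xr by (simp add: algebra_simps power2_eq_square)
  have "s * (B * (r - 1)\<^sup>2) \<le> r * ln r - r + 1"
  proof (cases "1 \<le> r")
    case True
    \<comment> \<open>Because \<open>s * r = x \<le> t\<close> and
      \<open>t + k * s = 1\<close>.\<close>
    have "s * (r + k) \<le> 1" using s x unfolding xr by (simp add: algebra_simps)
    then have "s * (r + k) * (B * (r - 1)\<^sup>2) \<le> 1 * (B * (r - 1)\<^sup>2)"
      using B0 by (intro mult_right_mono) auto
    also have "\<dots> \<le> (r + k) * (r * ln r - r + 1)"
      using mult_ln_gap_ge_1[OF k True] by (simp add: B_def)
    finally have "(r + k) * (s * (B * (r - 1)\<^sup>2)) \<le> (r + k) * (r * ln r - r + 1)"
      by (simp add: mult_ac)
    moreover have "0 < r + k" using r0 k by simp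
    ultimately show ?thesis by (simp only: mult_le_cancel_left_pos)
  next
    case False
    \<comment> \<open>From \<open>s \<le> t\<close> and \<open>t + k * s = 1\<close> one has
      \<open>s * (k + 1) \<le> 1\<close>, hence \<open>s * B \<le> 1 / 2\<close>, and the quadratic
      bound below 1 suffices.\<close>
    have "B \<le> (k + 1) / 2"
    proof -
      have "k * (2 * ln k) \<le> k * (k - 1 / k)"
        using two_ln_le_diff_inverse[of k] k by (intro mult_left_mono) auto
      then have "2 * (k * ln k) \<le> (k + 1) * (k - 1)" using k by (simp add: algebra_simps)
      then show ?thesis using k by (simp add: B_def field_simps)
    qed
    then have "s * B \<le> s * ((k + 1) / 2)" using s by (intro mult_left_mono) auto
    also have "\<dots> \<le> 1 / 2" using s by (simp add: algebra_simps)
    finally have "s * B * (r - 1)\<^sup>2 \<le> 1 / 2 * (r - 1)\<^sup>2" by (rule mult_right_mono) simp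
    also have "\<dots> \<le> r * ln r - r + 1" using mult_ln_gap_le_1[of r] False r0 by simp
    finally show ?thesis by (simp add: mult.assoc)
  qed
  then have "s * (s * (B * (r - 1)\<^sup>2)) \<le> s * (r * ln r - r + 1)"
    using s by (intro mult_left_mono) auto
  then show ?thesis unfolding eq sq B_def[symmetric] by (simp add: mult_ac)
qed

lemma convex_on_two_zeros:
  fixes f :: "real \<Rightarrow> real"
  assumes f: "convex_on S f" and S: "a \<in> S" "b \<in> S" "t \<in> S" and ab: "a < b" and z: "f a = 0" "f b = 0"
  shows "a \<le> t \<Longrightarrow> t \<le> b \<Longrightarrow> f t \<le> 0" and "b \<le> t \<Longrightarrow> 0 \<le> f t"
proof -
  assume t: "a \<le> t" "t \<le> b"
  let ?l = "(t - a) / (b - a)"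
  have "(1 - ?l) * a + ?l * b = a + ?l * (b - a)" by (simp only: algebra_simps)
  then have "(1 - ?l) * a + ?l * b = t" using ab by simp
  moreover have "f ((1 - ?l) * a + ?l * b) \<le> (1 - ?l) * f a + ?l * f b"
    using convex_onD[OF f, of ?l a b] S t ab by simp
  ultimately show "f t \<le> 0" using z by simp
next
  assume t: "b \<le> t"
  let ?l = "(b - a) / (t - a)"
  have l: "0 < ?l" "?l \<le> 1" using t ab by auto
  have "(1 - ?l) * a + ?l * t = a + ?l * (t - a)" by (simp only: algebra_simps)
  then have "(1 - ?l) * a + ?l * t = b" using ab t by simp
  moreover have "f ((1 - ?l) * a + ?l * t) \<le> (1 - ?l) * f a + ?l * f t"
    using convex_onD[OF f, of ?l a t] S l by simp
  ultimately have "0 \<le> ?l * f t" using z by simp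
  then show "0 \<le> f t" using l by (simp only: zero_le_mult_iff) linarith
qed

text \<open>The derivative of the difference of the two sides is odd about \<open>1/2\<close> and convex to the
  right of it, with zeros \<open>1/(k + 1)\<close>, \<open>1/2\<close> and \<open>k/(k + 1)\<close>.\<close>
lemma two_value_log_ineq:
  fixes k t :: real
  assumes k: "1 < k" and t: "1 / (k + 1) \<le> t" "t \<le> 1"
  shows "(k + 1) * ln k / (k - 1) * (t - 1 / (k + 1))\<^sup>2
    \<le> t * ln t + (1 - t) * ln ((1 - t) / k) + ln (k + 1)"
\<comment> \<open>The derivative is logarithmically singular at 1, so the endpoint is treated
  directly.\<close>
proof (cases "t = 1")
  case True
  have "1 / (k + 1) \<le> ln ((k + 1) / k)"
  proof -
    have "ln (k / (k + 1)) \<le> k / (k + 1) - 1" using k by (intro ln_le_minus_one) auto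
    then show ?thesis using k by (simp add: ln_div field_simps)
  qed
  then have "(k\<^sup>2 - 1) * (1 / (k + 1)) \<le> (k\<^sup>2 - 1) * ln ((k + 1) / k)"
    using k by (intro mult_left_mono) auto
  moreover have "(k\<^sup>2 - 1) * (1 / (k + 1)) = k - 1"
    using k by (simp add: field_simps power2_eq_square)
  moreover have "ln k \<le> k - 1" using k by (intro ln_le_minus_one) auto
  ultimately have "k\<^sup>2 * ln k \<le> (k\<^sup>2 - 1) * ln (k + 1)"
    using k by (simp add: ln_div algebra_simps)
  then have "k\<^sup>2 * ln k / (k\<^sup>2 - 1) \<le> ln (k + 1)"
    using k by (simp add: pos_divide_le_eq mult.commute)
  moreover have "(k + 1) * ln k / (k - 1) * (1 - 1 / (k + 1))\<^sup>2 = k\<^sup>2 * ln k / (k\<^sup>2 - 1)"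
  proof -
    have "1 - 1 / (k + 1) = k / (k + 1)" using k by (simp add: field_simps)
    moreover have "k\<^sup>2 - 1 = (k - 1) * (k + 1)" by (simp add: algebra_simps power2_eq_square)
    ultimately show ?thesis using k by (simp add: power_divide power2_eq_square)
  qed
  ultimately show ?thesis using True by simp
next
  case False
  define L where "L = (k + 1) * ln k / (k - 1)"
  define a where "a = 1 / (k + 1)"
  define D where "D = (\<lambda>t. t * ln t + (1 - t) * ln ((1 - t) / k) + ln (k + 1) - L * (t - a)\<^sup>2)"
  define q where "q = (\<lambda>t. ln t - ln (1 - t) + ln k - 2 * L * (t - a))"
  have a: "0 < a" "a < 1 / 2" "1 - a = k / (k + 1)" using k by (auto simp: a_def field_simps)
  have ak: "(1 - a) / k = a" unfolding a(3) using k by (simp add: a_def)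
  \<comment> \<open>This identity makes \<open>q\<close> odd about 1/2; it also makes
    \<open>D\<close> vanish at \<open>1 - a\<close> as well as at \<open>a\<close>.\<close>
  have La: "L * (1 - 2 * a) = ln k"
  proof -
    have "1 - 2 * a = (k - 1) / (k + 1)" using k by (simp add: a_def field_simps)
    then show ?thesis using k by (simp add: L_def)
  qed
  have lna: "ln (1 - a) = ln k - ln (k + 1)" "ln a = - ln (k + 1)"
    unfolding a(3) using k by (auto simp: a_def ln_div)
  have odd: "q (1 - t) = - q t" for t
    unfolding q_def La[symmetric] by (simp add: algebra_simps)
  have dD: "(D has_real_derivative q t) (at t)" if "0 < t" "t < 1" for t
  proof -
    have "(D has_real_derivative ln t + 1 - (ln ((1 - t) / k) + 1) - 2 * L * (t - a)) (at t)"
      unfolding D_def using that k by (auto intro!: derivative_eq_intros)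
    moreover have "ln t + 1 - (ln ((1 - t) / k) + 1) - 2 * L * (t - a) = q t"
      using that k by (simp add: ln_div q_def)
    ultimately show ?thesis by (simp only:)
  qed
  have conv: "convex_on {1/2..<1} q"
  proof (rule f''_ge0_imp_convex[where f' = "\<lambda>t. 1 / t + 1 / (1 - t) - 2 * L"
        and f'' = "\<lambda>t. 1 / (1 - t)\<^sup>2 - 1 / t\<^sup>2"])
    fix x :: real assume x: "x \<in> {1/2..<1}"
    show "(q has_real_derivative 1 / x + 1 / (1 - x) - 2 * L) (at x)"
      unfolding q_def using x by (auto intro!: derivative_eq_intros simp: field_simps)
    show "((\<lambda>t. 1 / t + 1 / (1 - t) - 2 * L) has_real_derivative 1 / (1 - x)\<^sup>2 - 1 / x\<^sup>2) (at x)"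
      using x by (auto intro!: derivative_eq_intros simp: power2_eq_square)
    have "(1 - x)\<^sup>2 \<le> x\<^sup>2" using x by (intro power_mono) auto
    then show "0 \<le> 1 / (1 - x)\<^sup>2 - 1 / x\<^sup>2" using x by (simp add: divide_left_mono)
  qed auto
  have q0: "q (1/2) = 0" using odd[of "1/2"] by simp
  have qa: "q a = 0" using lna by (simp add: q_def)
  then have q1: "q (1 - a) = 0" using odd[of a] by simp
  have neg: "q t \<le> 0" if "1/2 \<le> t" "t \<le> 1 - a" for t
    using convex_on_two_zeros(1)[OF conv _ _ _ _ q0 q1, of t] that a(1,2) by auto
  have pos: "0 \<le> q t" if "1 - a \<le> t" "t < 1" for t
    using convex_on_two_zeros(2)[OF conv _ _ _ _ q0 q1, of t] that a(1,2) by auto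
  have pos': "0 \<le> q t" if "a \<le> t" "t \<le> 1/2" for t
    using neg[of "1 - t"] odd[of t] that by simp
  have Da: "D a = 0"
    unfolding D_def ak by (simp add: lna algebra_simps)
  have D1: "D (1 - a) = 0"
  proof -
    have l: "ln (a / k) = - ln (k + 1) - ln k" using k a lna by (simp add: ln_div)
    have i: "1 - (1 - a) = a" by simp
    have "D (1 - a) = (1 - a) * (ln k - ln (k + 1)) - a * (ln (k + 1) + ln k) + ln (k + 1)
        - (1 - 2 * a) * (L * (1 - 2 * a))"
      unfolding D_def i lna(1) l by (simp add: algebra_simps power2_eq_square)
    then show ?thesis unfolding La by (simp add: algebra_simps)
  qed
  have up: "D b \<le> D c" if "b \<le> c" "0 < b" "c < 1" "\<And>x. b \<le> x \<Longrightarrow> x \<le> c \<Longrightarrow> 0 \<le> q x" for b c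
  proof (rule DERIV_nonneg_imp_nondecreasing[OF that(1)])
    fix x assume "b \<le> x" "x \<le> c"
    with dD[of x] that show "\<exists>y. (D has_real_derivative y) (at x) \<and> 0 \<le> y" by force
  qed
  have down: "D c \<le> D b" if "b \<le> c" "0 < b" "c < 1" "\<And>x. b \<le> x \<Longrightarrow> x \<le> c \<Longrightarrow> q x \<le> 0" for b c
  proof (rule DERIV_nonpos_imp_nonincreasing[OF that(1)])
    fix x assume "b \<le> x" "x \<le> c"
    with dD[of x] that show "\<exists>y. (D has_real_derivative y) (at x) \<and> y \<le> 0" by force
  qed
  \<comment> \<open>\<open>D\<close> rises from its zero at \<open>a\<close> up to 1/2, falls to its
    zero at \<open>1 - a\<close>, and rises again, so it is nonnegative throughout.\<close>
  consider "t \<le> 1/2" | "1/2 \<le> t" "t \<le> 1 - a" | "1 - a \<le> t" by linarith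
  then have "0 \<le> D t"
  proof cases
    case 1
    have "D a \<le> D t" using 1 t a(1,2) pos' by (intro up) (auto simp: a_def)
    then show ?thesis using Da by simp
  next
    case 2
    have "D (1 - a) \<le> D t" using 2 a(1,2) neg by (intro down) auto
    then show ?thesis using D1 by simp
  next
    case 3
    have "D (1 - a) \<le> D t" using 3 t False a(1,2) pos by (intro up) auto
    then show ?thesis using D1 by simp
  qed
  then show ?thesis by (simp add: D_def L_def a_def)
qed

text \<open>At \<open>\<theta> = 2\<close> and \<open>\<beta> = 2\<close> the interaction cancels
  the quadratic term, so a quartic remainder is needed to keep the uniform point the only maximiser.
  The coefficient 1 is below the Taylor coefficient 4/3.\<close>

lemma binary_entropy_quartic:
  fixes v :: real
  assumes v: "0 \<le> v" "v \<le> 1 / 2"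
  shows "2 * v\<^sup>2 + v ^ 4 \<le> (1/2 + v) * ln (1/2 + v) + (1/2 - v) * ln (1/2 - v) + ln 2"
proof (cases "v = 1 / 2")
  case True
  show ?thesis unfolding True using ln2_ge_two_thirds by (simp add: power_divide)
next
  case False
  let ?E = "\<lambda>v::real. (1/2 + v) * ln (1/2 + v) + (1/2 - v) * ln (1/2 - v) + ln 2 - 2 * v\<^sup>2 - v ^ 4"
  let ?E' = "\<lambda>v::real. ln (1/2 + v) - ln (1/2 - v) - 4 * v - 4 * v ^ 3"
  have E': "0 \<le> ?E' x" if x: "0 \<le> x" "x < 1 / 2" for x
  proof -
    have "?E' 0 \<le> ?E' x"
    proof (rule DERIV_nonneg_imp_nondecreasing[OF x(1)])
      fix y assume y: "0 \<le> y" "y \<le> x"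
      have "(?E' has_real_derivative 1 / (1/2 + y) + 1 / (1/2 - y) - 4 - 12 * y\<^sup>2) (at y)"
        using x y by (auto intro!: derivative_eq_intros)
      moreover have "0 \<le> 1 / (1/2 + y) + 1 / (1/2 - y) - 4 - 12 * y\<^sup>2"
      proof -
        have p: "0 < 1/4 - y\<^sup>2"
        proof -
          have "y\<^sup>2 < (1/2)\<^sup>2" using x y by (intro power_strict_mono) auto
          then show ?thesis by (simp add: power_divide)
        qed
        have "1 - (4 + 12 * w) * (1/4 - w) = w + 12 * (w * w)" for w :: real
          by (simp add: algebra_simps)
        from this[of "y\<^sup>2"] have "0 \<le> 1 - (4 + 12 * y\<^sup>2) * (1/4 - y\<^sup>2)" by simp
        then have "(4 + 12 * y\<^sup>2) * (1/4 - y\<^sup>2) \<le> 1" by simp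
        then have "4 + 12 * y\<^sup>2 \<le> 1 / (1/4 - y\<^sup>2)" using p by (simp add: pos_le_divide_eq)
        also have "\<dots> = 1 / (1/2 + y) + 1 / (1/2 - y)"
          using x y by (simp add: field_simps power2_eq_square)
        finally show ?thesis by simp
      qed
      ultimately show "\<exists>d. (?E' has_real_derivative d) (at y) \<and> 0 \<le> d" by blast
    qed
    then show ?thesis by simp
  qed
  have "?E 0 \<le> ?E v"
  proof (rule DERIV_nonneg_imp_nondecreasing[OF v(1)])
    fix x assume x: "0 \<le> x" "x \<le> v"
    have "(?E has_real_derivative ?E' x) (at x)"
      using x v False by (auto intro!: derivative_eq_intros simp: power2_eq_square)
    moreover have "0 \<le> ?E' x" using E'[of x] x v False by auto
    ultimately show "\<exists>d. (?E has_real_derivative d) (at x) \<and> 0 \<le> d" by blast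
  qed
  moreover have "?E 0 = 0" by (simp add: ln_div)
  ultimately show ?thesis by simp
qed

lemma binary_entropy_lt:
  fixes \<beta> :: real
  assumes "2 < \<beta>"
  obtains v where "0 < v" "v < 1 / 2"
    "(1/2 + v) * ln (1/2 + v) + (1/2 - v) * ln (1/2 - v) + ln 2 < \<beta> * v\<^sup>2"
proof -
  \<comment> \<open>The entropy deficit divided by \<open>v\<^sup>2\<close>, with both logarithms
    expanded about 1.\<close>
  let ?f = "\<lambda>v::real. ((1 + 2 * v) * ln (1 + 2 * v) + (1 - 2 * v) * ln (1 - 2 * v)) / (2 * v\<^sup>2)"
  have "(?f \<longlongrightarrow> 2) (at_right 0)" by real_asymp
  then have "eventually (\<lambda>v. ?f v < \<beta>) (at_right 0)" using assms by (rule order_tendstoD)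
  moreover have "eventually (\<lambda>v::real. 0 < v \<and> v < 1/2) (at_right 0)"
    by (auto simp: eventually_at_right_field intro!: exI[of _ "1/2"])
  ultimately have "eventually (\<lambda>v. ?f v < \<beta> \<and> 0 < v \<and> v < 1/2) (at_right 0)"
    by eventually_elim auto
  then obtain v where v: "?f v < \<beta>" "0 < v" "v < 1/2"
    using eventually_happens'[OF trivial_limit_at_right_real] by blast
  have "ln (1/2 + v) = ln ((1 + 2 * v) / 2)" "ln (1/2 - v) = ln ((1 - 2 * v) / 2)"
    by (simp_all add: field_simps)
  then have "ln (1/2 + v) = ln (1 + 2 * v) - ln 2" "ln (1/2 - v) = ln (1 - 2 * v) - ln 2"
    using v by (simp_all add: ln_div)
  moreover have "(1/2 + v) * (a - l) + (1/2 - v) * (b - l) + l = ((1 + 2 * v) * a + (1 - 2 * v) * b) / 2"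
    for a b l by (simp add: field_simps)
  ultimately have "(1/2 + v) * ln (1/2 + v) + (1/2 - v) * ln (1/2 - v) + ln 2
      = ((1 + 2 * v) * ln (1 + 2 * v) + (1 - 2 * v) * ln (1 - 2 * v)) / 2"
    by (simp only:)
  also have "\<dots> < \<beta> * v\<^sup>2" using v by (simp add: field_simps)
  finally show ?thesis using that v by blast
qed

section \<open>The phase transition\<close>

text \<open>Keep the largest entry \<open>t\<close> and replace the others by their mean
  \<open>s\<close>. The tangent gap at \<open>s\<close> controls the change, its linear terms
  cancelling in the sum; the vector with two values is then covered by
  \<open>two_value_log_ineq\<close> with \<open>k = \<theta> - 1\<close>.\<close>

lemma simplex_entropy_le:
  assumes x: "x \<in> prob_simplex \<theta>" and \<theta>: "3 \<le> \<theta>"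
  shows "entropy \<theta> x + (real \<theta> - 1) / (real \<theta> - 2) * ln (real \<theta> - 1) * ((\<Sum>i<\<theta>. (x i)\<^sup>2) - 1 / \<theta>) \<le> ln \<theta>"
proof -
  define k where "k = real \<theta> - 1"
  define B where "B = k * ln k / (k - 1)"
  have k: "1 < k" "real \<theta> = k + 1" using \<theta> by (auto simp: k_def)
  have \<theta>0: "0 < \<theta>" using \<theta> by simp
  obtain l where l: "l < \<theta>" "max_part \<theta> x = x l" using max_part_in[OF \<theta>0] by blast
  define t where "t = x l"
  define s where "s = (1 - t) / k"
  let ?I = "{..<\<theta>} - {l}"
  have xt: "x i \<le> t" "0 \<le> x i" if "i < \<theta>" for i
    using le_max_part[OF that, of x] l x that by (auto simp: t_def prob_simplex_def)
  have t: "1 / (k + 1) \<le> t" "t \<le> 1"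
    using max_part_simplex_ge[OF x \<theta>0] max_part_simplex_le_1[OF x \<theta>0] l k by (auto simp: t_def)
  have ts: "t + k * s = 1" "0 \<le> s" using k t by (auto simp: s_def)
  have st: "s \<le> t" using t k by (simp add: s_def field_simps)
  have sumI: "(\<Sum>i\<in>?I. x i) = 1 - t"
    using x l by (simp add: prob_simplex_def t_def sum.remove[of _ l])
  have cardI: "real (card ?I) = k" using l by (simp add: k_def of_nat_diff)
  \<comment> \<open>If \<open>s = 0\<close>, all the other entries vanish and both sides are
    0.\<close>
  have gap: "x i * ln s + x i - s + B * (x i - s)\<^sup>2 \<le> x i * ln (x i)" if i: "i \<in> ?I" for i
  proof (cases "s = 0")
    case True
    then have "(\<Sum>i\<in>?I. x i) = 0" using sumI ts by simp
    then have "x i = 0" using i xt by (subst (asm) sum_nonneg_eq_0_iff) auto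
    with True show ?thesis by simp
  next
    case False
    then have "0 < s" using ts by simp
    from mult_ln_tangent_gap[OF k(1) this st ts(1), of "x i"] i xt show ?thesis
      by (simp add: B_def)
  qed
  have "(1 - t) * ln s + B * ((\<Sum>i\<in>?I. (x i)\<^sup>2) - k * s\<^sup>2)
      = (\<Sum>i\<in>?I. x i * ln s + x i - s + B * (x i - s)\<^sup>2)"
  proof -
    have "(\<Sum>i\<in>?I. x i * ln s + x i - s + B * (x i - s)\<^sup>2) =
      (\<Sum>i\<in>?I. x i * (ln s + 1 - 2 * B * s) + B * (x i)\<^sup>2 + (B * s\<^sup>2 - s))"
      by (intro sum.cong) (auto simp: algebra_simps power2_eq_square)
    also have "\<dots> = (\<Sum>i\<in>?I. x i) * (ln s + 1 - 2 * B * s) + B * (\<Sum>i\<in>?I. (x i)\<^sup>2) + real (card ?I) * (B * s\<^sup>2 - s)"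
      by (simp only: sum.distrib sum_distrib_left sum_distrib_right sum_constant)
    also have "\<dots> = (1 - t) * ln s + B * ((\<Sum>i\<in>?I. (x i)\<^sup>2) - k * s\<^sup>2)"
    proof -
      have e: "1 - t = k * s" using ts by simp
      show ?thesis unfolding sumI cardI e by (simp add: algebra_simps power2_eq_square)
    qed
    finally show ?thesis by simp
  qed
  also have "\<dots> \<le> (\<Sum>i\<in>?I. x i * ln (x i))" by (rule sum_mono) (rule gap)
  finally have 1: "(1 - t) * ln s + B * ((\<Sum>i\<in>?I. (x i)\<^sup>2) - k * s\<^sup>2) \<le> (\<Sum>i\<in>?I. x i * ln (x i))" .
  have 2: "B * (t\<^sup>2 + k * s\<^sup>2 - 1 / (k + 1)) \<le> t * ln t + (1 - t) * ln s + ln (k + 1)"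
  proof -
    have "B * (t\<^sup>2 + k * s\<^sup>2 - 1 / (k + 1)) = (k + 1) * ln k / (k - 1) * (t - 1 / (k + 1))\<^sup>2"
    proof -
      have "k * s\<^sup>2 = (1 - t)\<^sup>2 / k" using k by (simp add: s_def power2_eq_square)
      moreover define a where "a = 1 / (k + 1)"
      have "(k + 1) * a = 1" using k by (simp add: a_def)
      then have "k * t\<^sup>2 + (1 - t)\<^sup>2 - k * a = (k + 1) * (t - a)\<^sup>2" by algebra
      then have "(k * t\<^sup>2 + (1 - t)\<^sup>2 - k * a) / k = (k + 1) / k * (t - a)\<^sup>2" by simp
      moreover have "(k * t\<^sup>2 + (1 - t)\<^sup>2 - k * a) / k = t\<^sup>2 + (1 - t)\<^sup>2 / k - a"
        using k by (simp add: add_divide_distrib diff_divide_distrib)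
      ultimately have "t\<^sup>2 + k * s\<^sup>2 - 1 / (k + 1) = (k + 1) / k * (t - 1 / (k + 1))\<^sup>2"
        by (simp only: a_def)
      then show ?thesis using k by (simp add: B_def)
    qed
    then show ?thesis using two_value_log_ineq[OF k(1) t] by (simp add: s_def)
  qed
  have "entropy \<theta> x = - (t * ln t + (\<Sum>i\<in>?I. x i * ln (x i)))"
    using l by (simp add: entropy_def t_def sum.remove[of _ l])
  moreover have "(\<Sum>i<\<theta>. (x i)\<^sup>2) = t\<^sup>2 + (\<Sum>i\<in>?I. (x i)\<^sup>2)"
    using l by (simp add: t_def sum.remove[of _ l])
  moreover have "B * (t\<^sup>2 + (\<Sum>i\<in>?I. (x i)\<^sup>2) - 1 / (k + 1))
      = B * (t\<^sup>2 + k * s\<^sup>2 - 1 / (k + 1)) + B * ((\<Sum>i\<in>?I. (x i)\<^sup>2) - k * s\<^sup>2)"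
    by (simp add: algebra_simps)
  moreover have "(real \<theta> - 1) / (real \<theta> - 2) * ln (real \<theta> - 1) = B" "ln (real \<theta>) = ln (k + 1)" "1 / real \<theta> = 1 / (k + 1)"
    by (auto simp: B_def k_def)
  ultimately show ?thesis using 1 2 by simp
qed

lemma simplex_entropy_le_2:
  assumes x: "x \<in> prob_simplex 2"
  shows "entropy 2 x + ((\<Sum>i<2. (x i)\<^sup>2) - 1 / 2) + (max_part 2 x - 1 / 2) ^ 4 \<le> ln 2"
proof -
  obtain l where l: "l < 2" "max_part 2 x = x l" using max_part_in[of 2 x] by auto
  define v where "v = x l - 1 / 2"
  have v: "0 \<le> v" "v \<le> 1 / 2"
    using max_part_simplex_ge[OF x] max_part_simplex_le_1[OF x] l by (auto simp: v_def)
  have sum: "x 0 + x 1 = 1" using x by (simp add: prob_simplex_def numeral_2_eq_2)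
  have "l = 0 \<or> l = 1" using l by auto
  then have *: "entropy 2 x = - ((1/2 + v) * ln (1/2 + v) + (1/2 - v) * ln (1/2 - v))
      \<and> (\<Sum>i<2. (x i)\<^sup>2) = (1/2 + v)\<^sup>2 + (1/2 - v)\<^sup>2"
  proof
    assume "l = 0"
    then have "x 0 = 1/2 + v" "x 1 = 1/2 - v" using sum by (auto simp: v_def)
    then show ?thesis by (simp add: entropy_def numeral_2_eq_2)
  next
    assume "l = 1"
    then have "x 0 = 1/2 - v" "x 1 = 1/2 + v" using sum by (auto simp: v_def)
    then show ?thesis by (simp add: entropy_def numeral_2_eq_2)
  qed
  have "(1/2 + v)\<^sup>2 + (1/2 - v)\<^sup>2 - 1 / 2 = 2 * v\<^sup>2" by (simp add: algebra_simps power2_eq_square)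
  moreover have "max_part 2 x - 1 / 2 = v" using l by (simp add: v_def)
  ultimately show ?thesis using * binary_entropy_quartic[OF v] by simp
qed

lemma simplex_variance_ge:
  assumes x: "x \<in> prob_simplex \<theta>" and \<theta>: "0 < \<theta>"
  shows "(max_part \<theta> x - 1 / \<theta>)\<^sup>2 \<le> (\<Sum>i<\<theta>. (x i)\<^sup>2) - 1 / \<theta>"
proof -
  obtain l where l: "l < \<theta>" "max_part \<theta> x = x l" using max_part_in[OF \<theta>] by blast
  have "(x l - 1 / \<theta>)\<^sup>2 \<le> (\<Sum>i<\<theta>. (x i - 1 / \<theta>)\<^sup>2)"
    using l by (intro member_le_sum) auto
  also have "\<dots> = (\<Sum>i<\<theta>. (x i)\<^sup>2 - 2 / \<theta> * x i + (1 / \<theta>)\<^sup>2)"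
    by (intro sum.cong) (auto simp: power2_diff)
  also have "\<dots> = (\<Sum>i<\<theta>. (x i)\<^sup>2) - 2 / \<theta> * (\<Sum>i<\<theta>. x i) + \<theta> * (1 / \<theta>)\<^sup>2"
    by (simp only: sum.distrib sum_subtractf sum_distrib_left sum_constant card_lessThan)
  also have "\<dots> = (\<Sum>i<\<theta>. (x i)\<^sup>2) - 1 / \<theta>"
    using x \<theta> by (simp add: prob_simplex_def power2_eq_square field_simps)
  finally show ?thesis using l by simp
qed

section \<open>The free energy against its value at the uniform vector\<close>

lemma free_energy_uniform:
  "0 < \<theta> \<Longrightarrow> free_energy \<theta> \<beta> h (\<lambda>_. 1 / real \<theta>) = ln \<theta> + \<beta> / (2 * real \<theta>) + h / \<theta>"
  by (simp add: free_energy_def entropy_uniform max_part_const power2_eq_square)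

lemma beta_c_ge_3:
  assumes "3 \<le> \<theta>"
  shows "beta_c \<theta> = 2 * ((real \<theta> - 1) / (real \<theta> - 2) * ln (real \<theta> - 1))"
  using assms unfolding beta_c_def by simp

text \<open>The exponent 4 is dictated by the critical case \<open>\<theta> = 2\<close>. For
  \<open>\<theta> \<ge> 3\<close> a quadratic gap is available and implies the quartic one, since
  the deviation is at most 1.\<close>

lemma free_energy_subcritical:
  assumes \<theta>: "2 \<le> \<theta>" and \<beta>: "\<beta> < beta_c \<theta> \<or> \<theta> = 2 \<and> \<beta> = beta_c \<theta>"
  obtains c where "0 < c" "\<And>x. x \<in> prob_simplex \<theta> \<Longrightarrow>
    free_energy \<theta> \<beta> 0 x \<le> ln \<theta> + \<beta> / (2 * real \<theta>) - c * (max_part \<theta> x - 1 / \<theta>) ^ 4"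
proof (cases "\<theta> = 2")
  case True
  have b: "\<beta> \<le> 2" using \<beta> True by (auto simp: beta_c_def)
  have "free_energy \<theta> \<beta> 0 x \<le> ln \<theta> + \<beta> / (2 * real \<theta>) - 1 * (max_part \<theta> x - 1 / \<theta>) ^ 4"
    if x: "x \<in> prob_simplex \<theta>" for x
  proof -
    let ?s = "\<Sum>i<\<theta>. (x i)\<^sup>2"
    have "0 \<le> ?s - 1 / \<theta>"
      using simplex_variance_ge[OF x] \<theta> zero_le_power2[of "max_part \<theta> x - 1 / \<theta>"] by linarith
    then have "\<beta> / 2 * (?s - 1 / \<theta>) \<le> 1 * (?s - 1 / \<theta>)"
      using b by (intro mult_right_mono) auto
    moreover have "entropy \<theta> x + (?s - 1 / \<theta>) + (max_part \<theta> x - 1 / \<theta>) ^ 4 \<le> ln \<theta>"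
      using simplex_entropy_le_2[of x] x True by simp
    ultimately show ?thesis by (simp add: free_energy_def algebra_simps)
  qed
  then show ?thesis using that[of 1] by simp
next
  case False
  then have \<theta>3: "3 \<le> \<theta>" using \<theta> by simp
  define B where "B = (real \<theta> - 1) / (real \<theta> - 2) * ln (real \<theta> - 1)"
  define c where "c = B - \<beta> / 2"
  have c: "0 < c" using \<beta> False beta_c_ge_3[OF \<theta>3] unfolding c_def B_def[symmetric] by linarith
  have "free_energy \<theta> \<beta> 0 x \<le> ln \<theta> + \<beta> / (2 * real \<theta>) - c * (max_part \<theta> x - 1 / \<theta>) ^ 4"
    if x: "x \<in> prob_simplex \<theta>" for x
  proof -
    let ?s = "\<Sum>i<\<theta>. (x i)\<^sup>2"
    let ?v = "max_part \<theta> x - 1 / \<theta>"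
    have "0 \<le> 1 / real \<theta>" by simp
    then have "0 \<le> ?v" "?v \<le> 1"
      using max_part_simplex_ge[OF x] max_part_simplex_le_1[OF x] \<theta> by linarith+
    then have "?v ^ 4 \<le> ?v\<^sup>2" by (intro power_decreasing) auto
    also have "\<dots> \<le> ?s - 1 / \<theta>" using simplex_variance_ge[OF x] \<theta> by simp
    finally have "c * ?v ^ 4 \<le> c * (?s - 1 / \<theta>)" using c by (intro mult_left_mono) auto
    moreover have "entropy \<theta> x + B * (?s - 1 / \<theta>) \<le> ln \<theta>"
      unfolding B_def by (rule simplex_entropy_le[OF x \<theta>3])
    ultimately show ?thesis by (simp add: free_energy_def c_def algebra_simps)
  qed
  with c that show ?thesis by blast
qed

text \<open>At \<open>\<beta> = beta_c \<theta>\<close> the free energy of this point equals that of the uniform point.\<close>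
lemma free_energy_critical_point:
  assumes \<theta>: "3 \<le> \<theta>"
  obtains x where "x \<in> prob_simplex \<theta>" "1 / \<theta> < max_part \<theta> x"
    "free_energy \<theta> \<beta> 0 x = ln \<theta> + \<beta> / (2 * real \<theta>) + (\<beta> - beta_c \<theta>) / 2 * ((real \<theta> - 2)\<^sup>2 / (\<theta> * (real \<theta> - 1)))"
proof -
  define k where "k = real \<theta> - 1"
  have k: "1 < k" "real \<theta> = k + 1" using \<theta> by (auto simp: k_def)
  \<comment> \<open>The second equality case of \<open>two_value_log_ineq\<close>: largest entry
    \<open>k / (k + 1)\<close>, the rest equal.\<close>
  define x where "x = (\<lambda>i::nat. if i = 0 then k / (k + 1) else 1 / (k * (k + 1)))"
  have split: "(\<Sum>i<\<theta>. f (x i)) = f (k / (k + 1)) + k * f (1 / (k * (k + 1)))" for f :: "real \<Rightarrow> real"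
  proof -
    have "(\<Sum>i<\<theta>. f (x i)) = f (x 0) + (\<Sum>i\<in>{..<\<theta>} - {0}. f (x i))"
      using \<theta> by (intro sum.remove) auto
    also have "(\<Sum>i\<in>{..<\<theta>} - {0}. f (x i)) = (\<Sum>i\<in>{..<\<theta>} - {0}. f (1 / (k * (k + 1))))"
      by (intro sum.cong) (auto simp: x_def)
    also have "\<dots> = k * f (1 / (k * (k + 1)))"
      using \<theta> by (simp add: k_def of_nat_diff)
    finally show ?thesis by (simp add: x_def)
  qed
  have "k * (1 / (k * (k + 1))) = 1 / (k + 1)" using k by simp
  then have "(\<Sum>i<\<theta>. x i) = 1"
    using split[of "\<lambda>y. y"] k by (simp add: add_divide_distrib[symmetric])
  moreover have "0 \<le> x i" for i using k by (simp add: x_def)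
  ultimately have simp: "x \<in> prob_simplex \<theta>" by (simp add: prob_simplex_def)
  have "1 / \<theta> < k / (k + 1)" using k by (simp add: field_simps)
  also have "\<dots> \<le> max_part \<theta> x" using le_max_part[of 0 \<theta> x] \<theta> by (simp add: x_def)
  finally have max: "1 / \<theta> < max_part \<theta> x" .
  have ent: "entropy \<theta> x = ln (k + 1) - (k - 1) / (k + 1) * ln k"
  proof -
    have "entropy \<theta> x = - (k / (k + 1) * (ln k - ln (k + 1)) + k * (1 / (k * (k + 1)) * (- ln k - ln (k + 1))))"
      unfolding entropy_def split[of "\<lambda>y. y * ln y"] using k by (simp add: ln_div ln_mult)
    also have "\<dots> = ln (k + 1) - (k - 1) / (k + 1) * ln k"
    proof -
      have "k * (1 / (k * (k + 1)) * y) = y / (k + 1)" for y using k by simp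
      moreover have "- (k / (k + 1) * (a - b) + (- a - b) / (k + 1)) = b - (k - 1) / (k + 1) * a" for a b
      proof -
        define c where "c = 1 / (k + 1)"
        have "(k + 1) * c = 1" using k by (simp add: c_def)
        then have "- (k * c * (a - b) + (- a - b) * c) = b - (k - 1) * c * a" by algebra
        then show ?thesis by (simp add: c_def)
      qed
      ultimately show ?thesis by simp
    qed
    finally show ?thesis .
  qed
  have sq: "(\<Sum>i<\<theta>. (x i)\<^sup>2) = 1 / (k + 1) + (k - 1)\<^sup>2 / ((k + 1) * k)"
  proof -
    have "(\<Sum>i<\<theta>. (x i)\<^sup>2) = (k / (k + 1))\<^sup>2 + k * (1 / (k * (k + 1)))\<^sup>2" by (rule split)
    also have "k * (1 / (k * (k + 1)))\<^sup>2 = 1 / (k * (k + 1)\<^sup>2)"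
      using k by (simp add: power2_eq_square)
    also have "(k / (k + 1))\<^sup>2 = k ^ 3 / (k * (k + 1)\<^sup>2)"
      using k by (simp add: power_divide power2_eq_square power3_eq_cube)
    also have "k ^ 3 / (k * (k + 1)\<^sup>2) + 1 / (k * (k + 1)\<^sup>2) = (k ^ 3 + 1) / (k * (k + 1)\<^sup>2)"
      by (rule add_divide_distrib[symmetric])
    also have "k ^ 3 + 1 = (k + 1) * (k + (k - 1)\<^sup>2)"
      by (simp add: algebra_simps power2_eq_square power3_eq_cube)
    also have "(k + 1) * (k + (k - 1)\<^sup>2) / (k * (k + 1)\<^sup>2) = (k + (k - 1)\<^sup>2) / (k * (k + 1))"
      using k by (simp add: power2_eq_square)
    also have "\<dots> = 1 / (k + 1) + (k - 1)\<^sup>2 / ((k + 1) * k)"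
      using k by (simp add: add_divide_distrib mult.commute)
    finally show ?thesis .
  qed
  have bc: "beta_c \<theta> / 2 * ((k - 1)\<^sup>2 / ((k + 1) * k)) = (k - 1) / (k + 1) * ln k"
  proof -
    have k1: "real \<theta> - 2 = k - 1" by (simp add: k_def)
    have b: "beta_c \<theta> / 2 = k / (k - 1) * ln k"
      using beta_c_ge_3[OF \<theta>] unfolding k1 k_def[symmetric] by linarith
    show ?thesis unfolding b using k by (simp add: power2_eq_square)
  qed
  have "free_energy \<theta> \<beta> 0 x = ln (k + 1) + \<beta> / (2 * (k + 1)) + (\<beta> - beta_c \<theta>) / 2 * ((k - 1)\<^sup>2 / ((k + 1) * k))"
    unfolding free_energy_def ent sq using bc by (simp add: algebra_simps diff_divide_distrib)
  then have "free_energy \<theta> \<beta> 0 x = ln \<theta> + \<beta> / (2 * real \<theta>) + (\<beta> - beta_c \<theta>) / 2 * ((real \<theta> - 2)\<^sup>2 / (\<theta> * (real \<theta> - 1)))"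
    using k by simp
  with simp max that show ?thesis by blast
qed

text \<open>For \<open>\<theta> = 2\<close> a small perturbation of the uniform vector suffices; for
  \<open>\<theta> \<ge> 3\<close> the point that ties at criticality wins.\<close>

lemma free_energy_supercritical:
  assumes \<theta>: "2 \<le> \<theta>" and \<beta>: "beta_c \<theta> < \<beta>"
  obtains x where "x \<in> prob_simplex \<theta>" "ln \<theta> + \<beta> / (2 * real \<theta>) < free_energy \<theta> \<beta> 0 x"
proof (cases "\<theta> = 2")
  case True
  then have "2 < \<beta>" using \<beta> by (simp add: beta_c_def)
  then obtain v where v: "0 < v" "v < 1 / 2"
    "(1/2 + v) * ln (1/2 + v) + (1/2 - v) * ln (1/2 - v) + ln 2 < \<beta> * v\<^sup>2"
    by (rule binary_entropy_lt)
  define x where "x = (\<lambda>i::nat. if i = 0 then 1/2 + v else 1/2 - v)"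
  have "x \<in> prob_simplex 2" using v by (auto simp: prob_simplex_def x_def numeral_2_eq_2)
  moreover have "(1/2 + v)\<^sup>2 + (1/2 - v)\<^sup>2 = 1 / 2 + 2 * v\<^sup>2" by (simp add: algebra_simps power2_eq_square)
  then have "free_energy 2 \<beta> 0 x = - ((1/2 + v) * ln (1/2 + v) + (1/2 - v) * ln (1/2 - v)) + \<beta> / 4 + \<beta> * v\<^sup>2"
    by (simp add: free_energy_def entropy_def x_def numeral_2_eq_2 algebra_simps)
  ultimately show ?thesis using that[of x] v(3) True by simp
next
  case False
  then have \<theta>3: "3 \<le> \<theta>" using \<theta> by simp
  obtain x where x: "x \<in> prob_simplex \<theta>" "1 / \<theta> < max_part \<theta> x"
    "free_energy \<theta> \<beta> 0 x = ln \<theta> + \<beta> / (2 * real \<theta>) + (\<beta> - beta_c \<theta>) / 2 * ((real \<theta> - 2)\<^sup>2 / (\<theta> * (real \<theta> - 1)))"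
    by (rule free_energy_critical_point[OF \<theta>3])
  have "0 < (\<beta> - beta_c \<theta>) / 2 * ((real \<theta> - 2)\<^sup>2 / (\<theta> * (real \<theta> - 1)))"
    using \<beta> \<theta>3 by (intro mult_pos_pos divide_pos_pos) auto
  with x that show ?thesis by simp
qed

section \<open>The right derivative in the field\<close>

lemma free_energy_split: "free_energy \<theta> \<beta> h x = free_energy \<theta> \<beta> 0 x + h * max_part \<theta> x"
  by (simp add: free_energy_def)

lemma z_quotient:
  assumes "0 < \<theta>" "0 < \<beta>" "0 < h"
  shows "(z \<theta> \<beta> h - z \<theta> \<beta> 0) / h = (max_free_energy \<theta> \<beta> h - max_free_energy \<theta> \<beta> 0) / h - 1 / \<theta>"
proof -
  have "z \<theta> \<beta> h - z \<theta> \<beta> 0 = max_free_energy \<theta> \<beta> h - max_free_energy \<theta> \<beta> 0 - h / \<theta>"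
    using assms by (simp add: z_eq)
  then show ?thesis using assms by (simp add: diff_divide_distrib)
qed

text \<open>A supremum of functions affine in \<open>h\<close> is convex, so its difference
  quotients at 0 increase.\<close>

lemma max_free_energy_quotient_mono:
  assumes \<theta>: "0 < \<theta>" and \<beta>: "0 \<le> \<beta>" and h: "0 < h" "h \<le> h'"
  shows "(max_free_energy \<theta> \<beta> h - max_free_energy \<theta> \<beta> 0) / h
    \<le> (max_free_energy \<theta> \<beta> h' - max_free_energy \<theta> \<beta> 0) / h'"
proof -
  let ?l = "h / h'"
  have l: "0 \<le> ?l" "?l \<le> 1" "?l * h' = h" using h by auto
  have "max_free_energy \<theta> \<beta> h \<le> (1 - ?l) * max_free_energy \<theta> \<beta> 0 + ?l * max_free_energy \<theta> \<beta> h'"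
  proof (rule max_free_energy_le[OF \<theta>])
    fix x assume x: "x \<in> prob_simplex \<theta>"
    have "?l * (h' * max_part \<theta> x) = h * max_part \<theta> x"
      using l(3) by (simp only: mult.assoc[symmetric])
    then have "free_energy \<theta> \<beta> h x = (1 - ?l) * free_energy \<theta> \<beta> 0 x + ?l * free_energy \<theta> \<beta> h' x"
      unfolding free_energy_split[of \<theta> \<beta> h] free_energy_split[of \<theta> \<beta> h'] by (simp only: algebra_simps)
    also have "\<dots> \<le> (1 - ?l) * max_free_energy \<theta> \<beta> 0 + ?l * max_free_energy \<theta> \<beta> h'"
      using l(1,2) h x by (intro add_mono mult_left_mono free_energy_le_max \<theta> \<beta>) auto
    finally show "free_energy \<theta> \<beta> h x \<le> (1 - ?l) * max_free_energy \<theta> \<beta> 0 + ?l * max_free_energy \<theta> \<beta> h'" .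
  qed
  then have "max_free_energy \<theta> \<beta> h - max_free_energy \<theta> \<beta> 0
      \<le> ?l * (max_free_energy \<theta> \<beta> h' - max_free_energy \<theta> \<beta> 0)"
    by (simp only: algebra_simps)
  then show ?thesis using h by (simp add: pos_divide_le_eq mult.commute)
qed

lemma tendsto_at_right_mono:
  fixes f :: "real \<Rightarrow> real"
  assumes mono: "\<And>x y. 0 < x \<Longrightarrow> x \<le> y \<Longrightarrow> f x \<le> f y" and lb: "\<And>x. 0 < x \<Longrightarrow> b \<le> f x"
  obtains L where "b \<le> L" "(f \<longlongrightarrow> L) (at_right 0)"
proof
  let ?L = "INF x\<in>{0<..}. f x"
  have bdd: "bdd_below (f ` {0<..})" using lb by (intro bdd_belowI2[of _ b]) auto
  show "b \<le> ?L" using lb by (intro cINF_greatest) auto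
  show "(f \<longlongrightarrow> ?L) (at_right 0)"
  proof (rule order_tendstoI)
    fix a assume "a < ?L"
    then have "a < f x" if "0 < x" for x
      using cINF_lower[OF bdd, of x] that by auto
    then show "eventually (\<lambda>x. a < f x) (at_right 0)"
      by (auto simp: eventually_at_right_field intro!: exI[of _ 1])
  next
    fix a assume "?L < a"
    then obtain y where y: "0 < y" "f y < a" using cINF_less_iff[OF _ bdd, of a] by auto
    then have "f x < a" if "0 < x" "x < y" for x
      using mono[of x y] that by auto
    then show "eventually (\<lambda>x. f x < a) (at_right 0)"
      using y by (auto simp: eventually_at_right_field intro!: exI[of _ y])
  qed
qed

text \<open>Monotone quotients bounded below converge as \<open>h\<close> decreases to 0. Their
  lower bound \<open>1 / \<theta> + \<eta>\<close> leaves \<eta> after the normalisation subtracts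
  \<open>1 / \<theta>\<close>.\<close>

lemma z_right_derivative_pos:
  assumes \<theta>: "0 < \<theta>" and \<beta>: "0 < \<beta>" and \<eta>: "0 < \<eta>"
    and lb: "\<And>h. 0 < h \<Longrightarrow> max_free_energy \<theta> \<beta> 0 + h * (1 / \<theta> + \<eta>) \<le> max_free_energy \<theta> \<beta> h"
  shows "\<exists>L>0. ((\<lambda>h. (z \<theta> \<beta> h - z \<theta> \<beta> 0) / h) \<longlongrightarrow> L) (at_right 0)"
proof -
  let ?q = "\<lambda>h. (max_free_energy \<theta> \<beta> h - max_free_energy \<theta> \<beta> 0) / h"
  have lbq: "1 / \<theta> + \<eta> \<le> ?q h" if "0 < h" for h
    using lb[OF that] that by (simp add: pos_le_divide_eq mult.commute)
  have monoq: "?q x \<le> ?q y" if "0 < x" "x \<le> y" for x y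
    using that \<beta> by (intro max_free_energy_quotient_mono \<theta>) auto
  obtain L where L: "1 / \<theta> + \<eta> \<le> L" "(?q \<longlongrightarrow> L) (at_right 0)"
    by (rule tendsto_at_right_mono[of ?q "1 / \<theta> + \<eta>", OF monoq lbq])
  have "((\<lambda>h. ?q h - 1 / \<theta>) \<longlongrightarrow> L - 1 / \<theta>) (at_right 0)"
    by (intro tendsto_diff L tendsto_const)
  moreover have "eventually (\<lambda>h. ?q h - 1 / \<theta> = (z \<theta> \<beta> h - z \<theta> \<beta> 0) / h) (at_right 0)"
    using z_quotient[OF \<theta> \<beta>] by (auto simp: eventually_at_right_field intro!: exI[of _ 1])
  ultimately have "((\<lambda>h. (z \<theta> \<beta> h - z \<theta> \<beta> 0) / h) \<longlongrightarrow> L - 1 / \<theta>) (at_right 0)"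
    by (rule Lim_transform_eventually)
  moreover have "0 < L - 1 / \<theta>" using L(1) \<eta> by simp
  ultimately show ?thesis by blast
qed

text \<open>Against the gap \<open>c * v ^ 4\<close>, a field \<open>h\<close> gains at most the
  maximum of \<open>h * v - c * v ^ 4\<close>, which is of smaller order than
  \<open>h\<close>.\<close>

lemma z_right_derivative_zero:
  assumes \<theta>: "2 \<le> \<theta>" and \<beta>: "0 < \<beta>" and sub: "\<beta> < beta_c \<theta> \<or> \<theta> = 2 \<and> \<beta> = beta_c \<theta>"
  shows "((\<lambda>h. (z \<theta> \<beta> h - z \<theta> \<beta> 0) / h) \<longlongrightarrow> 0) (at_right 0)"
proof -
  have \<theta>0: "0 < \<theta>" using \<theta> by simp
  let ?u = "ln \<theta> + \<beta> / (2 * real \<theta>)"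
  let ?q = "\<lambda>h. (z \<theta> \<beta> h - z \<theta> \<beta> 0) / h"
  obtain c where c: "0 < c" "\<And>x. x \<in> prob_simplex \<theta> \<Longrightarrow>
      free_energy \<theta> \<beta> 0 x \<le> ?u - c * (max_part \<theta> x - 1 / \<theta>) ^ 4"
    by (rule free_energy_subcritical[OF \<theta> sub]) blast
  have lower: "?u + h / \<theta> \<le> max_free_energy \<theta> \<beta> h" if "0 \<le> h" for h
    using free_energy_le_max[OF \<theta>0 _ that uniform_in_prob_simplex[OF \<theta>0], of \<beta>] \<beta>
    unfolding free_energy_uniform[OF \<theta>0] by simp
  \<comment> \<open>For \<open>v \<le> \<epsilon>\<close> the gain is at most
    \<open>h * \<epsilon>\<close>; beyond that, \<open>h \<le> c * \<epsilon> ^ 3\<close> lets the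
    quartic term win. Taking \<open>h = \<epsilon> = 0\<close> also gives the value at zero
    field.\<close>
  have upper: "max_free_energy \<theta> \<beta> h \<le> ?u + h / \<theta> + h * \<epsilon>"
    if h: "0 \<le> h" "h \<le> c * \<epsilon> ^ 3" and \<epsilon>: "0 \<le> \<epsilon>" for h \<epsilon>
  proof (rule max_free_energy_le[OF \<theta>0])
    fix x assume x: "x \<in> prob_simplex \<theta>"
    define v where "v = max_part \<theta> x - 1 / \<theta>"
    have v: "0 \<le> v" using max_part_simplex_ge[OF x \<theta>0] by (simp add: v_def)
    have "h * v - c * v ^ 4 \<le> h * \<epsilon>"
    proof (cases "v \<le> \<epsilon>")
      case True
      have "h * v \<le> h * \<epsilon>" using True h by (intro mult_left_mono) auto
      moreover have "0 \<le> c * v ^ 4" using c v by simp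
      ultimately show ?thesis by linarith
    next
      case False
      have "c * \<epsilon> ^ 3 \<le> c * v ^ 3" using False \<epsilon> c by (intro mult_left_mono power_mono) auto
      then have "v * (h - c * v ^ 3) \<le> 0" using h v by (intro mult_nonneg_nonpos) auto
      then have "h * v - c * v ^ 4 \<le> 0" by (simp add: algebra_simps power_eq_if)
      also have "0 \<le> h * \<epsilon>" using h \<epsilon> by simp
      finally show ?thesis .
    qed
    moreover have "free_energy \<theta> \<beta> h x \<le> ?u - c * v ^ 4 + h * (1 / \<theta> + v)"
      using c(2)[OF x] unfolding free_energy_split[of \<theta> \<beta> h] by (simp add: v_def)
    ultimately show "free_energy \<theta> \<beta> h x \<le> ?u + h / \<theta> + h * \<epsilon>" by (simp add: algebra_simps)
  qed
  have zero: "max_free_energy \<theta> \<beta> 0 = ?u"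
    using lower[of 0] upper[of 0 0] by simp
  have q: "?q h = (max_free_energy \<theta> \<beta> h - ?u - h / \<theta>) / h" if "0 < h" for h
    unfolding z_quotient[OF \<theta>0 \<beta> that] zero using that by (simp add: diff_divide_distrib)
  show ?thesis
  proof (rule order_tendstoI)
    fix a :: real assume a: "a < 0"
    have "a < ?q h" if "0 < h" for h
    proof -
      have "0 \<le> ?q h" unfolding q[OF that] using lower[of h] that by simp
      then show ?thesis using a by simp
    qed
    then show "eventually (\<lambda>h. a < ?q h) (at_right 0)"
      by (auto simp: eventually_at_right_field intro!: exI[of _ 1])
  next
    fix a :: real assume a: "0 < a"
    have "?q h < a" if h: "0 < h" "h < c * (a / 2) ^ 3" for h
    proof -
      have "?q h \<le> a / 2" unfolding q[OF h(1)]
        using upper[of h "a / 2"] h a by (simp add: pos_divide_le_eq mult.commute)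
      then show ?thesis using a by linarith
    qed
    moreover have "0 < c * (a / 2) ^ 3" using c a by simp
    ultimately show "eventually (\<lambda>h. ?q h < a) (at_right 0)"
      unfolding eventually_at_right_field by blast
  qed
qed

text \<open>Near-maximisers at zero field stay away from the uniform vector, so the field gains a
  fixed extra amount per unit. Working with near-maximisers avoids a compactness argument.\<close>

lemma max_free_energy_supercritical:
  assumes \<theta>: "2 \<le> \<theta>" and \<beta>: "0 < \<beta>" "beta_c \<theta> < \<beta>"
  obtains \<eta> where "0 < \<eta>"
    "\<And>h. 0 < h \<Longrightarrow> max_free_energy \<theta> \<beta> 0 + h * (1 / \<theta> + \<eta>) \<le> max_free_energy \<theta> \<beta> h"
proof -
  have \<theta>0: "0 < \<theta>" using \<theta> by simp
  let ?u = "ln \<theta> + \<beta> / (2 * real \<theta>)" and ?\<Phi> = "max_free_energy \<theta> \<beta>"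
  obtain y where y: "y \<in> prob_simplex \<theta>" "?u < free_energy \<theta> \<beta> 0 y"
    using free_energy_supercritical[OF \<theta> \<beta>(2)] .
  then have gap: "?u < ?\<Phi> 0" using free_energy_le_max[OF \<theta>0 _ _ y(1), of \<beta> 0] \<beta> by simp
  \<comment> \<open>Chosen so that a point whose largest entry is below
    \<open>1 / \<theta> + \<eta>\<close> reaches at most the midpoint of \<open>?u\<close> and
    \<open>?\<Phi> 0\<close>.\<close>
  define \<eta> where "\<eta> = (?\<Phi> 0 - ?u) / \<beta>"
  have \<eta>: "0 < \<eta>" "\<beta> * \<eta> = ?\<Phi> 0 - ?u" using gap \<beta> by (auto simp: \<eta>_def)
  have near: "1 / \<theta> + \<eta> \<le> max_part \<theta> x"
    if x: "x \<in> prob_simplex \<theta>" and "?\<Phi> 0 - (?\<Phi> 0 - ?u) / 2 < free_energy \<theta> \<beta> 0 x" for x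
  proof (rule ccontr)
    assume "\<not> ?thesis"
    then have "(\<Sum>i<\<theta>. (x i)\<^sup>2) \<le> 1 / \<theta> + \<eta>"
      using simplex_sum_squares_le[OF x] by linarith
    then have "\<beta> / 2 * (\<Sum>i<\<theta>. (x i)\<^sup>2) \<le> \<beta> / 2 * (1 / \<theta> + \<eta>)"
      using \<beta> by (intro mult_left_mono) auto
    then have "free_energy \<theta> \<beta> 0 x \<le> ?u + \<beta> * \<eta> / 2"
      using entropy_le[OF x \<theta>0] by (simp add: free_energy_def algebra_simps)
    also have "\<dots> = ?\<Phi> 0 - (?\<Phi> 0 - ?u) / 2" unfolding \<eta>(2) by (simp add: field_simps)
    finally show False using that by simp
  qed
  have "?\<Phi> 0 + h * (1 / \<theta> + \<eta>) \<le> ?\<Phi> h" if h: "0 < h" for h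
  proof (rule field_le_epsilon)
    fix e :: real assume e: "0 < e"
    define d where "d = min e ((?\<Phi> 0 - ?u) / 2)"
    have d: "0 < d" "d \<le> e" using e gap by (auto simp: d_def)
    have d': "d \<le> (?\<Phi> 0 - ?u) / 2" unfolding d_def by (rule min.cobounded2)
    have "\<exists>x\<in>prob_simplex \<theta>. ?\<Phi> 0 - d < free_energy \<theta> \<beta> 0 x"
    proof (rule ccontr)
      assume "\<not> ?thesis"
      then have "?\<Phi> 0 \<le> ?\<Phi> 0 - d" by (intro max_free_energy_le \<theta>0) (auto simp: not_less)
      then show False using d by simp
    qed
    then obtain x where x: "x \<in> prob_simplex \<theta>" "?\<Phi> 0 - d < free_energy \<theta> \<beta> 0 x" by blast
    have "h * (1 / \<theta> + \<eta>) \<le> h * max_part \<theta> x"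
      using near[OF x(1)] x(2) d' h by (intro mult_left_mono) auto
    then have "?\<Phi> 0 - d + h * (1 / \<theta> + \<eta>) \<le> free_energy \<theta> \<beta> h x"
      using x(2) unfolding free_energy_split[of \<theta> \<beta> h] by simp
    also have "\<dots> \<le> ?\<Phi> h" using free_energy_le_max[OF \<theta>0 _ _ x(1)] \<beta> h by simp
    finally show "?\<Phi> 0 + h * (1 / \<theta> + \<eta>) \<le> ?\<Phi> h + e" using d by simp
  qed
  with \<eta>(1) that show ?thesis by blast
qed

text \<open>At criticality the uniform vector and the point of
  \<open>free_energy_critical_point\<close> tie as maximisers; a positive field favours the
  latter.\<close>

lemma max_free_energy_critical:
  assumes \<theta>: "3 \<le> \<theta>" and \<beta>: "0 < \<beta>" "\<beta> = beta_c \<theta>"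
  obtains \<eta> where "0 < \<eta>"
    "\<And>h. 0 < h \<Longrightarrow> max_free_energy \<theta> \<beta> 0 + h * (1 / \<theta> + \<eta>) \<le> max_free_energy \<theta> \<beta> h"
proof -
  have \<theta>0: "0 < \<theta>" using \<theta> by simp
  let ?u = "ln \<theta> + \<beta> / (2 * real \<theta>)" and ?\<Phi> = "max_free_energy \<theta> \<beta>"
  have "?\<Phi> 0 \<le> ?u"
  proof (rule max_free_energy_le[OF \<theta>0])
    fix x assume x: "x \<in> prob_simplex \<theta>"
    have b: "\<beta> / 2 = (real \<theta> - 1) / (real \<theta> - 2) * ln (real \<theta> - 1)"
      using beta_c_ge_3[OF \<theta>] \<beta>(2) by linarith
    have "entropy \<theta> x + \<beta> / 2 * ((\<Sum>i<\<theta>. (x i)\<^sup>2) - 1 / \<theta>) \<le> ln \<theta>"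
      unfolding b by (rule simplex_entropy_le[OF x \<theta>])
    then show "free_energy \<theta> \<beta> 0 x \<le> ?u" by (simp add: free_energy_def algebra_simps)
  qed
  moreover obtain x where x: "x \<in> prob_simplex \<theta>" "1 / \<theta> < max_part \<theta> x" "free_energy \<theta> \<beta> 0 x = ?u"
    using free_energy_critical_point[OF \<theta>, of \<beta>] \<beta>(2) by auto
  ultimately have "?\<Phi> 0 + h * (1 / \<theta> + (max_part \<theta> x - 1 / \<theta>)) \<le> ?\<Phi> h" if "0 < h" for h
    using free_energy_le_max[OF \<theta>0 _ _ x(1), of \<beta> h] free_energy_split[of \<theta> \<beta> h x] \<beta> that by simp
  with x(2) that show ?thesis by (metis diff_gt_0_iff_gt)
qed

theorem theorem1p2:
  fixes \<theta> :: nat and \<beta> :: real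
  assumes "\<theta> \<ge> 2" and "\<beta> > 0"
  shows "(\<beta> < beta_c \<theta> \<or> (\<theta> = 2 \<and> \<beta> = beta_c \<theta>) \<longrightarrow>
            ((\<lambda>h. (z \<theta> \<beta> h - z \<theta> \<beta> 0) / h) \<longlongrightarrow> 0) (at_right 0))
       \<and> (\<beta> > beta_c \<theta> \<or> (\<theta> \<ge> 3 \<and> \<beta> = beta_c \<theta>) \<longrightarrow>
            (\<exists>L>0. ((\<lambda>h. (z \<theta> \<beta> h - z \<theta> \<beta> 0) / h) \<longlongrightarrow> L) (at_right 0)))"
proof (intro conjI impI)
  assume "\<beta> < beta_c \<theta> \<or> (\<theta> = 2 \<and> \<beta> = beta_c \<theta>)"
  then show "((\<lambda>h. (z \<theta> \<beta> h - z \<theta> \<beta> 0) / h) \<longlongrightarrow> 0) (at_right 0)"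
    by (rule z_right_derivative_zero[OF assms])
next
  assume "\<beta> > beta_c \<theta> \<or> (\<theta> \<ge> 3 \<and> \<beta> = beta_c \<theta>)"
  then obtain \<eta> where "0 < \<eta>"
    "\<And>h. 0 < h \<Longrightarrow> max_free_energy \<theta> \<beta> 0 + h * (1 / \<theta> + \<eta>) \<le> max_free_energy \<theta> \<beta> h"
    using max_free_energy_supercritical[OF assms] max_free_energy_critical[of \<theta> \<beta>] assms(2) by metis
  then show "\<exists>L>0. ((\<lambda>h. (z \<theta> \<beta> h - z \<theta> \<beta> 0) / h) \<longlongrightarrow> L) (at_right 0)"
    using assms by (intro z_right_derivative_pos) auto
qed

end
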